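(* For all integers $s \ge k \ge 4$ we have $h_1^{(k)}(s) = g_k(s)+1$.
   Context: A $k$-graph is a $k$-uniform hypergraph; $K^{(k)}_N$ is the complete $k$-graph on $N$ vertices. For integers $2\le k<s<n$ and $2\le t\le \binom sk$, $r_k(s,t;n)$ is the minimum $N$ such that every red/blue coloring of the edges of $K^{(k)}_N$ contains a blue copy of $K^{(k)}_n$ or has a set of $s$ vertices containing at least $t$ red edges. For fixed $s,k$, $h_1^{(k)}(s)$ is the threshold value of $t$ at which $r_k(s,t;n)$ changes from polynomial growth in $n$ to super-polynomial growth: $h_1^{(k)}(s)$ is the least $t$ such that $r_k(s,t;n)$ is not bounded above by a polynomial in $n$. Equivalently, the claim asserts that $r_k(s,g_k(s);n)$ is polynomial in $n$ while $r_k(s,g_k(s)+1;n)$ is at least exponential in a power of $n$; in hypergraph language, there exist $C=C(k)>0$ and, for every $N>k$, an $N$-vertex $k$-graph with independence number at most $C\log N$ in which every $s$ vertices span at most $g_k(s)$ edges. The function $g_k$ is defined by: $g_k(s)=0$ for $0\le s<k$, and for $s\ge k\ge 3$, $g_k(s)=\max\left(\sum_{i=1}^k g_k(s_i)+\prod_{i=1}^k s_i\right)$, the maximum over all partitions $s_1+\dots+s_k=s$ into nonnegative integers with $s_i<s$ for each $i$. *)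

theory Defs
  imports Main
begin

text \<open>One recursion step: given the table L = [g_k(0),...,g_k(s-1)], compute g_k(s).
  Partitions s_1+...+s_k = s into nonnegative integers with every s_i < s are
  represented as lists of length k.\<close>

definition g_step :: "nat \<Rightarrow> nat \<Rightarrow> nat list \<Rightarrow> nat" where
  "g_step k s L = (if s < k then 0 else
     Max {sum_list (map (\<lambda>x. L ! x) xs) + prod_list xs | xs.
            length xs = k \<and> sum_list xs = s \<and> (\<forall>x\<in>set xs. x < s)})"

primrec g_table :: "nat \<Rightarrow> nat \<Rightarrow> nat list" where
  "g_table k 0 = [g_step k 0 []]"
| "g_table k (Suc m) = g_table k m @ [g_step k (Suc m) (g_table k m)]"

definition g :: "nat \<Rightarrow> nat \<Rightarrow> nat" where
  "g k s = g_table k s ! s"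

text \<open>Colourings of the complete k-graph on vertex set {..<N}: the set of red edges
  (a set of k-subsets); all other k-subsets are blue.\<close>
definition ramsey_prop :: "nat \<Rightarrow> nat \<Rightarrow> nat \<Rightarrow> nat \<Rightarrow> nat \<Rightarrow> bool" where
  "ramsey_prop k s t n N \<longleftrightarrow>
     (\<forall>red. red \<subseteq> {e. e \<subseteq> {..<N} \<and> card e = k} \<longrightarrow>
        (\<exists>V. V \<subseteq> {..<N} \<and> card V = n \<and> (\<forall>e. e \<subseteq> V \<and> card e = k \<longrightarrow> e \<notin> red))
      \<or> (\<exists>S. S \<subseteq> {..<N} \<and> card S = s \<and> t \<le> card {e \<in> red. e \<subseteq> S}))"

definition r :: "nat \<Rightarrow> nat \<Rightarrow> nat \<Rightarrow> nat \<Rightarrow> nat" where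
  "r k s t n = (LEAST N. ramsey_prop k s t n N)"

text \<open>r_k(s,t;n) is bounded above by a polynomial in n (for n > s); it must in particular
  exist (if no admissible N exists, r_k(s,t;n) is infinite).\<close>
definition poly_bounded_r :: "nat \<Rightarrow> nat \<Rightarrow> nat \<Rightarrow> bool" where
  "poly_bounded_r k s t \<longleftrightarrow>
     (\<exists>C d::nat. \<forall>n>s. (\<exists>N. ramsey_prop k s t n N) \<and> r k s t n \<le> C * n ^ d)"

definition h1 :: "nat \<Rightarrow> nat \<Rightarrow> nat" where
  "h1 k s = (LEAST t. 2 \<le> t \<and> \<not> poly_bounded_r k s t)"

end

theory Submission
  imports Defs "HOL-Analysis.Convex" "HOL-Library.Disjoint_Sets" "HOL-Combinatorics.Permutations"
begin

text \<open>Upper bound: in a \<open>k\<close>-graph on polynomially many vertices whose independence number is below \<open>n\<close>,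
  a random placement of disjoint parts of suitable polynomial sizes spans a dense \<open>k\<close>-partite piece.
  Replacing the coordinates one after the other by a set that is already rich in edges (induction on \<open>s\<close>,
  pigeonhole) yields the configuration that defines \<open>g_k(s)\<close>.

  Lower bound: every vertex gets a random role below \<open>k\<close> at each of polynomially many levels, every pair of
  vertices gets a random level, and the edges are the \<open>k\<close>-sets all of whose pairs have the same level and
  whose vertices have distinct roles at it. Packings of \<open>k\<close>-sets with at most one common vertex show that
  large sets are not independent. On \<open>s\<close> vertices the levels form edge-disjoint \<open>k\<close>-partite graphs whose
  \<open>k\<close>-cliques are counted. In a minimal counterexample all degrees are so large that every vertex has
  most of its neighbours at one level, which is then shown to be the same for all vertices.
  Relative to the roles at that level, the cliques of other levels that cross between parts are at
  most as many as the transversals that they destroy, and induction applies to the parts.\<close>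

section \<open>Products of balanced partitions\<close>

text \<open>The two bounds concern different functions: the dense side realises the maximum
  \<open>g\<close>, while the construction is bounded by \<open>gbal\<close>, the recursion
  restricted to balanced partitions. They meet because \<open>gbal k s \<le> g k s\<close>. Working
  with \<open>gbal\<close> gives access to increments. In a minimal counterexample on
  \<open>m + 1\<close> vertices every degree exceeds \<open>gbal_inc k m\<close>, hence also
  \<open>balprod_inc k m\<close>, the number of transversals of \<open>k - 1\<close> balanced parts
  with \<open>m - m div k\<close> vertices in total. Since \<open>balprod\<close> is convex, a
  neighbourhood divided between several levels cannot reach this number. The obstacle is to make
  this quantitative. With \<open>q = k - 1\<close> and \<open>u\<close> the tolerated deviation
  relative to \<open>b\<close>, the argument needs \<open>(1 + u) ^ (q + 1) \<le> u * q ^ q\<close>.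
  The best choice \<open>u = 1 / q\<close> turns this into
  \<open>(q + 1) ^ (q + 1) \<le> q ^ (2 * q)\<close>, which fails for \<open>q = 2\<close> and holds
  for \<open>q = 3\<close>; this is where \<open>k \<ge> 4\<close> enters. The construction has
  \<open>2 ^ w\<close> vertices, while the size \<open>n\<close> of the sets that must contain an
  edge is polynomial in \<open>w\<close>.\<close>

text \<open>The product of \<open>q\<close> naturals with sum \<open>z\<close> that differ by at most one, and its increment in \<open>z\<close>.\<close>

definition balprod :: "nat \<Rightarrow> nat \<Rightarrow> nat" where
  "balprod q z = (z div q + 1) ^ (z mod q) * (z div q) ^ (q - z mod q)"

definition balprod_inc :: "nat \<Rightarrow> nat \<Rightarrow> nat" where
  "balprod_inc q z = (z div q + 1) ^ (z mod q) * (z div q) ^ (q - 1 - z mod q)"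

lemma balprod_eq:
  assumes "0 < q" "i \<le> q"
  shows "balprod q (q * b + i) = (b + 1) ^ i * b ^ (q - i)"
proof (cases "i < q")
  case True
  then show ?thesis by (simp add: balprod_def)
next
  case False
  then have "i = q" using assms by simp
  then have "q * b + i = q * (b + 1)" by simp
  then show ?thesis using \<open>i = q\<close> assms by (simp add: balprod_def del: mult_Suc_right)
qed

lemma balprod_inc_eq:
  assumes "i < q"
  shows "balprod_inc q (q * b + i) = (b + 1) ^ i * b ^ (q - 1 - i)"
  using assms by (simp add: balprod_inc_def)

text \<open>Raising one of the smallest parts by one adds the product of the other
  \<open>q - 1\<close> parts.\<close>

lemma balprod_Suc:
  assumes "0 < q"
  shows "balprod q (Suc z) = balprod q z + balprod_inc q z"
proof -
  define b i where "b = z div q" and "i = z mod q"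
  have z: "z = q * b + i" and i: "i < q" using assms by (simp_all add: b_def i_def)
  have "balprod q (Suc z) = (b + 1) ^ Suc i * b ^ (q - Suc i)"
    using balprod_eq[of q "Suc i" b] i by (simp add: z)
  moreover have "balprod q z = (b + 1) ^ i * b ^ (q - i)" using balprod_eq[of q i b] i by (simp add: z)
  moreover have "b ^ (q - i) = b * b ^ (q - Suc i)"
    using i by (metis Suc_diff_Suc power_Suc)
  moreover have "balprod_inc q z = (b + 1) ^ i * b ^ (q - Suc i)"
    using balprod_inc_eq[OF i, of b] by (simp add: z)
  ultimately show ?thesis by (simp add: algebra_simps)
qed

text \<open>This is convexity of \<open>balprod\<close>, the property that penalises a neighbourhood
  divided between levels. When \<open>z\<close> passes to the next multiple of \<open>q\<close>,
  both increments equal \<open>(b + 1) ^ (q - 1)\<close>.\<close>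

lemma balprod_inc_le_Suc:
  assumes "0 < q"
  shows "balprod_inc q z \<le> balprod_inc q (Suc z)"
proof -
  define b i where "b = z div q" and "i = z mod q"
  have z: "z = q * b + i" and i: "i < q" using assms by (simp_all add: b_def i_def)
  show ?thesis
  proof (cases "Suc i < q")
    case True
    have "balprod_inc q (Suc z) = (b + 1) ^ Suc i * b ^ (q - 1 - Suc i)"
      using balprod_inc_eq[OF True, of b] by (simp add: z)
    moreover have "balprod_inc q z = (b + 1) ^ i * b ^ (q - 1 - i)"
      using balprod_inc_eq[OF i, of b] by (simp add: z)
    moreover have "b ^ (q - 1 - i) = b * b ^ (q - 1 - Suc i)"
      using True by (metis Suc_diff_Suc diff_Suc_eq_diff_pred power_Suc zero_less_diff Suc_lessD diff_diff_left plus_1_eq_Suc)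
    ultimately show ?thesis by (simp add: algebra_simps)
  next
    case False
    then have "q = Suc i" using i by simp
    then have "Suc z = q * (b + 1) + 0" using z by simp
    then have "balprod_inc q (Suc z) = (b + 1) ^ (q - 1)" using balprod_inc_eq[of 0 q "b + 1"] assms by simp
    moreover have "balprod_inc q z = (b + 1) ^ (q - 1)"
      using balprod_inc_eq[OF i, of b] \<open>q = Suc i\<close> by (simp add: z)
    ultimately show ?thesis by simp
  qed
qed

lemma balprod_inc_mono: "0 < q \<Longrightarrow> x \<le> y \<Longrightarrow> balprod_inc q x \<le> balprod_inc q y"
  by (rule lift_Suc_mono_le) (simp_all add: balprod_inc_le_Suc)

lemma balprod_mono: "0 < q \<Longrightarrow> x \<le> y \<Longrightarrow> balprod q x \<le> balprod q y"
  by (rule lift_Suc_mono_le) (simp_all add: balprod_Suc)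

lemma balprod_less: "z < q \<Longrightarrow> balprod q z = 0"
  by (simp add: balprod_def)

lemma balprod_mult: "0 < q \<Longrightarrow> balprod q (q * b) = b ^ q"
  using balprod_eq[of q 0 b] by simp

lemma balprod_convex:
  assumes "0 < q" "x \<le> y"
  shows "balprod q (x + d) + balprod q y \<le> balprod q x + balprod q (y + d)"
proof (induction d)
  case (Suc d)
  have "balprod_inc q (x + d) \<le> balprod_inc q (y + d)" using assms by (intro balprod_inc_mono) auto
  then show ?case using Suc assms by (simp add: balprod_Suc)
qed simp

lemma balprod_superadd:
  assumes "0 < q"
  shows "balprod q x + balprod q y \<le> balprod q (x + y)"
  using balprod_convex[OF assms, of 0 y x] assms by (simp add: balprod_less add.commute)

lemma sum_balprod_le:
  assumes "0 < q" "finite T"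
  shows "(\<Sum>t\<in>T. balprod q (z t)) \<le> balprod q (sum z T)"
  using assms(2)
proof (induction T rule: finite_induct)
  case (insert a T)
  then show ?case using balprod_superadd[OF assms(1), of "z a" "sum z T"] by simp
qed (use assms in \<open>simp add: balprod_less\<close>)

text \<open>By convexity the sum is largest when one argument reaches the cap \<open>A\<close> and
  the remaining mass is collected in a single other argument.\<close>

lemma sum_balprod_le_two:
  assumes q: "0 < q" and fin: "finite T" and le: "\<And>t. t \<in> T \<Longrightarrow> z t \<le> A"
    and S: "sum z T \<le> m" and A: "A \<le> m" "m \<le> 2 * A"
  shows "(\<Sum>t\<in>T. balprod q (z t)) \<le> balprod q A + balprod q (m - A)"
proof -
  \<comment> \<open>An invariant that survives adding elements one at a time: the mass seen so far
    fills one argument up to the cap, and the overflow goes into a second one.\<close>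
  have "(\<Sum>t\<in>T. balprod q (z t)) \<le> (if sum z T \<le> A then balprod q (sum z T) else balprod q A + balprod q (sum z T - A))"
    using fin le S
  proof (induction T rule: finite_induct)
    case (insert a T)
    let ?S = "sum z T"
    have IH: "(\<Sum>t\<in>T. balprod q (z t)) \<le> (if ?S \<le> A then balprod q ?S else balprod q A + balprod q (?S - A))"
      using insert by simp
    have za: "z a \<le> A" using insert.prems by simp
    consider "z a + ?S \<le> A" | "z a + ?S > A" "?S \<le> A" | "?S > A" by linarith
    then show ?case
    proof cases
      case 1
      then show ?thesis using IH insert.hyps balprod_superadd[OF q, of "z a" ?S] by simp
    next
      case 2
      \<comment> \<open>Convexity moves \<open>A - z a\<close> units from the old total
        \<open>?S\<close> to \<open>z a\<close>, which fills \<open>z a\<close> up to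
        \<open>A\<close>.\<close>
      have "balprod q (z a + ?S - A + (A - z a)) + balprod q (z a) \<le> balprod q (z a + ?S - A) + balprod q (z a + (A - z a))"
        using 2 za by (intro balprod_convex q) auto
      then have "balprod q ?S + balprod q (z a) \<le> balprod q (z a + ?S - A) + balprod q A"
        using 2 za by simp
      then show ?thesis using IH insert.hyps 2 by simp
    next
      case 3
      have "balprod q (z a) + balprod q (?S - A) \<le> balprod q (z a + ?S - A)"
        using balprod_superadd[OF q, of "z a" "?S - A"] 3 by simp
      then show ?thesis using IH insert.hyps 3 by simp
    qed
  qed (use q in \<open>simp add: balprod_less\<close>)
  also have "\<dots> \<le> balprod q A + balprod q (m - A)"
    using S A balprod_mono[OF q, of "sum z T" A] balprod_mono[OF q, of "sum z T - A" "m - A"] by (simp add: trans_le_add1)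
  finally show ?thesis .
qed

text \<open>Multiplied over a partition with average close to \<open>b\<close>, the exponents on the right add up to a constant.\<close>

lemma le_tangent:
  assumes "0 < b"
  shows "real a \<le> real b * (1 + 1 / real b) powi (int a - int b)"
proof (cases "b \<le> a")
  case True
  have "1 + real (a - b) * (1 / real b) \<le> (1 + 1 / real b) ^ (a - b)"
    by (rule Bernoulli_inequality) (simp add: order_trans[of _ 0])
  moreover have "(1 + 1 / real b) powi (int a - int b) = (1 + 1 / real b) ^ (a - b)"
    using True by (metis of_nat_diff power_int_of_nat)
  moreover have "real b * (1 + real (a - b) * (1 / real b)) = real a"
    using assms True by (simp add: field_simps of_nat_diff)
  ultimately show ?thesis
    by (metis mult_left_mono of_nat_0_le_iff)
next
  case False
  define n where "n = b - a"
  have e: "inverse (1 + 1 / real b) = 1 + (- 1 / (real b + 1))" using assms by (simp add: field_simps)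
  have "1 + real n * (- 1 / (real b + 1)) \<le> (1 + (- 1 / (real b + 1))) ^ n"
    by (rule Bernoulli_inequality) (simp add: field_simps)
  moreover have "(1 + 1 / real b) powi (int a - int b) = (1 + (- 1 / (real b + 1))) ^ n"
  proof -
    have "int a - int b = - int n" using False by (simp add: n_def)
    then show ?thesis by (simp only: power_int_minus power_int_of_nat e[symmetric] power_inverse)
  qed
  moreover have "real a \<le> real b * (1 + real n * (- 1 / (real b + 1)))"
    using False by (simp add: n_def field_simps of_nat_diff)
  ultimately show ?thesis
    by (smt (verit) mult_left_mono of_nat_0_le_iff)
qed

text \<open>AM-GM for integers. The exponential bound \<open>le_tangent\<close> is exact at
  \<open>b\<close> and at \<open>b + 1\<close>, so nothing is lost at the balanced partition and the
  product of the bounds is \<open>balprod\<close> itself.\<close>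

lemma prod_le_balprod:
  assumes fin: "finite I" and ne: "I \<noteq> {}"
  shows "(\<Prod>i\<in>I. a i) \<le> balprod (card I) (\<Sum>i\<in>I. a i)"
proof -
  define q z where "q = card I" and "z = (\<Sum>i\<in>I. a i)"
  define b i where "b = z div q" and "i = z mod q"
  have q: "0 < q" using fin ne by (simp add: q_def card_gt_0_iff)
  have z: "z = q * b + i" and i: "i < q" using q by (simp_all add: b_def i_def)
  show ?thesis
  proof (cases "b = 0")
    \<comment> \<open>The exponential bound has no meaning for \<open>b = 0\<close>, but then the
      sum is below \<open>q\<close> and some factor vanishes.\<close>
    case True
    then have "z < q" using z i by simp
    have "\<exists>j\<in>I. a j = 0"
    proof (rule ccontr)
      assume "\<not> ?thesis"
      then have "(\<Sum>j\<in>I. 1) \<le> (\<Sum>j\<in>I. a j)" by (intro sum_mono) (auto simp: Suc_le_eq)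
      then show False using \<open>z < q\<close> by (simp add: q_def z_def)
    qed
    then show ?thesis using fin by (metis le0 prod_zero_iff)
  next
    case False
    then have b: "0 < b" by simp
    let ?c = "1 + 1 / real b"
    have c: "?c \<noteq> 0" using b by (smt (verit) divide_pos_pos of_nat_0_less_iff)
    have "real (\<Prod>j\<in>I. a j) \<le> (\<Prod>j\<in>I. real b * ?c powi (int (a j) - int b))"
      unfolding of_nat_prod by (intro prod_mono) (use le_tangent[OF b] in auto)
    also have "\<dots> = real b ^ q * (\<Prod>j\<in>I. ?c powi (int (a j) - int b))"
      by (simp add: prod.distrib q_def)
    also have "(\<Prod>j\<in>I. ?c powi (int (a j) - int b)) = ?c powi (\<Sum>j\<in>I. int (a j) - int b)"
      using fin by (induction I rule: finite_induct) (simp_all add: power_int_add c)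
    also have "(\<Sum>j\<in>I. int (a j) - int b) = int i"
      using z by (simp add: sum_subtractf q_def z_def flip: of_nat_sum)
    also have "real b ^ q * ?c powi int i = real ((b + 1) ^ i * b ^ (q - i))"
    proof -
      have "real b ^ q = real b ^ (q - i) * real b ^ i" using i by (simp flip: power_add)
      moreover have "real b ^ i * ?c ^ i = (real b + 1) ^ i"
        using b by (simp add: field_simps flip: power_mult_distrib)
      ultimately show ?thesis by (simp add: mult.assoc mult.commute add.commute)
    qed
    finally have "(\<Prod>j\<in>I. a j) \<le> (b + 1) ^ i * b ^ (q - i)" by (simp only: of_nat_le_iff)
    then show ?thesis using balprod_eq[of q i b] q i z by (simp add: q_def z_def)
  qed
qed

text \<open>One more unit multiplies \<open>balprod\<close> by \<open>(c + 1) / c\<close> with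
  \<open>c = z div q\<close>, a ratio that decreases in \<open>c\<close>. The form without division
  also covers \<open>c = 0\<close>.\<close>

lemma balprod_step:
  assumes "0 < q" "z div q \<le> b"
  shows "balprod q z * (b + 1) \<le> balprod q (Suc z) * b"
proof -
  define c i where "c = z div q" and "i = z mod q"
  have z: "z = q * c + i" and i: "i < q" using assms by (simp_all add: c_def i_def)
  have "balprod q (Suc z) = (c + 1) ^ Suc i * c ^ (q - Suc i)"
    using balprod_eq[of q "Suc i" c] i by (simp add: z)
  moreover have "balprod q z = (c + 1) ^ i * c ^ (q - i)" using balprod_eq[of q i c] i by (simp add: z)
  moreover have "c ^ (q - i) = c * c ^ (q - Suc i)"
    using i by (metis Suc_diff_Suc power_Suc)
  moreover have "c * (b + 1) \<le> (c + 1) * b" using assms(2) c_def by simp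
  then have "(c * (b + 1)) * ((c + 1) ^ i * c ^ (q - Suc i)) \<le> ((c + 1) * b) * ((c + 1) ^ i * c ^ (q - Suc i))"
    by (rule mult_right_mono) simp
  ultimately show ?thesis by (simp only: power_Suc ac_simps)
qed

lemma balprod_steps:
  assumes "0 < q" "z + y \<le> q * (b + 1)"
  shows "balprod q z * (b + 1) ^ y \<le> balprod q (z + y) * b ^ y"
  using assms(2)
proof (induction y)
  case (Suc y)
  have "z + y < q * (b + 1)" using Suc.prems by linarith
  then have d: "(z + y) div q \<le> b"
    by (metis Suc_eq_plus1 less_Suc_eq_le less_mult_imp_div_less mult.commute)
  have "balprod q z * (b + 1) ^ Suc y = (balprod q z * (b + 1) ^ y) * (b + 1)" by (simp only: power_Suc ac_simps)
  also have "\<dots> \<le> balprod q (z + y) * b ^ y * (b + 1)" using Suc by (intro mult_right_mono) auto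
  also have "\<dots> = balprod q (z + y) * (b + 1) * b ^ y" by (simp only: ac_simps)
  also have "\<dots> \<le> balprod q (Suc (z + y)) * b * b ^ y" using balprod_step[OF assms(1) d] by (rule mult_right_mono) simp
  finally show ?case by (simp add: ac_simps)
qed simp

text \<open>Every factor divided by the mean \<open>z / q\<close> is bounded through
  \<open>1 + x \<le> exp x\<close>; the deviations from the mean add up to zero, so the exponents
  cancel.\<close>

lemma balprod_le_power:
  assumes "0 < q"
  shows "real (balprod q z) \<le> (real z / real q) ^ q"
proof (cases "z = 0")
  case True
  then show ?thesis using assms by (simp add: balprod_less)
next
  case False
  define b i where "b = z div q" and "i = z mod q"
  have z: "z = q * b + i" and i: "i < q" using assms by (simp_all add: b_def i_def)
  have zp: "0 < real z" using False by simp
  have e1: "(real b + 1) * q / z \<le> exp ((real q - real i) / z)"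
  proof -
    have "(real b + 1) * q / z = 1 + (real q - real i) / z" using zp by (simp add: z field_simps)
    then show ?thesis using exp_ge_add_one_self by simp
  qed
  have e2: "real b * q / z \<le> exp (- (real i / z))"
  proof -
    have "real b * q / z = 1 + - (real i / z)" using zp by (simp add: z field_simps)
    then show ?thesis using exp_ge_add_one_self by metis
  qed
  have "((real b + 1) * q / z) ^ i * (real b * q / z) ^ (q - i)
      \<le> exp ((real q - real i) / z) ^ i * exp (- (real i / z)) ^ (q - i)"
    using e1 e2 by (intro mult_mono power_mono) auto
  also have "\<dots> = exp (real i * ((real q - real i) / z) + real (q - i) * (- (real i / z)))"
    by (simp only: exp_add exp_of_nat_mult)
  also have "\<dots> = 1" using i by (simp add: of_nat_diff)
  finally have "((real b + 1) * q / z) ^ i * (real b * q / z) ^ (q - i) \<le> 1" .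
  moreover have "((real b + 1) * q / z) ^ i * (real b * q / z) ^ (q - i) = real (balprod q z) / (real z / real q) ^ q"
  proof -
    define A where "A = real z / real q"
    have *: "x * real q / real z = x / A" for x by (simp add: A_def)
    have "A ^ q = A ^ i * A ^ (q - i)" using i by (simp flip: power_add)
    moreover have "balprod q z = (b + 1) ^ i * b ^ (q - i)" using balprod_eq[of q i b] i assms by (simp add: z)
    ultimately show ?thesis unfolding * A_def[symmetric]
      by (simp add: power_divide add.commute)
  qed
  moreover have "(real z / real q) ^ q > 0" using zp assms by simp
  ultimately show ?thesis by (metis divide_le_eq_1_pos)
qed

section \<open>The recursion along balanced partitions\<close>

text \<open>The increments of \<open>gbal\<close>, which is \<open>g\<close> with the maximum replaced by the value at the balanced partition.\<close>

fun gbal_inc :: "nat \<Rightarrow> nat \<Rightarrow> nat" where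
  "gbal_inc k m = (if m = 0 \<or> k < 2 then 0 else gbal_inc k (m div k) + balprod_inc k m)"

declare gbal_inc.simps [simp del]

definition gbal :: "nat \<Rightarrow> nat \<Rightarrow> nat" where
  "gbal k s = (\<Sum>m<s. gbal_inc k m)"

lemma gbal_Suc: "gbal k (Suc s) = gbal k s + gbal_inc k s"
  by (simp add: gbal_def)

lemma gbal_0 [simp]: "gbal k 0 = 0"
  by (simp add: gbal_def)

lemma gbal_inc_eq:
  assumes "2 \<le> k"
  shows "gbal_inc k m = gbal_inc k (m div k) + balprod_inc k m"
  using assms by (cases "m = 0") (simp_all add: gbal_inc.simps[of k m] balprod_inc_def gbal_inc.simps[of k 0])

lemma balprod_inc_le_gbal_inc: "2 \<le> k \<Longrightarrow> balprod_inc k m \<le> gbal_inc k m"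
  by (subst gbal_inc_eq) auto

text \<open>Adding a vertex to a balanced partition of \<open>m\<close> enlarges a part of size
  \<open>m div k\<close>: the sum over the parts grows by \<open>gbal_inc k (m div k)\<close> and
  the product by \<open>balprod_inc k m\<close>. This is the origin of the recursion for
  \<open>gbal_inc\<close>.\<close>

lemma gbal_balanced:
  assumes k: "2 \<le> k" and "i \<le> k"
  shows "gbal k (k * b + i) = i * gbal k (b + 1) + (k - i) * gbal k b + balprod k (k * b + i)"
proof -
  \<comment> \<open>The identity spreads from \<open>k * b\<close> to \<open>k * b + i\<close>; the
    case \<open>i = k\<close> reaches the next multiple of \<open>k\<close> and drives the outer
    induction on \<open>b\<close>.\<close>
  have step: "gbal k (k * b + i) = i * gbal k (b + 1) + (k - i) * gbal k b + balprod k (k * b + i)"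
    if "gbal k (k * b) = k * gbal k b + balprod k (k * b)" "i \<le> k" for b i
    using that(2)
  proof (induction i)
    case (Suc i)
    have 1: "gbal_inc k (k * b + i) = gbal_inc k b + balprod_inc k (k * b + i)"
      using Suc.prems gbal_inc_eq[OF k, of "k * b + i"] by simp
    have 2: "balprod k (k * b + Suc i) = balprod k (k * b + i) + balprod_inc k (k * b + i)"
      using balprod_Suc[of k "k * b + i"] k by simp
    have 3: "(k - i) * gbal k b = (k - Suc i) * gbal k b + gbal k b"
      using Suc.prems by (metis Suc_diff_Suc Suc_le_lessD add.commute mult_Suc)
    have IH: "gbal k (k * b + i) = i * gbal k (b + 1) + (k - i) * gbal k b + balprod k (k * b + i)"
      using Suc by simp
    have "gbal k (k * b + Suc i) = i * gbal k (b + 1) + (k - i) * gbal k b + balprod k (k * b + i) + gbal_inc k b + balprod_inc k (k * b + i)"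
      using IH 1 by (simp add: gbal_Suc)
    also have "\<dots> = i * gbal k (b + 1) + (gbal k b + gbal_inc k b) + (k - Suc i) * gbal k b + balprod k (k * b + Suc i)"
      using 2 3 by simp
    also have "gbal k b + gbal_inc k b = gbal k (b + 1)" by (simp add: gbal_Suc)
    finally show ?case by simp
  qed (use that in simp)
  have "gbal k (k * b) = k * gbal k b + balprod k (k * b)" for b
  proof (induction b)
    case (Suc b)
    show ?case using step[OF Suc, of k] by (simp add: algebra_simps)
  qed (use k in \<open>simp add: balprod_less\<close>)
  then show ?thesis using step assms by blast
qed

text \<open>Bounds the second difference of \<open>gbal\<close> by a product of \<open>k - 2\<close>
  sizes, the order of magnitude that a transfer between two parts gains in the product. Within a
  block of length \<open>k\<close> only \<open>balprod_inc\<close> changes; at a multiple of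
  \<open>k\<close> only the recursive term does.\<close>

lemma gbal_inc_Suc_le:
  assumes k: "2 \<le> k"
  shows "gbal_inc k (Suc m) \<le> gbal_inc k m + (Suc m div k + 1) ^ (k - 2)"
proof (induction m rule: less_induct)
  case (less m)
  define b i where "b = m div k" and "i = m mod k"
  have m: "m = k * b + i" and i: "i < k" using k by (simp_all add: b_def i_def)
  show ?case
  proof (cases "Suc i < k")
    case True
    then have sm: "Suc m = k * b + Suc i" using m by simp
    then have d: "Suc m div k = b" using True by (metis Suc_lessD add.right_neutral div_less div_mult_self4 k not_numeral_le_zero)
    have "balprod_inc k (Suc m) = (b + 1) ^ Suc i * b ^ (k - 1 - Suc i)"
      using balprod_inc_eq[OF True, of b] by (simp add: m)
    moreover have "balprod_inc k m = (b + 1) ^ i * b ^ (k - 1 - i)"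
      using balprod_inc_eq[OF i, of b] by (simp add: m)
    moreover have "k - 1 - i = Suc (k - 1 - Suc i)" using True by simp
    ultimately have "balprod_inc k (Suc m) = balprod_inc k m + (b + 1) ^ i * b ^ (k - 1 - Suc i)"
      by (simp add: algebra_simps)
    also have "b ^ (k - 1 - Suc i) \<le> (b + 1) ^ (k - 1 - Suc i)" by (rule power_mono) auto
    then have "(b + 1) ^ i * b ^ (k - 1 - Suc i) \<le> (b + 1) ^ i * (b + 1) ^ (k - 1 - Suc i)"
      by (rule mult_left_mono) simp
    also have "\<dots> = (b + 1) ^ (k - 2)" using True by (simp flip: power_add)
    finally have "balprod_inc k (Suc m) \<le> balprod_inc k m + (b + 1) ^ (k - 2)" by simp
    then show ?thesis using gbal_inc_eq[OF k, of "Suc m"] gbal_inc_eq[OF k, of m] d b_def by simp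
  next
    case False
    then have ik: "k = Suc i" using i by simp
    then have sm: "Suc m = k * (b + 1) + 0" using m by simp
    then have d: "Suc m div k = b + 1" using k by simp
    have "balprod_inc k (Suc m) = balprod_inc k m"
    proof -
      have "balprod_inc k (Suc m) = (b + 1) ^ (k - 1)" unfolding sm using balprod_inc_eq[of 0 k "b + 1"] k by simp
      moreover have "balprod_inc k m = (b + 1) ^ (k - 1)" unfolding m using balprod_inc_eq[OF i, of b] ik by simp
      ultimately show ?thesis by simp
    qed
    moreover have "b < m"
    proof -
      have "2 * b \<le> k * b" using k by (rule mult_right_mono) simp
      then show ?thesis using m ik k by linarith
    qed
    then have "gbal_inc k (Suc b) \<le> gbal_inc k b + (Suc b div k + 1) ^ (k - 2)" by (rule less.IH)
    moreover have "Suc b div k + 1 \<le> Suc m div k + 1" using d by simp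
    then have "(Suc b div k + 1) ^ (k - 2) \<le> (Suc m div k + 1) ^ (k - 2)" by (rule power_mono) simp
    ultimately show ?thesis using gbal_inc_eq[OF k, of "Suc m"] gbal_inc_eq[OF k, of m] d b_def by simp
  qed
qed

lemma gbal_inc_add_le:
  assumes k: "2 \<le> k" and c: "((y + d) div k + 1) ^ (k - 2) \<le> c"
  shows "gbal_inc k (y + d) \<le> gbal_inc k y + d * c"
  using c
proof (induction d)
  case (Suc d)
  have "(y + d) div k + 1 \<le> (y + Suc d) div k + 1" by (simp add: div_le_mono)
  then have "((y + d) div k + 1) ^ (k - 2) \<le> ((y + Suc d) div k + 1) ^ (k - 2)" by (rule power_mono) simp
  then show ?case using Suc gbal_inc_Suc_le[OF k, of "y + d"] by simp
qed simp

text \<open>Moving a unit from a part \<open>Suc x\<close> to a part \<open>y < x\<close> gains \<open>x - y\<close> times the product of the other parts,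
  which outweighs the loss in the sum as long as the parts are within a factor \<open>k\<close> of each other.\<close>

lemma sum_gbal_add_prod_le:
  assumes k: "2 \<le> k" and fin: "finite I" and card: "card I = k"
    and bd: "\<And>i. i \<in> I \<Longrightarrow> \<mu> \<le> s i \<and> s i \<le> k * \<mu>"
  shows "(\<Sum>i\<in>I. gbal k (s i)) + (\<Prod>i\<in>I. s i) \<le> gbal k (\<Sum>i\<in>I. s i)"
  using bd
\<comment> \<open>A transfer from a larger to a smaller part lowers the sum of squares and keeps all
  parts between \<open>\<mu>\<close> and \<open>k * \<mu>\<close>.\<close>
proof (induction "\<Sum>i\<in>I. (s i)\<^sup>2" arbitrary: s rule: less_induct)
  case less
  show ?case
  proof (cases "\<exists>i\<in>I. \<exists>j\<in>I. s j + 2 \<le> s i")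
    case True
    then obtain i j where ij: "i \<in> I" "j \<in> I" "s j + 2 \<le> s i" by blast
    have ne: "i \<noteq> j" using ij by auto
    define J where "J = I - {i} - {j}"
    have I: "I = insert i (insert j J)" "i \<notin> insert j J" "j \<notin> J" "finite J"
      using ij ne fin by (auto simp: J_def)
    have cJ: "card J = k - 2" using card I by simp
    define x y where "x = s i - 1" and "y = s j"
    have x: "s i = Suc x" "y < x" using ij by (auto simp: x_def y_def)
    let ?s = "s(i := x, j := Suc y)"
    have JJ: "(\<Sum>l\<in>J. f (?s l)) = (\<Sum>l\<in>J. f (s l))" for f :: "nat \<Rightarrow> nat"
      using I by (intro sum.cong) auto
    have JP: "(\<Prod>l\<in>J. ?s l) = (\<Prod>l\<in>J. s l)" using I by (intro prod.cong) auto
    define P where "P = (\<Prod>l\<in>J. s l)"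
    define D where "D = (x - y) * P"
    have "x\<^sup>2 + (Suc y)\<^sup>2 < (Suc x)\<^sup>2 + y\<^sup>2" using x by (simp add: power2_eq_square)
    then have "(\<Sum>l\<in>I. (?s l)\<^sup>2) < (\<Sum>l\<in>I. (s l)\<^sup>2)"
      using I JJ[of "\<lambda>z. z\<^sup>2"] x ne by (simp add: y_def)
    moreover have "\<mu> \<le> ?s l \<and> ?s l \<le> k * \<mu>" if "l \<in> I" for l
      using less.prems[OF that] less.prems[OF ij(1)] less.prems[OF ij(2)] x y_def by auto
    ultimately have "(\<Sum>l\<in>I. gbal k (?s l)) + (\<Prod>l\<in>I. ?s l) \<le> gbal k (\<Sum>l\<in>I. ?s l)"
      by (rule less.hyps)
    moreover have sum_eq: "(\<Sum>l\<in>I. ?s l) = (\<Sum>l\<in>I. s l)"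
      using I JJ[of "\<lambda>z. z"] x ne by (simp add: y_def)
    ultimately have "(\<Sum>l\<in>I. gbal k (?s l)) + (\<Prod>l\<in>I. ?s l) \<le> gbal k (\<Sum>l\<in>I. s l)"
      by (simp only:)
    moreover have "(\<Sum>l\<in>I. gbal k (?s l)) = gbal k x + gbal k y + gbal_inc k y + (\<Sum>l\<in>J. gbal k (s l))"
      using I JJ[of "gbal k"] ne by (simp add: gbal_Suc)
    moreover have "(\<Sum>l\<in>I. gbal k (s l)) = gbal k x + gbal_inc k x + gbal k y + (\<Sum>l\<in>J. gbal k (s l))"
      using I x by (simp add: gbal_Suc y_def)
    moreover have "(\<Prod>l\<in>I. ?s l) = x * Suc y * P"
      using I JP ne by (simp add: P_def del: fun_upd_apply) (simp add: ac_simps)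
    moreover have "(\<Prod>l\<in>I. s l) = Suc x * y * P"
      using I x by (simp add: P_def y_def) (simp add: algebra_simps)
    moreover have "gbal_inc k x \<le> gbal_inc k y + D"
    proof -
      \<comment> \<open>Here the factor \<open>k\<close> matters: every second difference between
        \<open>y\<close> and \<open>x\<close> is at most \<open>\<mu> ^ (k - 2)\<close>, and the
        other \<open>k - 2\<close> parts have at least this product.\<close>
      have "x < k * \<mu>" using less.prems[OF ij(1)] x by simp
      then have "x div k + 1 \<le> \<mu>" by (simp add: less_mult_imp_div_less mult.commute Suc_leI)
      then have "(x div k + 1) ^ (k - 2) \<le> \<mu> ^ (k - 2)" by (rule power_mono) simp
      also have "\<dots> = (\<Prod>l\<in>J. \<mu>)" using cJ by simp
      also have "\<dots> \<le> P" unfolding P_def using less.prems I by (intro prod_mono) auto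
      finally show ?thesis using gbal_inc_add_le[OF k, of y "x - y" P] x by (simp add: D_def)
    qed
    moreover have "D + Suc x * y * P = x * Suc y * P"
    proof -
      have "(x - y) + Suc x * y = x * Suc y" using x by (simp add: algebra_simps)
      then show ?thesis unfolding D_def by (metis add_mult_distrib)
    qed
    ultimately show ?thesis by linarith
  next
    case False
    \<comment> \<open>Any two parts now differ by at most one, and \<open>gbal_balanced\<close>
      gives equality.\<close>
    define c where "c = Min (s ` I)"
    have ne: "I \<noteq> {}" using card k by auto
    have c_le: "c \<le> s l" if "l \<in> I" for l using that fin by (simp add: c_def)
    have "c \<in> s ` I" unfolding c_def using fin ne by (intro Min_in) auto
    then have le_c: "s l \<le> c + 1" if "l \<in> I" for l using False that by force
    define J where "J = {l \<in> I. s l = c + 1}"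
    have J: "J \<subseteq> I" "finite J" using fin by (auto simp: J_def)
    have out: "s l = c" if "l \<in> I - J" for l using c_le[of l] le_c[of l] that by (auto simp: J_def)
    have cJ: "card J \<le> k" using J fin card card_mono by blast
    have cIJ: "card (I - J) = k - card J" using J card by (simp add: card_Diff_subset)
    have sumf: "(\<Sum>l\<in>I. f (s l)) = card J * f (c + 1) + (k - card J) * f c" for f :: "nat \<Rightarrow> nat"
    proof -
      have "(\<Sum>l\<in>I. f (s l)) = (\<Sum>l\<in>I - J. f (s l)) + (\<Sum>l\<in>J. f (s l))"
        using sum.subset_diff[OF J(1) fin] by simp
      moreover have "(\<Sum>l\<in>I - J. f (s l)) = (\<Sum>l\<in>I - J. f c)" using out by (intro sum.cong) auto
      moreover have "(\<Sum>l\<in>J. f (s l)) = (\<Sum>l\<in>J. f (c + 1))" by (intro sum.cong) (auto simp: J_def)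
      ultimately show ?thesis using cIJ by simp
    qed
    have prd: "(\<Prod>l\<in>I. s l) = (c + 1) ^ card J * c ^ (k - card J)"
    proof -
      have "(\<Prod>l\<in>I. s l) = (\<Prod>l\<in>I - J. s l) * (\<Prod>l\<in>J. s l)"
        using prod.subset_diff[OF J(1) fin] by simp
      moreover have "(\<Prod>l\<in>I - J. s l) = (\<Prod>l\<in>I - J. c)" using out by (intro prod.cong) auto
      moreover have "(\<Prod>l\<in>J. s l) = (\<Prod>l\<in>J. c + 1)" by (intro prod.cong) (auto simp: J_def)
      ultimately show ?thesis using cIJ by simp
    qed
    have "(\<Sum>l\<in>I. s l) = k * c + card J"
      using sumf[of "\<lambda>x. x"] cJ by (simp add: algebra_simps flip: add_mult_distrib)
    then show ?thesis
      using sumf[of "gbal k"] prd gbal_balanced[OF k cJ, of c] balprod_eq[of k "card J" c] cJ k by simp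
  qed
qed

section \<open>Numerical estimates\<close>

text \<open>Serves the upper end \<open>u = 2 / 5\<close> in \<open>one_plus_power_le\<close>. The
  inequality is false for \<open>q = 3\<close>, which is therefore treated separately there.\<close>

lemma seven_fifths_power_le:
  assumes "4 \<le> q"
  shows "(7 / 5 :: real) ^ (q + 1) * (4 * (real q + 1)) \<le> real q ^ q"
  using assms
proof (induction q rule: dec_induct)
  case (step q)
  have "(7 / 5 :: real) ^ (Suc q + 1) * (4 * (real (Suc q) + 1))
      = ((7 / 5) ^ (q + 1) * (4 * (real q + 1))) * (7 / 5 * (real q + 2) / (real q + 1))"
  proof -
    define A where "A = real q + 1"
    have "A \<noteq> 0" unfolding A_def by linarith
    then have "(4 * A) * (7 / 5 * (real q + 2) / A) = 7 / 5 * (4 * (real q + 2))" by simp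
    then have "(7 / 5) ^ (q + 1) * ((4 * A) * (7 / 5 * (real q + 2) / A)) = (7 / 5) ^ (q + 1) * (7 / 5 * (4 * (real q + 2)))"
      by simp
    moreover have "real (Suc q) + 1 = real q + 2" by simp
    ultimately show ?thesis unfolding A_def[symmetric] by (simp only: power_Suc add_Suc_shift Suc_eq_plus1 ac_simps power_add power_one_right)
  qed
  also have "\<dots> \<le> real q ^ q * (7 / 5 * (real q + 2) / (real q + 1))"
    using step.IH by (intro mult_right_mono) auto
  also have "\<dots> \<le> real q ^ q * (real q + 1)"
  proof (intro mult_left_mono)
    have "0 \<le> (real q - 4) * real q" using step.hyps by (intro mult_nonneg_nonneg) auto
    moreover have "(real q + 1) * (real q + 1) - 7 / 5 * (real q + 2) = (real q - 4) * real q + (23 / 5 * real q - 9 / 5)"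
      by (simp add: field_simps)
    moreover have "0 \<le> 23 / 5 * real q - 9 / 5" using step.hyps by simp
    ultimately have "7 / 5 * (real q + 2) \<le> (real q + 1) * (real q + 1)" by linarith
    then show "7 / 5 * (real q + 2) / (real q + 1) \<le> real q + 1" by (simp add: field_simps)
  qed simp
  also have "\<dots> \<le> (real q + 1) ^ q * (real q + 1)"
    by (intro mult_right_mono power_mono) auto
  finally show ?case by (simp add: ac_simps)
qed (simp add: power_numeral_reduce)

text \<open>The inequality that makes splitting a neighbourhood unprofitable. The limits on
  \<open>u\<close> are those of \<open>(y + 1) / b\<close> for
  \<open>y = b div (4 * (q + 1))\<close> and \<open>b \<ge> q \<ge> 3\<close>.\<close>

lemma one_plus_power_le:
  fixes u :: real
  assumes q: "3 \<le> q" and u: "1 / (4 * (real q + 1)) \<le> u" "u \<le> 2 / 5"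
  shows "(1 + u) ^ (q + 1) \<le> u * real q ^ q"
proof (cases "q = 3")
  case True
  have u0: "1 / 16 \<le> u" using u True by simp
  have *: "(1 + u) ^ 4 \<le> u * 27" if "u \<le> c" "(1 + c) ^ 4 \<le> d * 27" "d \<le> u" for c d
  proof -
    have "(1 + u) ^ 4 \<le> (1 + c) ^ 4" using that u0 by (intro power_mono) auto
    then show ?thesis using that by linarith
  qed
  \<comment> \<open>On each interval the left side is taken at the right end and the right side at
    the left end; on a single interval this would be too coarse.\<close>
  consider "u \<le> 1/8" | "1/8 \<le> u" "u \<le> 1/4" | "1/4 \<le> u" by linarith
  then have "(1 + u) ^ 4 \<le> u * 27"
  proof cases
    case 1
    then show ?thesis using u0 by (intro *[of "1/8" "1/16"]) (auto simp: power_numeral_reduce)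
  next
    case 2
    then show ?thesis by (intro *[of "1/4" "1/8"]) (auto simp: power_numeral_reduce)
  next
    case 3
    then show ?thesis using u by (intro *[of "2/5" "1/4"]) (auto simp: power_numeral_reduce)
  qed
  then show ?thesis using True by (simp add: power_numeral_reduce)
next
  case False
  have "0 < u" using u(1) by (smt (verit) divide_pos_pos of_nat_0_le_iff)
  then have "(1 + u) ^ (q + 1) \<le> (7 / 5) ^ (q + 1)" using u by (intro power_mono) auto
  also have "\<dots> \<le> real q ^ q / (4 * (real q + 1))"
    using seven_fifths_power_le[of q] q False by (simp add: field_simps)
  also have "\<dots> \<le> real q ^ q * u"
    using mult_left_mono[OF u(1), of "real q ^ q"] by simp
  finally show ?thesis by (simp add: ac_simps)
qed

text \<open>Here and below \<open>q = k - 1\<close>, \<open>k * b + i + 1\<close> is the number of vertices, and \<open>b + y\<close> bounds the number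
  of neighbours of a vertex outside its main level. The value of \<open>y\<close> is large enough for this lemma
  and small enough for \<open>part_sizes\<close>.\<close>

lemma balprod_split_le:
  assumes q: "3 \<le> q" and b: "q \<le> b" and i: "i \<le> q" and y: "y = b div (4 * (q + 1))"
  shows "balprod q (q * b + i - (y + 1)) + balprod q (b + (y + 1)) \<le> balprod q (q * b + i)"
proof -
  define u where "u = real (y + 1) / real b"
  define X W Q where "X = balprod q (q * b + i - (y + 1))" and "W = balprod q (b + (y + 1))" and "Q = balprod q (q * b + i)"
  have b0: "0 < b" "3 \<le> b" using b q by auto
  have ylt: "b < (y + 1) * (4 * (q + 1))"
    unfolding y using dividend_less_times_div[of "4 * (q + 1)" b] by (simp add: algebra_simps)
  have yle: "y * (4 * (q + 1)) \<le> b" unfolding y by (rule div_times_less_eq_dividend)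
  \<comment> \<open>For \<open>y = 0\<close> this is \<open>5 \<le> 2 * b\<close>, true since
    \<open>b \<ge> 3\<close>; otherwise \<open>y + 1 \<le> 2 * y\<close> and
    \<open>16 * y \<le> b\<close> suffice.\<close>
  have ule: "u \<le> 2 / 5"
  proof -
    have "y * 16 \<le> y * (4 * (q + 1))" using q by (intro mult_left_mono) auto
    then have "16 * (y + 1) \<le> b + 16" using le_trans[OF _ yle] by simp
    then have "16 * real (y + 1) \<le> real b + 16" by linarith
    then have "5 * real (y + 1) \<le> 2 * real b" using b0 by (cases "y = 0") auto
    then show ?thesis using b0 by (simp add: u_def field_simps)
  qed
  have uge: "1 / (4 * (real q + 1)) \<le> u"
  proof -
    have "real b \<le> real ((y + 1) * (4 * (q + 1)))" using ylt by (simp only: of_nat_le_iff less_imp_le)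
    then show ?thesis using b0 by (simp add: u_def field_simps)
  qed
  have u0: "0 < u" using b0 by (simp add: u_def)
  have ub: "real b * u = real (y + 1)" using b0 by (simp add: u_def)
  have "y + 1 \<le> q * b + i"
  proof -
    have "y \<le> b div 1" unfolding y by (intro div_le_mono2) auto
    then have "y + 1 \<le> 3 * b" using b0 by simp
    also have "\<dots> \<le> q * b" using q by simp
    finally show ?thesis by simp
  qed
  then have "X * (b + 1) ^ (y + 1) \<le> Q * b ^ (y + 1)"
    using balprod_steps[of q "q * b + i - (y + 1)" "y + 1" b] q i unfolding X_def Q_def
    by (simp only: le_add_diff_inverse2) simp
  then have "real X * (real b + 1) ^ (y + 1) \<le> real Q * real b ^ (y + 1)"
    unfolding of_nat_le_iff[where ?'a = real, symmetric] of_nat_mult of_nat_power of_nat_add of_nat_1 .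
  moreover have "0 < real b ^ (y + 1)" using b0 by simp
  ultimately have "real X * ((real b + 1) ^ (y + 1) / real b ^ (y + 1)) \<le> real Q"
    by (simp only: times_divide_eq_right pos_divide_le_eq)
  moreover have "1 + u \<le> (real b + 1) ^ (y + 1) / real b ^ (y + 1)"
  proof -
    have "1 + real (y + 1) * (1 / real b) \<le> (1 + 1 / real b) ^ (y + 1)"
      by (rule Bernoulli_inequality) (use b0 in \<open>simp add: field_simps\<close>)
    moreover have "1 + 1 / real b = (real b + 1) / real b" using b0 by (simp add: field_simps)
    then have "(1 + 1 / real b) ^ (y + 1) = (real b + 1) ^ (y + 1) / real b ^ (y + 1)"
      by (simp only: power_divide)
    ultimately show ?thesis by (simp add: u_def)
  qed
  ultimately have X: "real X * (1 + u) \<le> real Q"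
    by (meson mult_left_mono of_nat_0_le_iff order_trans)
  have bQ: "real b ^ q \<le> real Q"
  proof -
    have "b ^ q = balprod q (q * b)" using balprod_mult[of q b] q by simp
    also have "\<dots> \<le> Q" unfolding Q_def using q by (intro balprod_mono) auto
    finally show ?thesis by (metis of_nat_le_iff of_nat_power)
  qed
  have "real W \<le> (real (b + (y + 1)) / real q) ^ q" unfolding W_def using q by (intro balprod_le_power) auto
  also have "real (b + (y + 1)) / real q = real b * (1 + u) / real q"
    using ub by (simp add: distrib_left)
  also have "(real b * (1 + u) / real q) ^ q = real b ^ q * (1 + u) ^ q / real q ^ q"
    by (simp add: power_divide power_mult_distrib)
  finally have "real W * (1 + u) \<le> real b ^ q * (1 + u) ^ q / real q ^ q * (1 + u)"
    using u0 by (intro mult_right_mono) auto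
  also have "\<dots> = real b ^ q * ((1 + u) ^ (q + 1) / real q ^ q)" by simp
  also have "\<dots> \<le> real b ^ q * u"
  proof (intro mult_left_mono)
    show "(1 + u) ^ (q + 1) / real q ^ q \<le> u"
      using one_plus_power_le[OF q uge ule] q by (simp add: divide_le_eq)
  qed simp
  also have "\<dots> \<le> real Q * u" using bQ u0 by (intro mult_right_mono) auto
  \<comment> \<open>The sum of \<open>X * (1 + u) \<le> Q\<close> and
    \<open>W * (1 + u) \<le> Q * u\<close>: removing \<open>y + 1\<close> units from the large part
    loses a factor \<open>1 + u\<close>, and the small part is worth at most the share
    \<open>u\<close> of what remains.\<close>
  finally have "(real X + real W) * (1 + u) \<le> real Q * (1 + u)" using X by (simp add: algebra_simps)
  then have "real X + real W \<le> real Q" using u0 by (simp only: mult_le_cancel_right)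
  then show ?thesis unfolding X_def W_def Q_def by linarith
qed

text \<open>For \<open>c \<le> 3 / 4\<close> the sequence \<open>(n + 2) * c ^ n\<close> does not
  increase from \<open>n = 2\<close> on, so its value at \<open>2\<close> is the bound.\<close>

lemma geometric_bounds:
  assumes "2 \<le> n"
  shows "(real n + 2) * (1 / 3) ^ n \<le> 4 / 9" "(real n + 2) * (17 / 32) ^ n \<le> 289 / 256"
proof -
  have *: "(real n + 2) * c ^ n \<le> 4 * c\<^sup>2" if "0 \<le> c" "c \<le> 3 / 4" for c :: real
    using assms
  proof (induction n rule: dec_induct)
    case (step n)
    have "(real (Suc n) + 2) * c ^ Suc n = ((real n + 3) * c) * c ^ n" by (simp add: algebra_simps)
    also have "(real n + 3) * c \<le> (real n + 3) * (3 / 4)" using that by (intro mult_left_mono) auto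
    then have "(real n + 3) * c \<le> real n + 2" using step.hyps of_nat_mono[of 2 n, where ?'a = real] by simp
    then have "((real n + 3) * c) * c ^ n \<le> (real n + 2) * c ^ n"
      using that by (intro mult_right_mono) auto
    finally show ?case using step.IH by linarith
  qed simp
  show "(real n + 2) * (1 / 3) ^ n \<le> 4 / 9" using *[of "1 / 3"] by (simp add: power2_eq_square)
  show "(real n + 2) * (17 / 32) ^ n \<le> 289 / 256" using *[of "17 / 32"] by (simp add: power2_eq_square)
qed

lemma balprod_scaled_le:
  assumes q: "0 < q" and z: "real z \<le> c * real q * real b" and c: "0 \<le> c"
  shows "real (balprod q z) \<le> c ^ q * real b ^ q"
proof -
  have "real (balprod q z) \<le> (real z / real q) ^ q" using balprod_le_power[OF q] .
  also have "\<dots> \<le> (c * real b) ^ q"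
    using z q by (intro power_mono) (auto simp: divide_le_eq ac_simps)
  finally show ?thesis by (simp add: power_mult_distrib)
qed

text \<open>The left side is the bound of \<open>exceptional_vertex_degree\<close> for twice the
  degree of a vertex with a deviating main level; the right side is twice a number that every degree
  in a minimal counterexample exceeds.\<close>

lemma exceptional_bound:
  assumes q: "3 \<le> q" and b: "q \<le> b" and i: "i \<le> q" and y: "y = b div (4 * (q + 1))"
    and n': "n' \<le> 4 * y + 2" and m: "m = (q + 1) * b + i" and h: "h = b + y"
  shows "2 * balprod q n' + m * balprod (q - 1) n' + m * balprod (q - 1) (h - 1) + 2 * balprod q h \<le> 2 * balprod q (q * b + i)"
proof -
  define Q where "Q = balprod q (q * b + i)"
  have b0: "0 < b" "3 \<le> b" using b q by auto
  have yle: "y * (4 * (q + 1)) \<le> b" unfolding y by (rule div_times_less_eq_dividend)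
  have "y * 16 \<le> y * (4 * (q + 1))" using q by (intro mult_left_mono) auto
  then have y16: "y * 16 \<le> b" using yle by linarith
  \<comment> \<open>The ratios \<open>2 / 3\<close> for \<open>n'\<close> and \<open>17 / 16\<close>
    for \<open>h\<close>, divided by \<open>q \<ge> 3\<close>, give the constants
    \<open>2 / 9\<close> and \<open>17 / 48\<close> below; divided by \<open>q - 1 \<ge> 2\<close>
    they give \<open>1 / 3\<close> and \<open>17 / 32\<close>.\<close>
  have n3: "real n' \<le> 2 / 3 * real b"
  proof (cases "y = 0")
    case True
    then show ?thesis using n' b0 by simp
  next
    case False
    then have "3 * n' \<le> 2 * b" using n' y16 by simp
    then show ?thesis by linarith
  qed
  have h3: "real h \<le> 17 / 16 * real b" using y16 by (simp add: h)
  have h1: "real (h - 1) \<le> real h" by simp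
  have q3: "3 \<le> real q" "2 \<le> real (q - 1)" using q by auto
  have mono: "c * 3 * real b \<le> c * real q * real b" "c * 2 * real b \<le> c * real (q - 1) * real b" if "0 \<le> c" for c
    using q3 that by (auto intro!: mult_right_mono mult_left_mono)
  have nn: "0 \<le> (2 / 9 :: real)" "0 \<le> (17 / 48 :: real)" "0 \<le> (1 / 3 :: real)" "0 \<le> (17 / 32 :: real)" by auto
  have qp: "0 < q" "0 < q - 1" using q by auto
  have pw: "c ^ q \<le> c ^ 3" if "0 \<le> c" "c \<le> 1" for c :: real
    using that q by (intro power_decreasing) auto
  have A1: "real (balprod q n') \<le> (2 / 9) ^ 3 * real b ^ q"
  proof -
    have "real (balprod q n') \<le> (2 / 9) ^ q * real b ^ q"
      using balprod_scaled_le[OF qp(1) _ nn(1), where b = b and z = "n'"] n3 mono(1)[OF nn(1)] by linarith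
    also have "\<dots> \<le> (2 / 9) ^ 3 * real b ^ q" using pw[of "2 / 9"] by (intro mult_right_mono) auto
    finally show ?thesis .
  qed
  have A2: "real (balprod q h) \<le> (17 / 48) ^ 3 * real b ^ q"
  proof -
    have "real (balprod q h) \<le> (17 / 48) ^ q * real b ^ q"
      using balprod_scaled_le[OF qp(1) _ nn(2), where b = b and z = "h"] h3 mono(1)[OF nn(2)] by linarith
    also have "\<dots> \<le> (17 / 48) ^ 3 * real b ^ q" using pw[of "17 / 48"] by (intro mult_right_mono) auto
    finally show ?thesis .
  qed
  have A3: "real (balprod (q - 1) n') \<le> (1 / 3) ^ (q - 1) * real b ^ (q - 1)"
    using balprod_scaled_le[OF qp(2) _ nn(3), where b = b and z = "n'"] n3 mono(2)[OF nn(3)] by linarith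
  have A4: "real (balprod (q - 1) (h - 1)) \<le> (17 / 32) ^ (q - 1) * real b ^ (q - 1)"
    using balprod_scaled_le[OF qp(2) _ nn(4), where b = b and z = "h - 1"] h3 h1 mono(2)[OF nn(4)] by linarith
  have Qeq: "real Q = (real b + 1) ^ i * real b ^ (q - i)"
    using balprod_eq[of q i b] q i by (simp add: Q_def add.commute)
  have bq: "real b ^ q = real b ^ (q - 1) * real b" using q by (metis power_minus_mult gr0I not_numeral_le_zero)
  \<comment> \<open>Absorbs the factor \<open>m\<close>: by Bernoulli
    \<open>Q \<ge> b ^ (q - 1) * (b + i)\<close>, and \<open>m \<le> (q + 1) * (b + i)\<close>. The
    remaining factor \<open>q + 1\<close> is the one in \<open>geometric_bounds\<close>.\<close>
  have mQ: "real m * real b ^ (q - 1) \<le> (real q + 1) * real Q"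
  proof -
    have "1 + real i * (1 / real b) \<le> (1 + 1 / real b) ^ i"
      by (rule Bernoulli_inequality) (use b0 in \<open>simp add: field_simps\<close>)
    then have "real b ^ q * (1 + real i * (1 / real b)) \<le> real b ^ q * (1 + 1 / real b) ^ i"
      by (rule mult_left_mono) simp
    also have "\<dots> = real b ^ (q - i) * (real b * (1 + 1 / real b)) ^ i"
      using i by (simp add: power_mult_distrib flip: power_add)
    also have "real b * (1 + 1 / real b) = real b + 1" using b0 by (simp add: field_simps)
    also have "real b ^ (q - i) * (real b + 1) ^ i = real Q" by (simp add: Qeq)
    also have "real b ^ q * (1 + real i * (1 / real b)) = real b ^ (q - 1) * (real b + real i)"
      unfolding bq using b0 by (simp add: algebra_simps)
    finally have "real b ^ (q - 1) * (real b + real i) \<le> real Q" .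
    then have "(real q + 1) * (real b ^ (q - 1) * (real b + real i)) \<le> (real q + 1) * real Q"
      by (rule mult_left_mono) simp
    moreover have "real m * real b ^ (q - 1) \<le> (real q + 1) * (real b ^ (q - 1) * (real b + real i))"
    proof -
      have "real m \<le> (real q + 1) * (real b + real i)" by (simp add: m algebra_simps)
      then have "real m * real b ^ (q - 1) \<le> (real q + 1) * (real b + real i) * real b ^ (q - 1)"
        by (rule mult_right_mono) simp
      then show ?thesis by (simp add: ac_simps)
    qed
    ultimately show ?thesis by linarith
  qed
  have bQ: "real b ^ q \<le> real Q"
  proof -
    have "b ^ q = balprod q (q * b)" using balprod_mult[of q b] q by simp
    also have "\<dots> \<le> Q" unfolding Q_def using q by (intro balprod_mono) auto
    finally show ?thesis by (metis of_nat_le_iff of_nat_power)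
  qed
  have q1: "real (q - 1) + 2 = real q + 1" using q by (simp add: of_nat_diff)
  have M: "real m * real (balprod (q - 1) z) \<le> d * real Q"
    if "real (balprod (q - 1) z) \<le> c ^ (q - 1) * real b ^ (q - 1)" "(real q + 1) * c ^ (q - 1) \<le> d" "0 \<le> c" for z c d
  proof -
    have "real m * real (balprod (q - 1) z) \<le> real m * (c ^ (q - 1) * real b ^ (q - 1))"
      using that by (intro mult_left_mono) auto
    also have "\<dots> = c ^ (q - 1) * (real m * real b ^ (q - 1))" by simp
    also have "\<dots> \<le> c ^ (q - 1) * ((real q + 1) * real Q)" using mQ that by (intro mult_left_mono) auto
    also have "\<dots> = ((real q + 1) * c ^ (q - 1)) * real Q" by simp
    also have "\<dots> \<le> d * real Q" using that by (intro mult_right_mono) auto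
    finally show ?thesis .
  qed
  have q2: "2 \<le> q - 1" using q by simp
  have "real m * real (balprod (q - 1) n') \<le> 4 / 9 * real Q"
    by (rule M[OF A3 _ nn(3)]) (use geometric_bounds(1)[OF q2] in \<open>simp only: q1\<close>)
  moreover have "real m * real (balprod (q - 1) (h - 1)) \<le> 289 / 256 * real Q"
    by (rule M[OF A4 _ nn(4)]) (use geometric_bounds(2)[OF q2] in \<open>simp only: q1\<close>)
  moreover have "real (balprod q n') \<le> (2 / 9) ^ 3 * real Q" "real (balprod q h) \<le> (17 / 48) ^ 3 * real Q"
    using order_trans[OF A1 mult_left_mono[OF bQ]] order_trans[OF A2 mult_left_mono[OF bQ]] by simp_all
  \<comment> \<open>The four coefficients add up to about 1.69, below the available 2.\<close>
  ultimately have "2 * real (balprod q n') + real m * real (balprod (q - 1) n') + real m * real (balprod (q - 1) (h - 1)) + 2 * real (balprod q h) \<le> 2 * real Q"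
    by (simp add: power_numeral_reduce)
  then have "real (2 * balprod q n' + m * balprod (q - 1) n' + m * balprod (q - 1) (h - 1) + 2 * balprod q h) \<le> real (2 * Q)"
    by simp
  then show ?thesis unfolding Q_def by (simp only: of_nat_le_iff)
qed

text \<open>\<open>L\<close> is what remains for one role class if the other \<open>q\<close>
  classes have at most \<open>b + y + 1\<close> vertices each. The first bound is the hypothesis of
  \<open>uniform_level_bound\<close>, the second keeps the parts within a factor \<open>k\<close> of
  each other, and the third says that the subtraction in \<open>L\<close> does not truncate.\<close>

lemma part_sizes:
  fixes q b i y L :: nat
  assumes q: "3 \<le> q" and b: "q \<le> b" and y: "y = b div (4 * (q + 1))"
    and L: "L = (q + 1) * b + i + 1 - q * (b + y + 1)"
  shows "b + y - 1 \<le> (q - 1) * L" "b + y + 1 \<le> (q + 1) * L" "q * (b + y + 1) \<le> (q + 1) * b + i + 1"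
proof -
  have yle: "y * (4 * (q + 1)) \<le> b" unfolding y by (rule div_times_less_eq_dividend)
  define q' b' y' where "q' = int q" and "b' = int b" and "y' = int y"
  have Q: "3 \<le> q'" "q' \<le> b'" "0 \<le> y'" using q b by (auto simp: q'_def b'_def y'_def)
  have Y: "y' * (4 * (q' + 1)) \<le> b'"
    using yle unfolding q'_def b'_def y'_def
    unfolding of_nat_le_iff[where ?'a = int, symmetric] of_nat_mult of_nat_add of_nat_1 of_nat_numeral .
  define l where "l = b' + 1 - q' - q' * y'"
  \<comment> \<open>Expanded in the integers this is
    \<open>y * (q * q - q + 1) \<le> (q - 2) * (b - q)\<close>, with equality at
    \<open>y = 0\<close> and \<open>b = q\<close>; this is why the case \<open>b < q\<close> needs
    another argument.\<close>
  have main: "b' + y' - 1 \<le> (q' - 1) * l"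
  proof -
    have "y' * (q' * q' - q' + 1) \<le> (q' - 2) * (b' - q')"
    proof (cases "y' = 0")
      case True
      then show ?thesis using Q by simp
    next
      case False
      then have y1: "1 \<le> y'" using Q by simp
      have "y' * (3 * q' + 4) \<le> b' - q'"
      proof -
        have "q' * 1 \<le> q' * y'" using y1 Q by (intro mult_left_mono) auto
        then show ?thesis using Y by (simp add: algebra_simps)
      qed
      then have "(q' - 2) * (y' * (3 * q' + 4)) \<le> (q' - 2) * (b' - q')" using Q by (intro mult_left_mono) auto
      moreover have "y' * (q' * q' - q' + 1) \<le> y' * ((q' - 2) * (3 * q' + 4))"
      proof (intro mult_left_mono)
        have "3 * q' \<le> q' * q'" using Q by (intro mult_right_mono) auto
        then have "9 + q' \<le> 2 * (q' * q')" using Q by linarith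
        then show "q' * q' - q' + 1 \<le> (q' - 2) * (3 * q' + 4)" by (simp add: algebra_simps)
      qed (use Q in simp)
      ultimately show ?thesis by (simp add: algebra_simps)
    qed
    then show ?thesis by (simp add: l_def algebra_simps)
  qed
  have lpos: "1 \<le> l"
  proof (rule ccontr)
    assume "\<not> ?thesis"
    then have "(q' - 1) * l \<le> 0" using Q by (intro mult_nonneg_nonpos) auto
    then show False using main Q by linarith
  qed
  have big: "int ((q + 1) * b + i + 1) - int (q * (b + y + 1)) = l + int i"
    by (simp add: l_def q'_def b'_def y'_def algebra_simps)
  then show 3: "q * (b + y + 1) \<le> (q + 1) * b + i + 1" using lpos by linarith
  have iL: "int L = l + int i" using L big 3 by (simp only: of_nat_diff)
  have m1: "(q' - 1) * l \<le> (q' - 1) * int L" using iL Q by (intro mult_left_mono) auto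
  have "int (b + y) - 1 \<le> int ((q - 1) * L)"
  proof -
    have "int ((q - 1) * L) = (q' - 1) * int L" using q by (simp add: q'_def of_nat_diff)
    then show ?thesis using order_trans[OF main m1] by (simp only: b'_def y'_def of_nat_add)
  qed
  then show 1: "b + y - 1 \<le> (q - 1) * L" by linarith
  have "(q + 1) * L = (q - 1) * L + 2 * L" using q by (simp add: algebra_simps flip: add_mult_distrib)
  moreover have "1 \<le> L" using iL lpos by linarith
  ultimately show "b + y + 1 \<le> (q + 1) * L" using 1 by linarith
qed

text \<open>The hypothesis is \<open>class_bound\<close> with the parameters inserted. Since
  \<open>q + 1 \<le> 2 * (q - 1)\<close>, it forces \<open>Z < 4 * (y + 1)\<close>.\<close>

lemma exceptional_number_le:
  fixes q b i y Z :: nat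
  assumes q: "3 \<le> q" and Z: "(q - 1) * Z + 2 * ((q + 1) * b + i + 1) \<le> 2 * ((q + 1) * (b + y + 1))"
  shows "Z \<le> 4 * y + 3"
proof (rule ccontr)
  assume "\<not> ?thesis"
  then have "(q - 1) * (4 * y + 4) \<le> (q - 1) * Z" by (intro mult_left_mono) auto
  then have "(q - 1) * (4 * y + 4) + 2 * i + 2 \<le> 2 * (q + 1) * (y + 1)" using Z by (simp add: algebra_simps)
  moreover obtain p where "q = p + 3" using q by (metis add.commute le_Suc_ex)
  ultimately show False by (simp add: algebra_simps)
qed

section \<open>Cliques in edge-disjoint multipartite graphs\<close>

lemma balprod_inc_eq_balprod:
  assumes "2 \<le> k" "i < k"
  shows "balprod_inc k (k * b + i) = balprod (k - 1) ((k - 1) * b + i)"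
  using assms balprod_inc_eq[of i k b] balprod_eq[of "k - 1" i b] by simp

lemma sum_card_fibres:
  assumes "finite A" "finite J" "f ` A \<subseteq> J"
  shows "(\<Sum>i\<in>J. card {x \<in> A. f x = i}) = card A"
  using sum.group[OF assms, of "\<lambda>_. 1::nat"] by simp

text \<open>A transversal is the image of its choice function, so passing to the choice function is
  injective into a product of fibres.\<close>

lemma card_transversals_le:
  assumes A: "finite A" and J: "finite J" and f: "f ` A \<subseteq> J"
  shows "card {e. e \<subseteq> A \<and> card e = card J \<and> inj_on f e} \<le> (\<Prod>i\<in>J. card {x \<in> A. f x = i})"
proof -
  let ?T = "{e. e \<subseteq> A \<and> card e = card J \<and> inj_on f e}"
  let ?p = "\<lambda>e. restrict (inv_into e f) J"
  have img: "f ` e = J" if "e \<in> ?T" for e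
    using that f J by (intro card_subset_eq) (auto simp: card_image)
  have inv: "?p e ` J = e" if "e \<in> ?T" for e
  proof -
    have "?p e ` J = inv_into e f ` f ` e" using img[OF that] by auto
    also have "\<dots> = e" using that by (auto simp: inv_into_image_cancel)
    finally show ?thesis .
  qed
  have "inj_on ?p ?T" by (rule inj_onI) (metis inv)
  moreover have "?p ` ?T \<subseteq> (\<Pi>\<^sub>E i\<in>J. {x \<in> A. f x = i})"
  proof (intro image_subsetI PiE_I)
    fix e i assume e: "e \<in> ?T" and i: "i \<in> J"
    then have "i \<in> f ` e" using img by blast
    then have "inv_into e f i \<in> e" "f (inv_into e f i) = i"
      by (auto simp: inv_into_into f_inv_into_f)
    then show "?p e i \<in> {x \<in> A. f x = i}" using e i by auto
  qed auto
  moreover have "finite (\<Pi>\<^sub>E i\<in>J. {x \<in> A. f x = i})" using A J by (intro finite_PiE) auto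
  ultimately have "card ?T \<le> card (\<Pi>\<^sub>E i\<in>J. {x \<in> A. f x = i})" by (intro card_inj_on_le)
  also have "\<dots> = (\<Prod>i\<in>J. card {x \<in> A. f x = i})" using J by (rule card_PiE)
  finally show ?thesis .
qed

lemma sum_card_incident:
  assumes "finite U" "finite F"
  shows "(\<Sum>v\<in>U. card {e \<in> F. v \<in> e}) = (\<Sum>e\<in>F. card (e \<inter> U))"
proof -
  have "(\<Sum>v\<in>U. card {e \<in> F. v \<in> e}) = (\<Sum>v\<in>U. \<Sum>e\<in>F. if v \<in> e then 1 else 0)"
    using assms by (simp add: sum.If_cases Int_def)
  also have "\<dots> = (\<Sum>e\<in>F. \<Sum>v\<in>U. if v \<in> e then 1 else 0)" by (rule sum.swap)
  also have "\<dots> = (\<Sum>e\<in>F. card (e \<inter> U))"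
    using assms by (simp add: sum.If_cases Int_def conj_commute)
  finally show ?thesis .
qed

text \<open>\<open>L {u, v}\<close> is the level of the pair \<open>u, v\<close> and \<open>rho t v\<close> the role of the vertex \<open>v\<close> at level \<open>t\<close>.\<close>

locale level_structure =
  fixes k :: nat and L :: "'a set \<Rightarrow> nat" and rho :: "nat \<Rightarrow> 'a \<Rightarrow> nat"
  assumes k4: "4 \<le> k" and rho_less: "rho t v < k"
begin

definition adj :: "nat \<Rightarrow> 'a \<Rightarrow> 'a \<Rightarrow> bool" where
  "adj t u v \<longleftrightarrow> u \<noteq> v \<and> L {u, v} = t \<and> rho t u \<noteq> rho t v"

definition clique :: "nat \<Rightarrow> 'a set \<Rightarrow> bool" where
  "clique t e \<longleftrightarrow> (\<forall>u\<in>e. \<forall>v\<in>e. u \<noteq> v \<longrightarrow> adj t u v)"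

definition cliques :: "nat \<Rightarrow> 'a set \<Rightarrow> nat \<Rightarrow> 'a set set" where
  "cliques t V j = {e. e \<subseteq> V \<and> card e = j \<and> clique t e}"

definition edges :: "'a set \<Rightarrow> 'a set set" where
  "edges V = {e. e \<subseteq> V \<and> card e = k \<and> (\<exists>t. clique t e)}"

definition nbrs :: "nat \<Rightarrow> 'a set \<Rightarrow> 'a \<Rightarrow> 'a set" where
  "nbrs t V v = {u \<in> V. adj t v u}"

lemma k_mult_eq: "k * x = (k - 2) * x + 2 * (x::nat)"
proof -
  have "k = (k - 2) + 2" using k4 by simp
  then show ?thesis by (metis add_mult_distrib)
qed

lemma nbrs_subset: "nbrs t V v \<subseteq> V - {v}"
  by (auto simp: nbrs_def adj_def)

lemma finite_nbrs [intro]: "finite V \<Longrightarrow> finite (nbrs t V v)"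
  by (simp add: nbrs_def)

lemma finite_cliques [intro]: "finite V \<Longrightarrow> finite (cliques t V j)"
  by (simp add: cliques_def)

lemma finite_edges [intro]: "finite V \<Longrightarrow> finite (edges V)"
  by (simp add: edges_def)

section \<open>Cliques of one level: through a vertex and through a pair\<close>

lemma clique_inj_on: "clique t e \<Longrightarrow> inj_on (rho t) e"
  unfolding clique_def adj_def inj_on_def by blast

lemma cliques_le_balprod:
  assumes A: "finite A" and J: "finite J" "J \<noteq> {}" and r: "rho t ` A \<subseteq> J"
  shows "card (cliques t A (card J)) \<le> balprod (card J) (card A)"
proof -
  have "card (cliques t A (card J)) \<le> card {e. e \<subseteq> A \<and> card e = card J \<and> inj_on (rho t) e}"
    using A clique_inj_on by (intro card_mono) (auto simp: cliques_def)
  also have "\<dots> \<le> (\<Prod>i\<in>J. card {x \<in> A. rho t x = i})" using A J r by (intro card_transversals_le)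
  also have "\<dots> \<le> balprod (card J) (\<Sum>i\<in>J. card {x \<in> A. rho t x = i})" using J by (rule prod_le_balprod)
  finally show ?thesis using sum_card_fibres[OF A J(1) r] by simp
qed

lemma cliques_at_le:
  assumes A: "finite A" and J: "finite J" "2 \<le> card J" and r: "rho t ` A \<subseteq> J" and w: "rho t w \<in> J"
  shows "card {e \<in> cliques t A (card J). w \<in> e} \<le> balprod (card J - 1) (card (nbrs t A w))"
proof -
  let ?J = "J - {rho t w}"
  have cJ: "card ?J = card J - 1" using J w by simp
  have neJ: "?J \<noteq> {}" using cJ J by (intro notI) simp
  have "inj_on (\<lambda>e. e - {w}) {e \<in> cliques t A (card J). w \<in> e}"
    by (rule inj_onI) (metis (mono_tags, lifting) insert_Diff mem_Collect_eq)
  moreover have "(\<lambda>e. e - {w}) ` {e \<in> cliques t A (card J). w \<in> e} \<subseteq> cliques t (nbrs t A w) (card ?J)"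
  proof clarify
    fix e assume e: "e \<in> cliques t A (card J)" "w \<in> e"
    then have "finite e" using J by (intro card_ge_0_finite) (simp add: cliques_def)
    then have "card (e - {w}) = card ?J" using e cJ by (simp add: cliques_def)
    moreover have "e - {w} \<subseteq> nbrs t A w" using e by (auto simp: cliques_def nbrs_def clique_def)
    moreover have "clique t (e - {w})" using e by (auto simp: cliques_def clique_def)
    ultimately show "e - {w} \<in> cliques t (nbrs t A w) (card ?J)" by (simp add: cliques_def)
  qed
  ultimately have "card {e \<in> cliques t A (card J). w \<in> e} \<le> card (cliques t (nbrs t A w) (card ?J))"
    using A by (intro card_inj_on_le[where f = "\<lambda>e. e - {w}"]) auto
  also have "\<dots> \<le> balprod (card ?J) (card (nbrs t A w))"
  proof (rule cliques_le_balprod)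
    show "rho t ` nbrs t A w \<subseteq> ?J" using r by (auto simp: nbrs_def adj_def)
  qed (use A J neJ in auto)
  finally show ?thesis using cJ by simp
qed

lemma degree_level_le:
  assumes "finite V"
  shows "card {e \<in> cliques t V k. v \<in> e} \<le> balprod (k - 1) (card (nbrs t V v))"
  using cliques_at_le[of V "{..<k}" t v] assms k4 rho_less by auto

text \<open>Removing \<open>v\<close> and then \<open>w\<close> leaves a clique on
  \<open>k - 2\<close> vertices in the common neighbourhood, where two roles are no longer
  available.\<close>

lemma codegree_le:
  assumes V: "finite V" and that: "v \<noteq> w"
  shows "card {e \<in> cliques t V k. v \<in> e \<and> w \<in> e} \<le> balprod (k - 2) (card (nbrs t (nbrs t V v) w))"
proof (cases "adj t v w")
  case False
  then have "{e \<in> cliques t V k. v \<in> e \<and> w \<in> e} = {}" using that by (auto simp: cliques_def clique_def)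
  then show ?thesis by (simp only: card.empty le0)
next
  case True
  let ?J = "{..<k} - {rho t v}"
  have cJ: "card ?J = k - 1" using rho_less by simp
  have "inj_on (\<lambda>e. e - {v}) {e \<in> cliques t V k. v \<in> e \<and> w \<in> e}"
    by (rule inj_onI) (metis (mono_tags, lifting) insert_Diff mem_Collect_eq)
  moreover have "(\<lambda>e. e - {v}) ` {e \<in> cliques t V k. v \<in> e \<and> w \<in> e} \<subseteq> {e \<in> cliques t (nbrs t V v) (card ?J). w \<in> e}"
  proof clarify
    fix e assume e: "e \<in> cliques t V k" "v \<in> e" "w \<in> e"
    then have "finite e" using k4 by (intro card_ge_0_finite) (simp add: cliques_def)
    then have "card (e - {v}) = card ?J" using e cJ by (simp add: cliques_def)
    moreover have "e - {v} \<subseteq> nbrs t V v" using e by (auto simp: cliques_def nbrs_def clique_def)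
    moreover have "clique t (e - {v})" using e by (auto simp: cliques_def clique_def)
    ultimately show "e - {v} \<in> cliques t (nbrs t V v) (card ?J) \<and> w \<in> e - {v}"
      using e that by (simp add: cliques_def)
  qed
  moreover have "finite {e \<in> cliques t (nbrs t V v) (card ?J). w \<in> e}"
    using V by (simp add: finite_cliques finite_nbrs)
  ultimately have "card {e \<in> cliques t V k. v \<in> e \<and> w \<in> e} \<le> card {e \<in> cliques t (nbrs t V v) (card ?J). w \<in> e}"
    by (intro card_inj_on_le[where f = "\<lambda>e. e - {v}"])
  also have "\<dots> \<le> balprod (card ?J - 1) (card (nbrs t (nbrs t V v) w))"
  proof (rule cliques_at_le)
    show "rho t ` nbrs t V v \<subseteq> ?J" using rho_less by (auto simp: nbrs_def adj_def)
    show "rho t w \<in> ?J" using True rho_less by (auto simp: adj_def)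
  qed (use V cJ k4 in auto)
  finally show ?thesis using cJ by (simp add: numeral_2_eq_2)
qed

section \<open>Degrees over all levels and the main level of a vertex\<close>

lemma sum_card_nbrs:
  assumes "finite V" "finite F"
  shows "(\<Sum>t\<in>F. card (nbrs t V v)) = card (\<Union>t\<in>F. nbrs t V v)"
  using assms by (intro card_UN_disjoint[symmetric]) (auto simp: nbrs_def adj_def)

lemma degree_le:
  assumes V: "finite V"
  obtains T where "finite T"
    "card {e \<in> edges V. v \<in> e} \<le> (\<Sum>t\<in>T. card {e \<in> cliques t V k. v \<in> e})"
proof
  let ?T = "(\<lambda>u. L {v, u}) ` V"
  show "finite ?T" using V by simp
  have "{e \<in> edges V. v \<in> e} \<subseteq> (\<Union>t\<in>?T. {e \<in> cliques t V k. v \<in> e})"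
  proof clarify
    fix e assume e: "e \<in> edges V" "v \<in> e"
    then obtain t where t: "clique t e" and c: "e \<subseteq> V" "card e = k" by (auto simp: edges_def)
    have "e \<noteq> {v}" using c k4 by auto
    then obtain u where "u \<in> e" "u \<noteq> v" using e by blast
    then have "L {v, u} = t" "u \<in> V" using t e c by (auto simp: clique_def adj_def)
    then show "e \<in> (\<Union>t\<in>?T. {e \<in> cliques t V k. v \<in> e})" using e c t by (auto simp: cliques_def)
  qed
  then have "card {e \<in> edges V. v \<in> e} \<le> card (\<Union>t\<in>?T. {e \<in> cliques t V k. v \<in> e})"
    using V by (intro card_mono) (auto simp: finite_cliques)
  also have "\<dots> \<le> (\<Sum>t\<in>?T. card {e \<in> cliques t V k. v \<in> e})" using V by (intro card_UN_le) auto
  finally show "card {e \<in> edges V. v \<in> e} \<le> (\<Sum>t\<in>?T. card {e \<in> cliques t V k. v \<in> e})" .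
qed

text \<open>Otherwise every level misses at least \<open>h + 2\<close> vertices, \<open>v\<close>
  among them, so the \<open>m\<close> other vertices are distributed over levels with at most
  \<open>m - (h + 1)\<close> each. Then \<open>sum_balprod_le_two\<close> contradicts the
  degree.\<close>

lemma dominating_level:
  assumes V: "finite V" "v \<in> V" and m: "card V = m + 1" "2 * (h + 1) \<le> m"
    and deg: "balprod (k - 1) (m - (h + 1)) + balprod (k - 1) (h + 1) < card {e \<in> edges V. v \<in> e}"
  shows "\<exists>t. card (V - nbrs t V v) \<le> h + 1"
proof (rule ccontr)
  assume neg: "\<not> ?thesis"
  obtain T where T: "finite T" "card {e \<in> edges V. v \<in> e} \<le> (\<Sum>t\<in>T. card {e \<in> cliques t V k. v \<in> e})"
    using degree_le[OF V(1)] .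
  have "(\<Sum>t\<in>T. card {e \<in> cliques t V k. v \<in> e}) \<le> (\<Sum>t\<in>T. balprod (k - 1) (card (nbrs t V v)))"
    using V by (intro sum_mono degree_level_le)
  also have "\<dots> \<le> balprod (k - 1) (m - (h + 1)) + balprod (k - 1) (m - (m - (h + 1)))"
  proof (rule sum_balprod_le_two)
    show "card (nbrs t V v) \<le> m - (h + 1)" for t
    proof -
      have "card (V - nbrs t V v) = card V - card (nbrs t V v)"
        using V nbrs_subset[of t V v] by (intro card_Diff_subset) (auto intro: finite_subset)
      moreover have "\<not> card (V - nbrs t V v) \<le> h + 1" using neg by blast
      ultimately show ?thesis using m by linarith
    qed
    have "(\<Sum>t\<in>T. card (nbrs t V v)) \<le> card (V - {v})"
      unfolding sum_card_nbrs[OF V(1) T(1)] using V nbrs_subset by (intro card_mono) auto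
    then show "(\<Sum>t\<in>T. card (nbrs t V v)) \<le> m" using V m by simp
  qed (use k4 T m in auto)
  also have "m - (m - (h + 1)) = h + 1" using m by simp
  finally show False using T deg by linarith
qed

text \<open>Double counting of the pairs \<open>(u, v)\<close> with \<open>v\<close> outside the main neighbourhood of \<open>u\<close>: pairs in different
  classes of \<open>\<sigma>\<close> count at least once, pairs with equal class and role twice.\<close>

lemma class_bound:
  assumes V: "finite V" "V \<noteq> {}" and H: "\<And>v. v \<in> V \<Longrightarrow> card (V - nbrs (\<sigma> v) V v) \<le> H"
    and d: "\<And>v. v \<in> V \<Longrightarrow> card {u \<in> V. \<sigma> u = \<sigma> v} \<le> d"
  shows "k * card V \<le> 2 * k * H + (k - 2) * d"
proof -
  define a :: "'a \<Rightarrow> 'a \<Rightarrow> nat" where "a u v = (if v \<in> nbrs (\<sigma> u) V u then 0 else 1)" for u v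
  define D R where "D u = card {v \<in> V. \<sigma> v = \<sigma> u}"
    and "R u = card {v \<in> V. \<sigma> v = \<sigma> u \<and> rho (\<sigma> u) v = rho (\<sigma> u) u}" for u
  have aH: "(\<Sum>v\<in>V. a u v) \<le> H" if "u \<in> V" for u
  proof -
    have "(\<Sum>v\<in>V. a u v) = card (V - nbrs (\<sigma> u) V u)"
      using V by (simp add: a_def sum.If_cases Diff_eq Compl_eq)
    then show ?thesis using H[OF that] by simp
  qed
  \<comment> \<open>A pair has a single level, so vertices with different main levels cannot both be
    main neighbours of each other. The diagonal \<open>u = v\<close> is included and counts as equal
    class and role.\<close>
  have pw: "1 + 2 * (if \<sigma> v = \<sigma> u \<and> rho (\<sigma> u) v = rho (\<sigma> u) u then 1 else 0)
      \<le> a u v + a v u + (if \<sigma> v = \<sigma> u then 1 else 0)" for u v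
  proof (cases "\<sigma> v = \<sigma> u")
    case True
    then show ?thesis by (simp add: a_def nbrs_def adj_def)
  next
    case False
    then have "\<not> (v \<in> nbrs (\<sigma> u) V u \<and> u \<in> nbrs (\<sigma> v) V v)"
      by (auto simp: nbrs_def adj_def insert_commute)
    then show ?thesis using False by (auto simp: a_def)
  qed
  have "(\<Sum>u\<in>V. \<Sum>v\<in>V. 1 + 2 * (if \<sigma> v = \<sigma> u \<and> rho (\<sigma> u) v = rho (\<sigma> u) u then 1 else 0))
      \<le> (\<Sum>u\<in>V. \<Sum>v\<in>V. a u v + a v u + (if \<sigma> v = \<sigma> u then 1 else 0))"
    by (intro sum_mono pw)
  moreover have "(\<Sum>u\<in>V. \<Sum>v\<in>V. 1 + 2 * (if \<sigma> v = \<sigma> u \<and> rho (\<sigma> u) v = rho (\<sigma> u) u then 1 else 0))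
      = card V * card V + 2 * (\<Sum>u\<in>V. R u)"
  proof -
    have "(\<Sum>v\<in>V. 1 + 2 * (if \<sigma> v = \<sigma> u \<and> rho (\<sigma> u) v = rho (\<sigma> u) u then 1 else 0)) = card V + 2 * R u" for u
    proof -
      have "R u = (\<Sum>v\<in>V. if \<sigma> v = \<sigma> u \<and> rho (\<sigma> u) v = rho (\<sigma> u) u then 1 else 0)"
        using V by (simp add: R_def sum.If_cases Int_def)
      then show ?thesis by (simp only: sum.distrib flip: sum_distrib_left) simp
    qed
    then show ?thesis by (simp only: sum.distrib flip: sum_distrib_left) simp
  qed
  moreover have "(\<Sum>u\<in>V. \<Sum>v\<in>V. a u v + a v u + (if \<sigma> v = \<sigma> u then 1 else 0))
      = 2 * (\<Sum>u\<in>V. \<Sum>v\<in>V. a u v) + (\<Sum>u\<in>V. D u)"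
  proof -
    have "(\<Sum>u\<in>V. \<Sum>v\<in>V. a v u) = (\<Sum>u\<in>V. \<Sum>v\<in>V. a u v)" by (rule sum.swap)
    moreover have "(\<Sum>v\<in>V. if \<sigma> v = \<sigma> u then 1 else 0) = D u" for u
      using V by (simp add: D_def sum.If_cases Int_def)
    ultimately show ?thesis by (simp only: sum.distrib mult_2)
  qed
  moreover have "(\<Sum>u\<in>V. \<Sum>v\<in>V. a u v) \<le> card V * H"
    using sum_mono[of V "\<lambda>u. \<Sum>v\<in>V. a u v" "\<lambda>_. H"] aH by simp
  ultimately have 1: "card V * card V + 2 * (\<Sum>u\<in>V. R u) \<le> 2 * (card V * H) + (\<Sum>u\<in>V. D u)" by linarith
  have "(\<Sum>u\<in>V. D u) \<le> k * (\<Sum>u\<in>V. R u)"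
  proof -
    have cls: "(\<Sum>u\<in>{x \<in> V. \<sigma> x = c}. D u) \<le> k * (\<Sum>u\<in>{x \<in> V. \<sigma> x = c}. R u)" for c
    proof -
      define U where "U = {x \<in> V. \<sigma> x = c}"
      have U: "finite U" using V by (simp add: U_def)
      define e where "e i = card {x \<in> U. rho c x = i}" for i
      have se: "(\<Sum>i<k. e i) = card U" unfolding e_def
        using U rho_less by (intro sum_card_fibres) auto
      have "(\<Sum>u\<in>U. R u) = (\<Sum>u\<in>U. e (rho c u))"
        by (intro sum.cong) (auto simp: R_def e_def U_def intro!: arg_cong[where f = card])
      also have "\<dots> = (\<Sum>i<k. \<Sum>u\<in>{x \<in> U. rho c x = i}. e (rho c u))"
        using U rho_less by (intro sum.group[symmetric]) auto
      also have "\<dots> = (\<Sum>i<k. e i * e i)"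
      proof (intro sum.cong refl)
        fix i
        have "(\<Sum>u\<in>{x \<in> U. rho c x = i}. e (rho c u)) = (\<Sum>u\<in>{x \<in> U. rho c x = i}. e i)" by (intro sum.cong) auto
        then show "(\<Sum>u\<in>{x \<in> U. rho c x = i}. e (rho c u)) = e i * e i" by (simp add: e_def)
      qed
      finally have R: "(\<Sum>u\<in>U. R u) = (\<Sum>i<k. e i * e i)" .
      have "(\<Sum>u\<in>U. D u) = (\<Sum>u\<in>U. card U)"
        by (intro sum.cong) (auto simp: D_def U_def intro!: arg_cong[where f = card])
      then have D: "(\<Sum>u\<in>U. D u) = card U * card U" by simp
      \<comment> \<open>Cauchy-Schwarz over the \<open>k\<close> roles: at least the fraction
        \<open>1 / k\<close> of the ordered pairs in a class have equal roles.\<close>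
      have "(\<Sum>i<k. real (e i))\<^sup>2 \<le> (\<Sum>i<k. (real (e i))\<^sup>2) * card {..<k}"
        by (rule sum_squared_le_sum_of_squares)
      then have "real (card U * card U) \<le> real (k * (\<Sum>i<k. e i * e i))"
        by (simp add: power2_eq_square mult.commute flip: se)
      then show ?thesis unfolding U_def[symmetric] R D by (simp only: of_nat_le_iff)
    qed
    have "(\<Sum>c\<in>\<sigma> ` V. \<Sum>u\<in>{x \<in> V. \<sigma> x = c}. D u) \<le> (\<Sum>c\<in>\<sigma> ` V. k * (\<Sum>u\<in>{x \<in> V. \<sigma> x = c}. R u))"
      by (intro sum_mono cls)
    then show ?thesis using V by (simp add: sum.group flip: sum_distrib_left)
  qed
  moreover have "(\<Sum>u\<in>V. D u) \<le> card V * d"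
    using sum_mono[of V D "\<lambda>_. d"] d by (simp add: D_def)
  \<comment> \<open>After multiplication by \<open>k\<close>, the term with \<open>R\<close> cancels
    two of the \<open>k\<close> copies of the sum of \<open>D\<close>; this is the origin of the
    coefficient \<open>k - 2\<close>.\<close>
  moreover have "k * (card V * card V) + 2 * (k * (\<Sum>u\<in>V. R u)) \<le> 2 * (k * (card V * H)) + k * (\<Sum>u\<in>V. D u)"
    using mult_left_mono[OF 1, of k] by (simp add: algebra_simps)
  moreover have "k * (\<Sum>u\<in>V. D u) = (k - 2) * (\<Sum>u\<in>V. D u) + 2 * (\<Sum>u\<in>V. D u)"
    by (rule k_mult_eq)
  moreover have "(k - 2) * (\<Sum>u\<in>V. D u) \<le> (k - 2) * (card V * d)"
    using calculation(2) by (rule mult_left_mono) simp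
  ultimately have "k * (card V * card V) \<le> 2 * (k * (card V * H)) + (k - 2) * (card V * d)" by linarith
  then have "card V * (k * card V) \<le> card V * (2 * k * H + (k - 2) * d)" by (simp add: algebra_simps)
  then show ?thesis using V by (simp add: card_gt_0_iff)
qed

text \<open>The cliques at \<open>v\<close> in its main level are sorted by the number of their
  vertices outside the class \<open>D\<close> of \<open>v\<close>: none, one, or at least two. In
  the doubled count, those of the last kind are paid for by their incidences with outside vertices,
  which have a small codegree with \<open>v\<close> because their own main level is
  different.\<close>

lemma exceptional_vertex_degree:
  assumes V: "finite V" "v \<in> V" and H: "\<And>u. u \<in> V \<Longrightarrow> card (V - nbrs (\<sigma> u) V u) \<le> h + 1"
    and n': "card {u \<in> V. \<sigma> u = \<sigma> v} \<le> n' + 1" and m: "card V = m + 1"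
  shows "2 * card {e \<in> edges V. v \<in> e}
    \<le> 2 * balprod (k - 1) n' + m * balprod (k - 2) n' + m * balprod (k - 2) (h - 1) + 2 * balprod (k - 1) h"
proof -
  define t where "t = \<sigma> v"
  define D where "D = {u \<in> V. \<sigma> u = t}"
  define F where "F = {e \<in> cliques t V k. v \<in> e}"
  have D: "D \<subseteq> V" "finite D" "v \<in> D" using V by (auto simp: D_def t_def)
  have finF: "finite F" using V by (simp add: F_def finite_cliques)
  have kpos: "0 < k - 1" "0 < k - 2" using k4 by auto
  have cDv: "card (D - {v}) \<le> n'" using n' D by (simp add: D_def t_def)
  have cVD: "card (V - D) \<le> m"
  proof -
    have "card (V - D) \<le> card (V - {v})" using V D by (intro card_mono) auto
    then show ?thesis using V m by simp
  qed
  define F0 F1 where "F0 = {e \<in> F. e \<subseteq> D}" and "F1 = {e \<in> F. card (e - D) = 1}"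
  have fin_e: "finite e" if "e \<in> F" for e
    using that V by (auto simp: F_def cliques_def intro: finite_subset)
  have "2 * card F \<le> 2 * card F0 + card F1 + (\<Sum>e\<in>F. card (e \<inter> (V - D)))"
  proof -
    have pw: "2 \<le> 2 * (if e \<subseteq> D then 1 else 0) + (if card (e - D) = 1 then 1 else 0) + card (e \<inter> (V - D))"
      if "e \<in> F" for e
    proof -
      have eq: "e \<inter> (V - D) = e - D" using that by (auto simp: F_def cliques_def)
      show ?thesis
      proof (cases "e \<subseteq> D")
        case False
        then have "card (e - D) \<noteq> 0" using fin_e[OF that] by auto
        then show ?thesis unfolding eq by auto
      qed simp
    qed
    have "(\<Sum>e\<in>F. 2) \<le> (\<Sum>e\<in>F. 2 * (if e \<subseteq> D then 1 else 0) + (if card (e - D) = 1 then 1 else 0) + card (e \<inter> (V - D)))"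
      using pw by (rule sum_mono)
    moreover have "(\<Sum>e\<in>F. if e \<subseteq> D then 1 else 0) = card F0" "(\<Sum>e\<in>F. if card (e - D) = 1 then 1 else 0) = card F1"
      using finF by (simp_all add: F0_def F1_def sum.If_cases Int_def)
    ultimately show ?thesis by (simp add: sum.distrib flip: sum_distrib_left)
  qed
  moreover have "card F0 \<le> balprod (k - 1) n'"
  proof -
    have "card F0 \<le> card {e \<in> cliques t D k. v \<in> e}"
      using D by (intro card_mono) (auto simp: F0_def F_def cliques_def)
    also have "\<dots> \<le> balprod (k - 1) (card (nbrs t D v))" using D by (intro degree_level_le)
    also have "\<dots> \<le> balprod (k - 1) n'"
    proof (rule balprod_mono)
      have "card (nbrs t D v) \<le> card (D - {v})" using D nbrs_subset by (intro card_mono) auto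
      then show "card (nbrs t D v) \<le> n'" using cDv by linarith
    qed (rule kpos)
    finally show ?thesis .
  qed
  moreover have "card F1 \<le> m * balprod (k - 2) n'"
  proof -
    have "F1 \<subseteq> (\<Union>w\<in>V - D. {e \<in> F. e - D = {w}})"
    proof
      fix e assume e: "e \<in> F1"
      then obtain w where w: "e - D = {w}" by (auto simp: F1_def card_1_singleton_iff)
      then have "w \<in> V - D" using e by (auto simp: F1_def F_def cliques_def)
      then show "e \<in> (\<Union>w\<in>V - D. {e \<in> F. e - D = {w}})" using e w by (auto simp: F1_def)
    qed
    then have "card F1 \<le> card (\<Union>w\<in>V - D. {e \<in> F. e - D = {w}})" using finF V by (intro card_mono) auto
    also have "\<dots> \<le> (\<Sum>w\<in>V - D. card {e \<in> F. e - D = {w}})" using V by (intro card_UN_le) auto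
    also have "\<dots> \<le> (\<Sum>w\<in>V - D. balprod (k - 2) n')"
    proof (rule sum_mono)
      fix w assume w: "w \<in> V - D"
      have wv: "v \<noteq> w" using w D by auto
      have "card {e \<in> F. e - D = {w}} \<le> card {e \<in> cliques t (insert w D) k. v \<in> e \<and> w \<in> e}"
        using D by (intro card_mono) (auto simp: F_def cliques_def)
      also have "\<dots> \<le> balprod (k - 2) (card (nbrs t (nbrs t (insert w D) v) w))"
        using D wv by (intro codegree_le) auto
      also have "\<dots> \<le> balprod (k - 2) n'"
      proof (rule balprod_mono)
        have "nbrs t (nbrs t (insert w D) v) w \<subseteq> D - {v}" by (auto simp: nbrs_def adj_def)
        then have "card (nbrs t (nbrs t (insert w D) v) w) \<le> card (D - {v})" using D by (intro card_mono) auto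
        then show "card (nbrs t (nbrs t (insert w D) v) w) \<le> n'" using cDv by linarith
      qed (rule kpos)
      finally show "card {e \<in> F. e - D = {w}} \<le> balprod (k - 2) n'" .
    qed
    also have "\<dots> \<le> m * balprod (k - 2) n'" using cVD by simp
    finally show ?thesis .
  qed
  moreover have "(\<Sum>e\<in>F. card (e \<inter> (V - D))) \<le> m * balprod (k - 2) (h - 1)"
  proof -
    have "(\<Sum>e\<in>F. card (e \<inter> (V - D))) = (\<Sum>w\<in>V - D. card {e \<in> F. w \<in> e})"
      using V finF by (intro sum_card_incident[symmetric]) auto
    also have "\<dots> \<le> (\<Sum>w\<in>V - D. balprod (k - 2) (h - 1))"
    proof (rule sum_mono)
      fix w assume w: "w \<in> V - D"
      have wv: "v \<noteq> w" using w D by auto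
      have st: "\<sigma> w \<noteq> t" using w by (auto simp: D_def)
      show "card {e \<in> F. w \<in> e} \<le> balprod (k - 2) (h - 1)"
      proof (cases "adj t v w")
        case False
        then have "{e \<in> F. w \<in> e} = {}" using wv by (auto simp: F_def cliques_def clique_def)
        then show ?thesis by (simp only: card.empty le0)
      next
        case True
        have "{e \<in> F. w \<in> e} = {e \<in> cliques t V k. v \<in> e \<and> w \<in> e}" by (auto simp: F_def)
        then have "card {e \<in> F. w \<in> e} \<le> balprod (k - 2) (card (nbrs t (nbrs t V v) w))"
          using codegree_le[OF V(1) wv, of t] by simp
        also have "\<dots> \<le> balprod (k - 2) (h - 1)"
        proof (rule balprod_mono)
          \<comment> \<open>Since \<open>t\<close> is not the main level of \<open>w\<close>, all
            level-\<open>t\<close> neighbours of \<open>w\<close> lie outside its main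
            neighbourhood. So do \<open>v\<close> and \<open>w\<close>, which lowers the bound from
            \<open>h + 1\<close> to \<open>h - 1\<close>.\<close>
          have sub: "nbrs t (nbrs t V v) w \<subseteq> V - nbrs (\<sigma> w) V w - {v, w}"
            using st by (auto simp: nbrs_def adj_def)
          have vw: "{v, w} \<subseteq> V - nbrs (\<sigma> w) V w"
            using True st V w by (auto simp: nbrs_def adj_def insert_commute)
          have "card (nbrs t (nbrs t V v) w) \<le> card (V - nbrs (\<sigma> w) V w - {v, w})"
            using V sub by (intro card_mono) auto
          also have "\<dots> = card (V - nbrs (\<sigma> w) V w) - 2"
            using vw wv by (subst card_Diff_subset) auto
          also have "\<dots> \<le> h - 1" using H[of w] w by auto
          finally show "card (nbrs t (nbrs t V v) w) \<le> h - 1" .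
        qed (rule kpos)
        finally show ?thesis .
      qed
    qed
    also have "\<dots> \<le> m * balprod (k - 2) (h - 1)" using cVD by simp
    finally show ?thesis .
  qed
  moreover have "card {e \<in> edges V. v \<in> e} \<le> card F + balprod (k - 1) h"
  proof -
    obtain T where T: "finite T" "card {e \<in> edges V. v \<in> e} \<le> (\<Sum>t\<in>T. card {e \<in> cliques t V k. v \<in> e})"
      using degree_le[OF V(1)] .
    have "(\<Sum>t\<in>T. card {e \<in> cliques t V k. v \<in> e}) \<le> (\<Sum>t\<in>insert t T. card {e \<in> cliques t V k. v \<in> e})"
      using T by (intro sum_mono2) auto
    also have "\<dots> = card F + (\<Sum>t\<in>T - {t}. card {e \<in> cliques t V k. v \<in> e})"
      using T by (simp add: sum.insert_remove F_def)
    also have "(\<Sum>t\<in>T - {t}. card {e \<in> cliques t V k. v \<in> e}) \<le> (\<Sum>t\<in>T - {t}. balprod (k - 1) (card (nbrs t V v)))"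
      using V by (intro sum_mono degree_level_le)
    also have "\<dots> \<le> balprod (k - 1) (\<Sum>t\<in>T - {t}. card (nbrs t V v))"
      using T kpos by (intro sum_balprod_le) auto
    also have "\<dots> \<le> balprod (k - 1) h"
    \<comment> \<open>The neighbourhoods of \<open>v\<close> at the other levels are disjoint and
      avoid both \<open>v\<close> and its main neighbourhood, so together they have at most
      \<open>h\<close> vertices.\<close>
    proof (rule balprod_mono)
      have "(\<Sum>t\<in>T - {t}. card (nbrs t V v)) = card (\<Union>t\<in>T - {t}. nbrs t V v)"
        using V T by (intro sum_card_nbrs) auto
      also have "\<dots> \<le> card (V - nbrs t V v - {v})"
        using V by (intro card_mono) (auto simp: nbrs_def adj_def)
      also have "\<dots> = card (V - nbrs t V v) - 1"
        using V by (intro card_Diff_singleton) (auto simp: nbrs_def adj_def)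
      also have "\<dots> \<le> h" using H[OF V(2)] by (simp add: t_def)
      finally show "(\<Sum>t\<in>T - {t}. card (nbrs t V v)) \<le> h" .
    qed (rule kpos)
    finally show ?thesis using T by linarith
  qed
  ultimately show ?thesis by linarith
qed

text \<open>A clique of another level that meets two of the parts \<open>W i\<close> uses, at each of its vertices \<open>v\<close>, a pair \<open>v, w\<close>
  between two parts that is missing at level \<open>a\<close>; each such pair destroys at least \<open>l ^ (k - 2)\<close> transversals through \<open>v\<close>.\<close>

lemma uniform_level_bound:
  fixes a h :: nat and V :: "'a set"
  defines "W \<equiv> \<lambda>i. {v \<in> V. rho a v = i}" and "l \<equiv> card V - (k - 1) * (h + 1)"
  assumes V: "finite V" and H: "\<And>v. v \<in> V \<Longrightarrow> card (V - nbrs a V v) \<le> h + 1"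
    and hl: "h - 1 \<le> (k - 2) * l"
  shows "card (edges V) \<le> (\<Prod>i<k. card (W i)) + (\<Sum>i<k. card (edges (W i)))"
    and "card (W i) \<le> h + 1" and "i < k \<Longrightarrow> l \<le> card (W i)"
proof -
  have finW [simp]: "finite (W i)" for i using V by (simp add: W_def)
  show Wle: "card (W i) \<le> h + 1" for i
  proof (cases "W i = {}")
    case False
    then obtain v where v: "v \<in> W i" by auto
    have "card (W i) \<le> card (V - nbrs a V v)"
      using V v by (intro card_mono) (auto simp: W_def nbrs_def adj_def)
    then show ?thesis using H[of v] v by (simp add: W_def)
  qed simp
  have union: "card A \<le> card (A \<inter> W i) + card I * (h + 1)"
    if "A \<subseteq> V" "\<And>v. v \<in> A \<Longrightarrow> rho a v \<in> insert i I" "finite I" for A i I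
  proof -
    have "card A \<le> card ((A \<inter> W i) \<union> (\<Union>j\<in>I. W j))"
      using that V by (intro card_mono) (auto simp: W_def)
    also have "\<dots> \<le> card (A \<inter> W i) + card (\<Union>j\<in>I. W j)" by (rule card_Un_le)
    also have "card (\<Union>j\<in>I. W j) \<le> (\<Sum>j\<in>I. card (W j))" using that by (intro card_UN_le)
    also have "\<dots> \<le> card I * (h + 1)" using sum_mono[of I "\<lambda>j. card (W j)" "\<lambda>_. h + 1"] Wle by simp
    finally show ?thesis by simp
  qed
  show "l \<le> card (W i)" if "i < k" for i
  proof -
    have "card V \<le> card (V \<inter> W i) + card ({..<k} - {i}) * (h + 1)"
      using rho_less by (intro union) auto
    moreover have "V \<inter> W i = W i" by (auto simp: W_def)
    ultimately show ?thesis using that by (simp add: l_def)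
  qed
  \<comment> \<open>Outside \<open>W i\<close> there are at most \<open>h + 1\<close> vertices not
    adjacent to \<open>v\<close>, its own part included, and at most \<open>h + 1\<close> in each of
    the \<open>k - 2\<close> further parts.\<close>
  have nb: "l \<le> card (nbrs a V v \<inter> W i)" if v: "v \<in> V" and i: "i < k" "i \<noteq> rho a v" for v i
  proof -
    have "card ({..<k} - {i, rho a v}) = k - 2"
      using i rho_less by (subst card_Diff_subset) auto
    then have "card (nbrs a V v) \<le> card (nbrs a V v \<inter> W i) + (k - 2) * (h + 1)"
      using union[of "nbrs a V v" i "{..<k} - {i, rho a v}"] rho_less by (auto simp: nbrs_def adj_def)
    moreover have "card V \<le> card (nbrs a V v) + (h + 1)"
    proof -
      have "nbrs a V v \<subseteq> V" by (auto simp: nbrs_def)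
      then show ?thesis using H[OF v] card_Diff_subset[OF finite_nbrs[OF V], of a v V] by simp
    qed
    moreover have "(k - 1) * (h + 1) = (k - 2) * (h + 1) + (h + 1)"
    proof -
      have "k - 1 = (k - 2) + 1" using k4 by simp
      then show ?thesis by (metis add_mult_distrib mult_1)
    qed
    ultimately have "card V \<le> card (nbrs a V v \<inter> W i) + (k - 1) * (h + 1)" by linarith
    then show ?thesis unfolding l_def by simp
  qed
  define TT where "TT = {e. e \<subseteq> V \<and> card e = k \<and> inj_on (rho a) e}"
  define X where "X = {e \<in> edges V. \<not> clique a e \<and> (\<forall>i. \<not> e \<subseteq> W i)}"
  have finTT: "finite TT" using V by (simp add: TT_def)
  have cTT: "cliques a V k \<subseteq> TT" using clique_inj_on by (auto simp: TT_def cliques_def)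
  have "card X \<le> card (TT - cliques a V k)"
  proof -
    \<comment> \<open>Comparing at every single vertex is enough: both families consist of
      \<open>k\<close>-sets, so summation over \<open>v\<close> counts each member \<open>k\<close>
      times.\<close>
    have deg: "card {e \<in> X. v \<in> e} \<le> card {e \<in> TT - cliques a V k. v \<in> e}" if v: "v \<in> V" for v
    proof -
      define Y where "Y = {w \<in> V. rho a w \<noteq> rho a v \<and> \<not> adj a v w}"
      have finY: "finite Y" using V by (simp add: Y_def)
      have wv: "v \<noteq> w" if "w \<in> Y" for w using that by (auto simp: Y_def)
      have La: "L {v, w} \<noteq> a" if "w \<in> Y" for w using that by (auto simp: Y_def adj_def)
      have "card {e \<in> X. v \<in> e} \<le> card (\<Union>w\<in>Y. {e \<in> cliques (L {v, w}) V k. v \<in> e \<and> w \<in> e})"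
      proof (rule card_mono)
        show "{e \<in> X. v \<in> e} \<subseteq> (\<Union>w\<in>Y. {e \<in> cliques (L {v, w}) V k. v \<in> e \<and> w \<in> e})"
        proof clarify
          fix e assume e: "e \<in> X" "v \<in> e"
          then obtain t where t: "clique t e" "e \<subseteq> V" "card e = k" by (auto simp: X_def edges_def)
          then have ta: "t \<noteq> a" using e by (auto simp: X_def)
          have "\<not> e \<subseteq> W (rho a v)" using e by (auto simp: X_def)
          then obtain w where w: "w \<in> e" "rho a w \<noteq> rho a v" using t by (auto simp: W_def)
          then have "adj t v w" using t e by (auto simp: clique_def)
          then have "L {v, w} = t" by (simp add: adj_def)
          then show "e \<in> (\<Union>w\<in>Y. {e \<in> cliques (L {v, w}) V k. v \<in> e \<and> w \<in> e})"
            using w e t ta by (auto simp: Y_def cliques_def adj_def)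
        qed
      qed (use finY V in \<open>auto simp: finite_cliques\<close>)
      also have "\<dots> \<le> (\<Sum>w\<in>Y. card {e \<in> cliques (L {v, w}) V k. v \<in> e \<and> w \<in> e})"
        using finY by (rule card_UN_le)
      also have "\<dots> \<le> (\<Sum>w\<in>Y. l ^ (k - 2))"
      proof (rule sum_mono)
        fix w assume w: "w \<in> Y"
        let ?t = "L {v, w}"
        have "card {e \<in> cliques ?t V k. v \<in> e \<and> w \<in> e} \<le> balprod (k - 2) (card (nbrs ?t (nbrs ?t V v) w))"
          using V wv[OF w] by (intro codegree_le)
        also have "\<dots> \<le> balprod (k - 2) ((k - 2) * l)"
        proof (rule balprod_mono)
          have vw: "{v, w} \<subseteq> V - nbrs a V v" using w v by (auto simp: Y_def nbrs_def adj_def)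
          have "card (nbrs ?t (nbrs ?t V v) w) \<le> card (V - nbrs a V v - {v, w})"
            using V La[OF w] by (intro card_mono) (auto simp: nbrs_def adj_def)
          also have "\<dots> = card (V - nbrs a V v) - 2"
            using vw wv[OF w] by (subst card_Diff_subset) auto
          also have "\<dots> \<le> h - 1" using H[OF v] by auto
          finally show "card (nbrs ?t (nbrs ?t V v) w) \<le> (k - 2) * l" using hl by linarith
        qed (use k4 in simp)
        also have "\<dots> = l ^ (k - 2)" using k4 by (intro balprod_mult) simp
        finally show "card {e \<in> cliques ?t V k. v \<in> e \<and> w \<in> e} \<le> l ^ (k - 2)" .
      qed
      also have "\<dots> \<le> (\<Sum>w\<in>Y. card {e \<in> TT. v \<in> e \<and> w \<in> e \<and> (\<forall>u\<in>e - {v, w}. adj a v u)})"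
      proof (rule sum_mono)
        fix w assume w: "w \<in> Y"
        let ?F = "{e \<in> TT. v \<in> e \<and> w \<in> e \<and> (\<forall>u\<in>e - {v, w}. adj a v u)}"
        let ?J = "{..<k} - {rho a v, rho a w}"
        let ?P = "\<Pi>\<^sub>E i\<in>?J. nbrs a V v \<inter> W i"
        let ?f = "\<lambda>f. insert v (insert w (f ` ?J))"
        have cJ: "card ?J = k - 2" using w rho_less by (subst card_Diff_subset) (auto simp: Y_def)
        have fP: "f i \<in> nbrs a V v" "f i \<in> V" "rho a (f i) = i" if "f \<in> ?P" "i \<in> ?J" for f i
          using that by (auto simp: W_def dest!: PiE_mem)
        have "l ^ (k - 2) = (\<Prod>i\<in>?J. l)" using cJ by simp
        also have "\<dots> \<le> (\<Prod>i\<in>?J. card (nbrs a V v \<inter> W i))" using nb[OF v] by (intro prod_mono) auto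
        also have "\<dots> = card ?P" by (rule card_PiE[symmetric]) simp
        also have "\<dots> \<le> card ?F"
        proof (rule card_inj_on_le)
          show "inj_on ?f ?P"
          proof (rule inj_onI)
            fix f f' assume f: "f \<in> ?P" and f': "f' \<in> ?P" and eq: "?f f = ?f f'"
            show "f = f'"
            proof (rule PiE_ext[OF f f'])
              fix i assume i: "i \<in> ?J"
              have "f i \<in> ?f f'" using i eq by blast
              moreover have "f i \<noteq> v" "f i \<noteq> w" using fP(3)[OF f i] i by auto
              ultimately obtain j where j: "j \<in> ?J" "f i = f' j" by auto
              then have "i = j" using fP(3)[OF f i] fP(3)[OF f' j(1)] by simp
              then show "f i = f' i" using j by simp
            qed
          qed
          show "?f ` ?P \<subseteq> ?F"
          proof clarify
            fix f assume f: "f \<in> ?P"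
            have im: "rho a ` f ` ?J = ?J" using fP(3)[OF f] by force
            have vw: "rho a v \<notin> rho a ` f ` ?J" "rho a w \<notin> rho a ` f ` ?J" unfolding im by auto
            have inj: "inj_on (rho a) (?f f)"
            proof -
              have "inj_on (rho a) (f ` ?J)"
                by (rule inj_on_inverseI[where g = f]) (use fP(3)[OF f] in force)
              moreover have "rho a w \<notin> rho a ` (f ` ?J - {w})" using vw by blast
              moreover have "rho a v \<notin> rho a ` (insert w (f ` ?J) - {v})" 
              proof -
                have "rho a v \<noteq> rho a w" using w by (auto simp: Y_def)
                then show ?thesis using vw(1) unfolding image_def by blast
              qed
              ultimately show ?thesis unfolding inj_on_insert by blast
            qed
            have "rho a ` ?f f = insert (rho a v) (insert (rho a w) ?J)" unfolding image_insert im ..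
            also have "\<dots> = {..<k}" using rho_less by auto
            finally have "rho a ` ?f f = {..<k}" .
            then have "card (?f f) = k" using card_image[OF inj] by simp
            moreover have "?f f \<subseteq> V" using v w fP(2)[OF f] by (auto simp: Y_def)
            moreover have "adj a v u" if "u \<in> ?f f - {v, w}" for u
              using that fP(1)[OF f] by (auto simp: nbrs_def)
            ultimately show "?f f \<in> TT \<and> v \<in> ?f f \<and> w \<in> ?f f \<and> (\<forall>u\<in>?f f - {v, w}. adj a v u)"
              using inj unfolding TT_def by blast
          qed
        qed (use finTT in simp)
        finally show "l ^ (k - 2) \<le> card ?F" .
      qed
      \<comment> \<open>No transversal is counted for two different \<open>w\<close>: apart from
        \<open>v\<close> itself, \<open>w\<close> is its only vertex that is not adjacent to
        \<open>v\<close> at level \<open>a\<close>.\<close>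
      also have "\<dots> = card (\<Union>w\<in>Y. {e \<in> TT. v \<in> e \<and> w \<in> e \<and> (\<forall>u\<in>e - {v, w}. adj a v u)})"
        using finY finTT wv by (intro card_UN_disjoint[symmetric]) (auto simp: Y_def)
      also have "\<dots> \<le> card {e \<in> TT - cliques a V k. v \<in> e}"
        using finTT wv by (intro card_mono) (auto simp: Y_def cliques_def clique_def)
      finally show ?thesis .
    qed
    have cnt: "(\<Sum>v\<in>V. card {e \<in> F. v \<in> e}) = k * card F"
      if "finite F" "\<And>e. e \<in> F \<Longrightarrow> e \<subseteq> V \<and> card e = k" for F
    proof -
      have "(\<Sum>v\<in>V. card {e \<in> F. v \<in> e}) = (\<Sum>e\<in>F. card (e \<inter> V))" using V that by (intro sum_card_incident)
      also have "\<dots> = (\<Sum>e\<in>F. k)" using that by (intro sum.cong) (auto simp: Int_absorb2)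
      finally show ?thesis by simp
    qed
    have "k * card X = (\<Sum>v\<in>V. card {e \<in> X. v \<in> e})"
      using V by (intro cnt[symmetric]) (auto simp: X_def edges_def)
    also have "\<dots> \<le> (\<Sum>v\<in>V. card {e \<in> TT - cliques a V k. v \<in> e})" by (intro sum_mono deg)
    also have "\<dots> = k * card (TT - cliques a V k)" using finTT by (intro cnt) (auto simp: TT_def)
    finally show ?thesis using k4 by simp
  qed
  also have "card (TT - cliques a V k) = card TT - card (cliques a V k)"
    using V cTT by (intro card_Diff_subset finite_cliques)
  finally have 1: "card (cliques a V k) + card X \<le> card TT"
    using card_mono[OF finTT cTT] by linarith
  have "card TT \<le> (\<Prod>i<k. card (W i))"
    using card_transversals_le[of V "{..<k}" "rho a"] V rho_less by (auto simp: TT_def W_def)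
  moreover have "card (edges V) \<le> card (cliques a V k) + card X + (\<Sum>i<k. card (edges (W i)))"
  proof -
    have "edges V \<subseteq> (cliques a V k \<union> X) \<union> (\<Union>i<k. edges (W i))"
    proof
      fix e assume e: "e \<in> edges V"
      show "e \<in> (cliques a V k \<union> X) \<union> (\<Union>i<k. edges (W i))"
      proof (cases "clique a e \<or> e \<in> X")
        case True
        then show ?thesis using e by (auto simp: cliques_def edges_def)
      next
        case False
        then obtain i where i: "e \<subseteq> W i" using e by (auto simp: X_def)
        moreover obtain v where "v \<in> e" using e k4 by (fastforce simp: edges_def)
        ultimately have "i < k" using rho_less by (auto simp: W_def)
        then show ?thesis using i e by (auto simp: edges_def)
      qed
    qed
    then have "card (edges V) \<le> card ((cliques a V k \<union> X) \<union> (\<Union>i<k. edges (W i)))"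
      using V by (intro card_mono) (auto simp: X_def finite_cliques finite_edges)
    also have "\<dots> \<le> card (cliques a V k \<union> X) + card (\<Union>i<k. edges (W i))" by (rule card_Un_le)
    also have "card (cliques a V k \<union> X) \<le> card (cliques a V k) + card X" by (rule card_Un_le)
    also have "card (\<Union>i<k. edges (W i)) \<le> (\<Sum>i<k. card (edges (W i)))" by (intro card_UN_le) simp
    finally show ?thesis by simp
  qed
  ultimately show "card (edges V) \<le> (\<Prod>i<k. card (W i)) + (\<Sum>i<k. card (edges (W i)))" using 1 by linarith
qed

theorem card_edges_le:
  assumes "finite V"
  shows "card (edges V) \<le> gbal k (card V)"
  using assms
proof (induction "card V" arbitrary: V rule: less_induct)
  case less
  have IH: "card (edges U) \<le> gbal k (card U)" if "U \<subseteq> V" "card U < card V" for U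
    using less.hyps[OF that(2)] less.prems that(1) finite_subset by blast
  consider "card V < k" | "card V = k" | "k < card V" by linarith
  then show ?case
  proof cases
    case 1
    have "edges V = {}"
    proof (rule ccontr)
      assume "edges V \<noteq> {}"
      then obtain e where "e \<subseteq> V" "card e = k" by (auto simp: edges_def)
      then show False using 1 card_mono[OF less.prems, of e] by simp
    qed
    then show ?thesis by simp
  next
    case 2
    have "e = V" if "e \<in> edges V" for e
      using that 2 card_subset_eq[OF less.prems, of e] by (simp add: edges_def)
    then have "edges V \<subseteq> {V}" by auto
    then have "card (edges V) \<le> 1" using card_mono[of "{V}" "edges V"] by simp
    also have "1 \<le> balprod_inc k (k - 1)" using k4 by (simp add: balprod_inc_def)
    also have "\<dots> \<le> gbal_inc k (k - 1)" using k4 by (intro balprod_inc_le_gbal_inc) simp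
    also have "\<dots> \<le> gbal k (card V)" using gbal_Suc[of k "k - 1"] k4 2 by simp
    finally show ?thesis .
  next
    case 3
    define q m b i where "q = k - 1" and "m = card V - 1" and "b = m div k" and "i = m mod k"
    have kq: "k = q + 1" "3 \<le> q" "k - 2 = q - 1" using k4 by (simp_all add: q_def)
    have sm: "card V = m + 1" using 3 by (simp add: m_def)
    have m: "m = k * b + i" "i < k" using k4 by (simp_all add: b_def i_def)
    have iq: "i \<le> q" using m kq by simp
    have b1: "1 \<le> b"
    proof -
      have "k \<le> m" using 3 by (simp add: m_def)
      then show ?thesis using k4 by (simp add: b_def div_greater_zero_iff Suc_le_eq)
    qed
    have Vne: "V \<noteq> {}" using sm by auto
    define Q where "Q = balprod q (q * b + i)"
    have Qinc: "Q = balprod_inc k m" using balprod_inc_eq_balprod[of k i b] k4 m by (simp add: Q_def q_def)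
    show ?thesis
    proof (rule ccontr)
      assume big: "\<not> ?thesis"
      \<comment> \<open>Deleting \<open>v\<close> leaves at most \<open>gbal k m\<close> edges by
        induction, so the excess over \<open>gbal k m + gbal_inc k m\<close> falls to the degree of
        \<open>v\<close>.\<close>
      have deg: "Q < card {e \<in> edges V. v \<in> e}" if v: "v \<in> V" for v
      proof -
        have "edges V \<subseteq> edges (V - {v}) \<union> {e \<in> edges V. v \<in> e}" by (auto simp: edges_def)
        then have "card (edges V) \<le> card (edges (V - {v}) \<union> {e \<in> edges V. v \<in> e})"
          using less.prems by (intro card_mono) (auto simp: finite_edges)
        also have "\<dots> \<le> card (edges (V - {v})) + card {e \<in> edges V. v \<in> e}" by (rule card_Un_le)
        also have "card (edges (V - {v})) \<le> gbal k (card (V - {v}))"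
          using v less.prems by (intro IH card_Diff1_less) auto
        also have "card (V - {v}) = m" using v less.prems sm by simp
        finally have "card (edges V) \<le> gbal k m + card {e \<in> edges V. v \<in> e}" by simp
        moreover have "gbal k (card V) = gbal k m + gbal_inc k m" using sm gbal_Suc by simp
        moreover have "Q \<le> gbal_inc k m" unfolding Qinc using k4 by (intro balprod_inc_le_gbal_inc) simp
        ultimately show ?thesis using big by linarith
      qed
      define y where "y = b div (4 * (q + 1))"
      \<comment> \<open>For \<open>b < q\<close> fewer than \<open>q\<close> deviating vertices
        contain no transversal of \<open>q\<close> parts, so \<open>balprod q b = 0\<close> and the
        choice \<open>h + 1 = b\<close> is free. It is also small enough for
        \<open>class_bound\<close> to exclude this range of \<open>b\<close> altogether.\<close>
      define h where "h = (if b < q then b - 1 else b + y)"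
      have yb: "16 * y \<le> b"
      proof -
        have "y * 16 \<le> y * (4 * (q + 1))" using kq by (intro mult_left_mono) auto
        also have "\<dots> \<le> b" unfolding y_def by (rule div_times_less_eq_dividend)
        finally show ?thesis by simp
      qed
      have m4: "4 * b + i \<le> m" using m k4 by simp
      have hm: "2 * (h + 1) \<le> m"
        using yb m4 b1 kq by (auto simp: h_def)
      have split: "balprod q (m - (h + 1)) + balprod q (h + 1) \<le> Q"
      proof (cases "b < q")
        case True
        then have "h + 1 = b" using b1 by (simp add: h_def)
        moreover have "m - b = q * b + i" using m kq by simp
        ultimately show ?thesis using balprod_less[OF True] by (simp add: Q_def)
      next
        case False
        then have "m - (h + 1) = q * b + i - (y + 1)" using m kq by (simp add: h_def)
        then show ?thesis using balprod_split_le[OF kq(2) _ iq y_def] False by (simp add: Q_def h_def)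
      qed
      have "\<exists>t. card (V - nbrs t V v) \<le> h + 1" if "v \<in> V" for v
        using dominating_level[OF less.prems that sm hm] split deg[OF that] by (simp add: q_def)
      then have "\<exists>\<sigma>. \<forall>v\<in>V. card (V - nbrs (\<sigma> v) V v) \<le> h + 1" by (intro bchoice) blast
      then obtain \<sigma> where \<sigma>: "card (V - nbrs (\<sigma> v) V v) \<le> h + 1" if "v \<in> V" for v by blast
      define d where "d = Max ((\<lambda>c. card {u \<in> V. \<sigma> u = c}) ` \<sigma> ` V)"
      have dge: "card {u \<in> V. \<sigma> u = \<sigma> v} \<le> d" if "v \<in> V" for v
        using that less.prems by (auto simp: d_def)
      have "d \<in> (\<lambda>c. card {u \<in> V. \<sigma> u = c}) ` \<sigma> ` V"
        unfolding d_def using less.prems Vne by (intro Max_in) auto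
      then obtain a where a: "d = card {u \<in> V. \<sigma> u = a}" by auto
      have cb: "k * card V \<le> 2 * k * (h + 1) + (k - 2) * d"
        using class_bound[OF less.prems Vne \<sigma> dge] by simp
      have dle: "d \<le> card V" unfolding a using less.prems by (intro card_mono) auto
      \<comment> \<open>With \<open>h + 1 = b\<close> and classes of at most \<open>card V\<close>
        vertices, \<open>class_bound\<close> yields \<open>card V \<le> k * b\<close>, one less than
        the smallest possible value \<open>k * b + 1\<close>.\<close>
      have bq: "q \<le> b"
      proof (rule ccontr)
        assume "\<not> q \<le> b"
        then have "h + 1 = b" using b1 by (simp add: h_def)
        moreover have "(k - 2) * d \<le> (k - 2) * card V" using dle by (rule mult_left_mono) simp
        moreover have "k * card V \<le> 2 * k * b + (k - 2) * d" using cb \<open>h + 1 = b\<close> by (simp only:)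
        ultimately have "k * card V \<le> 2 * k * b + (k - 2) * card V" by linarith
        moreover have "k * card V = (k - 2) * card V + 2 * card V" by (rule k_mult_eq)
        ultimately show False using sm m by simp
      qed
      then have h: "h = b + y" by (simp add: h_def)
      have uni: "\<sigma> v = a" if v: "v \<in> V" for v
      proof (rule ccontr)
        assume va: "\<sigma> v \<noteq> a"
        define z where "z = card V - d"
        have zd: "card V = z + d" using dle by (simp add: z_def)
        have "(q - 1) * z + 2 * ((q + 1) * b + i + 1) \<le> 2 * ((q + 1) * (b + y + 1))"
        proof -
          have "k * card V = (k - 2) * card V + 2 * card V" by (rule k_mult_eq)
          then have "(k - 2) * z + 2 * card V \<le> 2 * k * (h + 1)"
            using cb zd by (simp add: add_mult_distrib2)
          moreover have "card V = (q + 1) * b + i + 1" using sm m kq by simp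
          ultimately show ?thesis using kq h by (simp add: algebra_simps)
        qed
        then have z: "z \<le> 4 * y + 3" by (rule exceptional_number_le[OF kq(2)])
        have "card {u \<in> V. \<sigma> u = \<sigma> v} + d = card ({u \<in> V. \<sigma> u = \<sigma> v} \<union> {u \<in> V. \<sigma> u = a})"
          unfolding a using less.prems va by (intro card_Un_disjoint[symmetric]) auto
        also have "\<dots> \<le> card V" using less.prems by (intro card_mono) auto
        \<comment> \<open>The class of \<open>v\<close> lies among the at most
          \<open>4 * y + 3\<close> vertices outside the largest class; leaving out \<open>v\<close>
          itself gives the value \<open>4 * y + 2\<close> for \<open>n'\<close>.\<close>
        finally have "card {u \<in> V. \<sigma> u = \<sigma> v} \<le> (4 * y + 2) + 1" using z zd by linarith
        then have "2 * card {e \<in> edges V. v \<in> e}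
            \<le> 2 * balprod q (4 * y + 2) + m * balprod (q - 1) (4 * y + 2) + m * balprod (q - 1) (h - 1) + 2 * balprod q h"
          using exceptional_vertex_degree[OF less.prems v \<sigma> _ sm] kq by simp
        also have "\<dots> \<le> 2 * Q" unfolding Q_def
          using m kq by (intro exceptional_bound[OF kq(2) bq iq y_def order_refl _ h]) simp
        finally show False using deg[OF v] by linarith
      qed
      define l where "l = card V - (k - 1) * (h + 1)"
      have leq: "l = (q + 1) * b + i + 1 - q * (b + y + 1)"
        using sm m kq h by (simp add: l_def)
      note ps = part_sizes[OF kq(2) bq y_def leq]
      have hl: "h - 1 \<le> (k - 2) * (card V - (k - 1) * (h + 1))"
        using ps(1) kq h by (simp add: l_def)
      have Ha: "card (V - nbrs a V v) \<le> h + 1" if "v \<in> V" for v using \<sigma>[OF that] uni[OF that] by simp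
      define W where "W j = {v \<in> V. rho a v = j}" for j
      have W1: "card (W j) \<le> h + 1" for j
        using uniform_level_bound(2)[OF less.prems Ha hl] by (simp add: W_def)
      have W2: "l \<le> card (W j)" if "j < k" for j
        using uniform_level_bound(3)[OF less.prems Ha hl that] by (simp add: W_def l_def)
      have hV: "h + 1 < card V" using hm unfolding sm by simp
      have "card (edges V) \<le> (\<Prod>j<k. card (W j)) + (\<Sum>j<k. card (edges (W j)))"
        using uniform_level_bound(1)[OF less.prems Ha hl] by (simp add: W_def)
      also have "(\<Sum>j<k. card (edges (W j))) \<le> (\<Sum>j<k. gbal k (card (W j)))"
        using W1 hV by (intro sum_mono IH) (auto simp: W_def intro: le_less_trans)
      also have "(\<Prod>j<k. card (W j)) + (\<Sum>j<k. gbal k (card (W j))) \<le> gbal k (\<Sum>j<k. card (W j))"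
      proof -
        have "(\<Sum>j<k. gbal k (card (W j))) + (\<Prod>j<k. card (W j)) \<le> gbal k (\<Sum>j<k. card (W j))"
        proof (rule sum_gbal_add_prod_le)
          show "l \<le> card (W j) \<and> card (W j) \<le> k * l" if "j \<in> {..<k}" for j
          proof -
            have "h + 1 \<le> k * l" using ps(2) kq h by simp
            then show ?thesis using W1[of j] W2[of j] that by simp
          qed
        qed (use k4 in auto)
        then show ?thesis by simp
      qed
      also have "(\<Sum>j<k. card (W j)) = card V"
        unfolding W_def using less.prems rho_less by (intro sum_card_fibres) auto
      finally show False using big by simp
    qed
  qed
qed

end

section \<open>Random levels and roles\<close>

lemma power_add_le: "(a::nat) ^ n + n * a ^ (n - 1) \<le> (a + 1) ^ n"
proof (induction n)
  case (Suc n)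
  have e: "n * a ^ (n - 1) * a = n * a ^ n" by (cases n) (simp_all add: algebra_simps)
  have "a ^ Suc n + Suc n * a ^ (Suc n - 1) \<le> a * a ^ n + a ^ n + n * a ^ (n - 1) * a + n * a ^ (n - 1)"
    unfolding e by simp
  also have "\<dots> = (a ^ n + n * a ^ (n - 1)) * (a + 1)"
    by (simp only: distrib_left distrib_right mult_1_right ac_simps)
  also have "\<dots> \<le> (a + 1) ^ n * (a + 1)" using Suc by (rule mult_right_mono) simp
  finally show ?case by (simp add: mult.commute)
qed simp

text \<open>This is \<open>(1 - 1 / x) ^ x \<le> 1 / 2\<close> cleared of denominators; both random
  choices below take it from here that enough independent trials succeed.\<close>

lemma two_mult_pred_power_le:
  assumes "1 \<le> x"
  shows "2 * (x - 1) ^ x \<le> (x::nat) ^ x"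
proof -
  obtain a where x: "x = a + 1" using assms by (metis add.commute le_add_diff_inverse)
  have "2 * a ^ (a + 1) \<le> a ^ (a + 1) + (a + 1) * a ^ (a + 1 - 1)" by simp
  also have "\<dots> \<le> (a + 1) ^ (a + 1)" by (rule power_add_le)
  finally show ?thesis by (simp add: x)
qed

lemma binomial_le_power: "n choose j \<le> n ^ j"
  by (cases "j \<le> n") (simp_all add: binomial_le_pow binomial_eq_0)

text \<open>The union bound without fractions: the event \<open>X i\<close> has probability at most
  \<open>c / (d * card \<Omega>)\<close>.\<close>

lemma exists_outside_UN:
  assumes "finite I" "finite \<Omega>" "\<And>i. i \<in> I \<Longrightarrow> X i \<subseteq> \<Omega>" "\<And>i. i \<in> I \<Longrightarrow> card (X i) * d \<le> c"
    and "card I * c < card \<Omega> * d"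
  shows "\<exists>x\<in>\<Omega>. \<forall>i\<in>I. x \<notin> X i"
proof (rule ccontr)
  assume "\<not> ?thesis"
  then have "\<Omega> \<subseteq> (\<Union>i\<in>I. X i)" by blast
  then have "card \<Omega> \<le> card (\<Union>i\<in>I. X i)"
    using assms(1-3) by (intro card_mono finite_UN_I) (auto intro: finite_subset[of _ \<Omega>])
  also have "\<dots> \<le> (\<Sum>i\<in>I. card (X i))" using assms(1) by (rule card_UN_le)
  finally have "card \<Omega> * d \<le> (\<Sum>i\<in>I. card (X i)) * d" by simp
  also have "\<dots> = (\<Sum>i\<in>I. card (X i) * d)" by (rule sum_distrib_right)
  also have "\<dots> \<le> card I * c" using sum_mono[of I "\<lambda>i. card (X i) * d" "\<lambda>_. c"] assms(4) by simp
  finally show False using assms(5) by simp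
qed

text \<open>A bad event is a pair \<open>(S, c)\<close> such that \<open>S\<close> misses the role
  \<open>c t\<close> at every level \<open>t < M\<close>. With \<open>n = k * M\<close> its
  probability is \<open>(1 - 1 / k) ^ (M * n)\<close>, at most \<open>4 ^ (- w * n)\<close> because
  \<open>M = 2 * k * w\<close>, and there are fewer than \<open>4 ^ (w * n)\<close> pairs.\<close>

lemma exists_roles:
  assumes k: "2 \<le> k" and w: "1 \<le> w" and M: "M = 2 * k * w"
  shows "\<exists>rho :: nat \<Rightarrow> nat \<Rightarrow> nat. (\<forall>t v. rho t v < k) \<and>
    (\<forall>S. S \<subseteq> {..<2 ^ w} \<and> card S = k * M \<longrightarrow> (\<exists>t<M. rho t ` S = {..<k}))"
proof -
  define n where "n = k * M"
  define N :: nat where "N = 2 ^ w"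
  define Y where "Y = ({..<M} \<rightarrow>\<^sub>E {..<k})"
  define Box where "Box c = (\<Pi>\<^sub>E t\<in>{..<M}. {..<k} - {c t})" for c :: "nat \<Rightarrow> nat"
  define \<Omega> where "\<Omega> = ({..<N} \<rightarrow>\<^sub>E Y)"
  define I where "I = {S. S \<subseteq> {..<N} \<and> card S = n} \<times> Y"
  define X where "X = (\<lambda>(S, c). \<Pi>\<^sub>E v\<in>{..<N}. if v \<in> S then Box c else Y)"
  have finY: "finite Y" by (simp add: Y_def finite_PiE)
  have cY: "card Y = k ^ M" by (simp add: Y_def card_PiE)
  have BoxY: "Box c \<subseteq> Y" for c by (auto simp: Box_def Y_def PiE_def)
  have cBox: "card (Box c) = (k - 1) ^ M" if "c \<in> Y" for c
  proof -
    have "card (Box c) = (\<Prod>t<M. card ({..<k} - {c t}))" by (simp add: Box_def card_PiE)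
    also have "\<dots> = (\<Prod>t<M. k - 1)"
    proof (rule prod.cong)
      fix t assume "t \<in> {..<M}"
      then have "c t \<in> {..<k}" using that by (auto simp: Y_def)
      then show "card ({..<k} - {c t}) = k - 1" by simp
    qed simp
    finally show ?thesis by simp
  qed
  have "\<exists>f\<in>\<Omega>. \<forall>i\<in>I. f \<notin> X i"
  proof (rule exists_outside_UN)
    show "finite I" using finY by (simp add: I_def)
    show "finite \<Omega>" using finY by (simp add: \<Omega>_def finite_PiE)
    show "X i \<subseteq> \<Omega>" if "i \<in> I" for i
      using BoxY by (auto simp: X_def \<Omega>_def PiE_def Pi_def split: prod.splits if_splits)
    show "card (X i) * k ^ (M * n) \<le> (k - 1) ^ (M * n) * k ^ (M * N)" if iI: "i \<in> I" for i
    proof -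
      obtain S c where i: "i = (S, c)" and S: "S \<subseteq> {..<N}" "card S = n" and c: "c \<in> Y"
        using iI by (auto simp: I_def)
      have "card (X i) = (\<Prod>v<N. card (if v \<in> S then Box c else Y))" by (simp add: i X_def card_PiE)
      also have "\<dots> = (\<Prod>v<N. if v \<in> S then (k - 1) ^ M else k ^ M)"
        using cBox[OF c] cY by (intro prod.cong) auto
      also have "\<dots> = ((k - 1) ^ M) ^ card S * (k ^ M) ^ card ({..<N} - S)"
        using S by (simp add: prod.If_cases Int_absorb1 Diff_eq)
      finally have "card (X i) = (k - 1) ^ (M * n) * k ^ (M * card ({..<N} - S))"
        using S by (simp add: power_mult)
      moreover have "card ({..<N} - S) + n = N"
        using S card_mono[of "{..<N}" S] by (simp add: card_Diff_subset finite_subset)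
      then have "M * card ({..<N} - S) + M * n = M * N" by (metis distrib_left)
      then have "k ^ (M * card ({..<N} - S)) * k ^ (M * n) = k ^ (M * N)" by (metis power_add)
      ultimately show ?thesis by simp
    qed
    show "card I * ((k - 1) ^ (M * n) * k ^ (M * N)) < card \<Omega> * k ^ (M * n)"
    proof -
      have M0: "0 < M" using k w M by simp
      have "card I = (N choose n) * k ^ M" using cY by (simp add: I_def card_cartesian_product n_subsets)
      also have "\<dots> \<le> N ^ n * k ^ M" using binomial_le_power by simp
      also have "\<dots> < N ^ n * 2 ^ n"
      proof -
        \<comment> \<open>The size \<open>k * M\<close> of \<open>S\<close> is chosen so that the
          \<open>k ^ M\<close> vectors \<open>c\<close> number less than
          \<open>2 ^ n\<close>.\<close>
        have "k ^ M < (2 ^ k) ^ M" using M0 by (intro power_strict_mono) auto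
        then show ?thesis by (simp add: n_def N_def power_mult)
      qed
      also have "\<dots> \<le> N ^ n * (2 ^ w) ^ n" using w by (intro mult_left_mono power_mono) (auto simp: self_le_power)
      also have "\<dots> = (4 ^ w) ^ n"
        by (simp add: N_def flip: power_mult_distrib)
      finally have I: "card I < (4 ^ w) ^ n" .
      have "4 ^ w * (k - 1) ^ M \<le> k ^ M"
      proof -
        have "(2 * (k - 1) ^ k) ^ (2 * w) \<le> (k ^ k) ^ (2 * w)"
          using two_mult_pred_power_le[of k] k by (intro power_mono) auto
        moreover have "(2 * (k - 1) ^ k) ^ (2 * w) = 4 ^ w * (k - 1) ^ M"
        proof -
          have "(2::nat) ^ (2 * w) = 4 ^ w" by (simp add: power_mult)
          moreover have "k * (2 * w) = M" by (simp add: M)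
          ultimately show ?thesis by (simp only: power_mult_distrib power_mult[symmetric])
        qed
        moreover have "(k ^ k) ^ (2 * w) = k ^ M" by (simp add: M power_mult[symmetric] ac_simps)
        ultimately show ?thesis by simp
      qed
      then have "(4 ^ w * (k - 1) ^ M) ^ n \<le> (k ^ M) ^ n" by (rule power_mono) simp
      then have *: "(4 ^ w) ^ n * (k - 1) ^ (M * n) \<le> k ^ (M * n)"
        by (simp only: power_mult_distrib power_mult)
      have pos: "0 < (k - 1) ^ (M * n)" "0 < k ^ (M * N)" using k by auto
      have "card I * ((k - 1) ^ (M * n) * k ^ (M * N)) < (4 ^ w) ^ n * ((k - 1) ^ (M * n) * k ^ (M * N))"
        using I pos by (intro mult_strict_right_mono) (simp_all only: nat_0_less_mult_iff)
      also have "\<dots> = ((4 ^ w) ^ n * (k - 1) ^ (M * n)) * k ^ (M * N)" by simp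
      also have "\<dots> \<le> k ^ (M * n) * k ^ (M * N)" using * by (rule mult_right_mono) simp
      finally have "card I * ((k - 1) ^ (M * n) * k ^ (M * N)) < k ^ (M * N) * k ^ (M * n)"
        by (simp only: mult.commute)
      moreover have "card \<Omega> = k ^ (M * N)" by (simp add: \<Omega>_def card_PiE cY power_mult)
      ultimately show ?thesis by (simp only:)
    qed
  qed
  then obtain f where f: "f \<in> \<Omega>" and avoid: "\<forall>i\<in>I. f \<notin> X i" by (rule bexE)
  define rho where "rho t v = (if t < M \<and> v < N then f v t else 0)" for t v
  have fv: "f v \<in> Y" if "v < N" for v using f that by (auto simp: \<Omega>_def)
  have fvt: "f v t < k" if "v < N" "t < M" for v t using fv[OF that(1)] that by (auto simp: Y_def)
  have less: "rho t v < k" for t v using fvt k by (simp add: rho_def)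
  have "\<exists>t<M. rho t ` S = {..<k}" if S: "S \<subseteq> {..<2 ^ w} \<and> card S = k * M" for S
  proof -
    show ?thesis
    proof (rule ccontr)
      assume "\<not> ?thesis"
      then have ne: "rho t ` S \<noteq> {..<k}" if "t < M" for t using that by blast
      have "\<exists>j. j < k \<and> j \<notin> rho t ` S" if "t < M" for t
      proof -
        have "rho t ` S \<subseteq> {..<k}" using less by auto
        then show ?thesis using ne[OF that] by blast
      qed
      then have "\<exists>c. \<forall>t\<in>{..<M}. c t < k \<and> c t \<notin> rho t ` S" by (intro bchoice) blast
      then obtain c where c: "\<And>t. t < M \<Longrightarrow> c t < k \<and> c t \<notin> rho t ` S" by blast
      define c' where "c' = restrict c {..<M}"
      have "(S, c') \<in> I" using S c by (auto simp: I_def n_def N_def Y_def c'_def)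
      moreover have "f \<in> X (S, c')"
      proof -
        have "f v \<in> Box c'" if "v \<in> S" for v
        proof -
          have v: "v < N" using that S by (auto simp: N_def)
          show ?thesis unfolding Box_def
          proof (rule PiE_I)
            fix t assume t: "t \<in> {..<M}"
            have "f v t \<in> rho t ` S" using t v that by (intro image_eqI[of _ _ v]) (simp_all add: rho_def)
            then show "f v t \<in> {..<k} - {c' t}" using c[of t] t fvt[OF v] by (auto simp: c'_def)
          qed (use fv[OF v] in \<open>auto simp: Y_def\<close>)
        qed
        then show ?thesis using f by (auto simp: X_def \<Omega>_def PiE_def Pi_def)
      qed
      ultimately show False using bspec[OF avoid] by simp
    qed
  qed
  then show ?thesis using less by (intro exI[of _ rho]) simp
qed

text \<open>Otherwise one role class with at most \<open>p\<close> vertices can be deleted at every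
  level. This costs at most \<open>M * p\<close> vertices and leaves \<open>n\<close> vertices that
  show all roles at no level.\<close>

lemma exists_balanced_level:
  fixes rho :: "nat \<Rightarrow> nat \<Rightarrow> nat"
  assumes rho: "\<And>S. S \<subseteq> V \<Longrightarrow> card S = n \<Longrightarrow> \<exists>t<M. rho t ` S = {..<k}"
    and S: "finite S" "S \<subseteq> V" "n + M * p \<le> card S"
  shows "\<exists>t<M. \<forall>i<k. p \<le> card {v \<in> S. rho t v = i}"
proof (rule ccontr)
  assume "\<not> ?thesis"
  then have "\<forall>t\<in>{..<M}. \<exists>i. i < k \<and> card {v \<in> S. rho t v = i} \<le> p" by (meson lessThan_iff nat_le_linear)
  then obtain c where c: "\<And>t. t < M \<Longrightarrow> c t < k \<and> card {v \<in> S. rho t v = c t} \<le> p" by (auto dest!: bchoice)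
  define D where "D = (\<Union>t<M. {v \<in> S. rho t v = c t})"
  have "card D \<le> (\<Sum>t<M. card {v \<in> S. rho t v = c t})" unfolding D_def by (intro card_UN_le) simp
  also have "\<dots> \<le> M * p" using sum_mono[of "{..<M}" "\<lambda>t. card {v \<in> S. rho t v = c t}" "\<lambda>_. p"] c by simp
  finally have "card D \<le> M * p" .
  moreover have "card (S - D) = card S - card D" using S by (intro card_Diff_subset) (auto simp: D_def)
  ultimately have "n \<le> card (S - D)" using S by linarith
  then obtain S' where S': "S' \<subseteq> S - D" "card S' = n" by (metis obtain_subset_with_card_n)
  then obtain t where t: "t < M" "rho t ` S' = {..<k}" using rho[of S'] S by blast
  then obtain v where "v \<in> S'" "rho t v = c t" using c[OF t(1)] by (metis imageE lessThan_iff)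
  then show False using S' t by (auto simp: D_def)
qed

section \<open>Random levels of pairs\<close>

text \<open>The disjoint sets \<open>A j\<close> receive the constant value \<open>t\<close>
  independently, each with probability \<open>M ^ (- c)\<close>. The induction splits off the
  coordinates in one set, where exactly one restriction, the constant \<open>t\<close>, is
  forbidden.\<close>

lemma card_avoiding_le:
  assumes "finite J" "finite P" "\<And>j. j \<in> J \<Longrightarrow> A j \<subseteq> P \<and> card (A j) = c" "disjoint_family_on A J" "t < M"
  shows "card {f \<in> P \<rightarrow>\<^sub>E {..<M}. \<forall>j\<in>J. \<exists>x\<in>A j. f x \<noteq> t} * (M ^ c) ^ card J \<le> (M ^ c - 1) ^ card J * M ^ card P"
  using assms(1-4)
proof (induction J arbitrary: P rule: finite_induct)
  case empty
  then show ?case by (simp add: card_PiE)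
next
  case (insert j J)
  define P' where "P' = P - A j"
  define F F' G where "F = {f \<in> P \<rightarrow>\<^sub>E {..<M}. \<forall>i\<in>insert j J. \<exists>x\<in>A i. f x \<noteq> t}"
    and "F' = {f \<in> P' \<rightarrow>\<^sub>E {..<M}. \<forall>i\<in>J. \<exists>x\<in>A i. f x \<noteq> t}"
    and "G = (A j \<rightarrow>\<^sub>E {..<M}) - {\<lambda>x\<in>A j. t}"
  have Aj: "A j \<subseteq> P" "card (A j) = c" "finite (A j)" using insert.prems(1,2) by (auto intro: finite_subset[of _ P])
  have AiP: "A i \<subseteq> P'" if "i \<in> J" for i
    using insert.prems insert.hyps that by (fastforce simp: P'_def disjoint_family_on_def)
  have "card F' * (M ^ c) ^ card J \<le> (M ^ c - 1) ^ card J * M ^ card P'"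
    unfolding F'_def
  proof (rule insert.IH)
    show "finite P'" using insert.prems by (simp add: P'_def)
    show "A i \<subseteq> P' \<and> card (A i) = c" if "i \<in> J" for i using AiP[OF that] insert.prems that by simp
    show "disjoint_family_on A J" using insert.prems by (auto simp: disjoint_family_on_def)
  qed
  moreover have "card F \<le> card (G \<times> F')"
  proof (rule card_inj_on_le)
    let ?h = "\<lambda>f. (restrict f (A j), restrict f P')"
    show "inj_on ?h F"
    proof (rule inj_onI)
      fix f f' assume f: "f \<in> F" "f' \<in> F" and eq: "?h f = ?h f'"
      show "f = f'"
      proof (rule PiE_ext)
        show "f \<in> P \<rightarrow>\<^sub>E {..<M}" "f' \<in> P \<rightarrow>\<^sub>E {..<M}" using f by (auto simp: F_def)
        fix x assume "x \<in> P"
        then show "f x = f' x" using eq by (cases "x \<in> A j") (auto simp: P'_def dest: fun_cong[where x = x] split: if_splits)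
      qed
    qed
    show "?h ` F \<subseteq> G \<times> F'"
    proof clarify
      fix f assume f: "f \<in> F"
      have fP: "f x < M" if "x \<in> P" for x using f that by (auto simp: F_def)
      obtain x where "x \<in> A j" "f x \<noteq> t" using f by (auto simp: F_def)
      then have "restrict f (A j) \<noteq> (\<lambda>x\<in>A j. t)" by (metis restrict_apply')
      then have "restrict f (A j) \<in> G" using fP Aj by (auto simp: G_def)
      moreover have "restrict f P' \<in> F'" unfolding F'_def
      proof (intro CollectI conjI ballI)
        show "restrict f P' \<in> P' \<rightarrow>\<^sub>E {..<M}" using fP by (auto simp: P'_def)
        fix i assume i: "i \<in> J"
        then obtain x where "x \<in> A i" "f x \<noteq> t" using f by (auto simp: F_def)
        then show "\<exists>x\<in>A i. restrict f P' x \<noteq> t" using AiP[OF i] by (intro bexI[of _ x]) auto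
      qed
      ultimately show "restrict f (A j) \<in> G \<and> restrict f P' \<in> F'" by blast
    qed
    show "finite (G \<times> F')" using insert.prems Aj by (simp add: G_def F'_def P'_def finite_PiE)
  qed
  moreover have "card G = M ^ c - 1"
  proof -
    have "(\<lambda>x\<in>A j. t) \<in> A j \<rightarrow>\<^sub>E {..<M}" using assms(5) by auto
    then show ?thesis using Aj by (simp add: G_def card_PiE)
  qed
  moreover have "M ^ card P' * M ^ c = M ^ card P"
  proof -
    have "card P' + c = card P"
      using Aj insert.prems card_mono[OF insert.prems(1) Aj(1)] by (simp add: P'_def card_Diff_subset)
    then show ?thesis by (metis power_add)
  qed
  ultimately have step: "card F' * (M ^ c) ^ card J \<le> (M ^ c - 1) ^ card J * M ^ card P'"
    "card F \<le> (M ^ c - 1) * card F'" "M ^ card P' * M ^ c = M ^ card P"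
    by (simp_all add: card_cartesian_product)
  have "card F * (M ^ c) ^ card (insert j J) = card F * ((M ^ c) ^ card J * M ^ c)"
    using insert.hyps by (simp add: mult.commute)
  also have "\<dots> \<le> ((M ^ c - 1) * card F') * ((M ^ c) ^ card J * M ^ c)" using step(2) by (rule mult_right_mono) simp
  also have "\<dots> = (card F' * (M ^ c) ^ card J) * ((M ^ c - 1) * M ^ c)" by (simp only: ac_simps)
  also have "\<dots> \<le> ((M ^ c - 1) ^ card J * M ^ card P') * ((M ^ c - 1) * M ^ c)" using step(1) by (rule mult_right_mono) simp
  also have "\<dots> = (M ^ c - 1) ^ card (insert j J) * (M ^ card P' * M ^ c)"
    using insert.hyps by (simp add: ac_simps)
  finally show ?case unfolding step(3) F_def .
qed

definition pairs :: "'a set \<Rightarrow> 'a set set" where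
  "pairs e = {p. p \<subseteq> e \<and> card p = 2}"

lemma card_pairs: "finite e \<Longrightarrow> card (pairs e) = card e choose 2"
  by (simp add: pairs_def n_subsets)

text \<open>The packing consists of the lines \<open>i \<mapsto> a + i * b\<close> through enumerations of the role classes.\<close>

lemma exists_line_packing:
  fixes f :: "'a \<Rightarrow> nat"
  assumes S: "finite S" and p: "\<And>i. i < k \<Longrightarrow> k * u \<le> card {v \<in> S. f v = i}"
  shows "\<exists>e. (\<forall>j\<in>{..<u} \<times> {..<u}. e j \<subseteq> S \<and> card (e j) = k \<and> inj_on f (e j)) \<and>
    disjoint_family_on (\<lambda>j. pairs (e j)) ({..<u} \<times> {..<u})"
proof -
  have "\<exists>h. inj_on h {..<k * u} \<and> h ` {..<k * u} \<subseteq> {v \<in> S. f v = i}" if "i < k" for i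
    using card_le_inj[of "{..<k * u}" "{v \<in> S. f v = i}"] S p[OF that] by auto
  then have "\<exists>h. \<forall>i\<in>{..<k}. inj_on (h i) {..<k * u} \<and> h i ` {..<k * u} \<subseteq> {v \<in> S. f v = i}"
    by (intro bchoice) auto
  then obtain h where h: "\<And>i. i < k \<Longrightarrow> inj_on (h i) {..<k * u}"
    "\<And>i x. i < k \<Longrightarrow> x < k * u \<Longrightarrow> h i x \<in> S \<and> f (h i x) = i" by (auto simp: image_subset_iff)
  define e where "e = (\<lambda>(a, b). (\<lambda>i. h i (a + i * b)) ` {..<k})"
  \<comment> \<open>The largest index on a line is at most
    \<open>(u - 1) + (k - 1) * (u - 1)\<close>, hence \<open>k * u\<close> vertices are enumerated
    in every class.\<close>
  have small: "a + i * b < k * u" if "a < u" "b < u" "i < k" for a b i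
  proof -
    have "i * b \<le> i * u" using that by simp
    then have "a + i * b < u + i * u" using that(1) by linarith
    then have "a + i * b < (i + 1) * u" by simp
    also have "\<dots> \<le> k * u" using that by (intro mult_right_mono) auto
    finally show ?thesis .
  qed
  show ?thesis
  proof (intro exI[of _ e] conjI ballI)
    fix j assume j: "j \<in> {..<u} \<times> {..<u}"
    then obtain a b where ab: "j = (a, b)" "a < u" "b < u" by auto
    have hf: "h i (a + i * b) \<in> S \<and> f (h i (a + i * b)) = i" if "i < k" for i
      using h(2)[OF that small[OF ab(2,3) that]] .
    show "e j \<subseteq> S" using hf by (auto simp: e_def ab)
    have "inj_on (\<lambda>i. h i (a + i * b)) {..<k}" using hf by (intro inj_on_inverseI[where g = f]) auto
    then show "card (e j) = k" by (simp add: e_def ab card_image)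
    show "inj_on f (e j)" by (rule inj_onI) (use hf in \<open>auto simp: e_def ab\<close>)
  next
    show "disjoint_family_on (\<lambda>j. pairs (e j)) ({..<u} \<times> {..<u})"
      unfolding disjoint_family_on_def
    proof (intro ballI impI, rule ccontr)
      fix j j' assume j: "j \<in> {..<u} \<times> {..<u}" "j' \<in> {..<u} \<times> {..<u}" "j \<noteq> j'"
        and "pairs (e j) \<inter> pairs (e j') \<noteq> {}"
      then obtain q where q: "q \<subseteq> e j" "q \<subseteq> e j'" "card q = 2" by (auto simp: pairs_def)
      then obtain x y where xy: "x \<noteq> y" "x \<in> e j" "x \<in> e j'" "y \<in> e j" "y \<in> e j'"
        by (auto simp: card_2_iff)
      obtain a b a' b' where ab: "j = (a, b)" "a < u" "b < u" "j' = (a', b')" "a' < u" "b' < u"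
        using j by auto
      have line: "f z < k \<and> a + f z * b = a' + f z * b' \<and> z = h (f z) (a + f z * b)"
        if z: "z \<in> e j" "z \<in> e j'" for z
      proof -
        obtain i i' where i: "i < k" "z = h i (a + i * b)" "i' < k" "z = h i' (a' + i' * b')"
          using z by (auto simp: e_def ab)
        have s: "a + i * b < k * u" "a' + i' * b' < k * u" using small ab i by blast+
        have fz: "f z = i" "f z = i'" using h(2)[OF i(1) s(1)] h(2)[OF i(3) s(2)] i by simp_all
        then have "h i (a + i * b) = h i (a' + i * b')" using i by simp
        then have "a + i * b = a' + i * b'" using inj_onD[OF h(1)[OF i(1)]] s fz by simp
        then show ?thesis unfolding fz(1) using i(1,2) by blast
      qed
      define H where "H i = h i (a + i * b)" for i
      have "x = H (f x)" "y = H (f y)" unfolding H_def using line[OF xy(2,3)] line[OF xy(4,5)] by blast+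
      then have fxy: "f x \<noteq> f y" using xy(1) by auto
      \<comment> \<open>Two common vertices lie in different classes, so they give two linear
        equations with different coefficients, which determine \<open>b\<close> and then
        \<open>a\<close>.\<close>
      have "int a + int (f x) * int b = int a' + int (f x) * int b'"
        "int a + int (f y) * int b = int a' + int (f y) * int b'"
        using line[OF xy(2,3)] line[OF xy(4,5)] unfolding of_nat_mult[symmetric] of_nat_add[symmetric] of_nat_eq_iff
        by blast+
      then have "(int (f x) - int (f y)) * (int b - int b') = 0"
        by (simp only: left_diff_distrib right_diff_distrib)
      then have "b = b'" using fxy by simp
      then have "a = a'" using line[OF xy(2,3)] by simp
      then show False using \<open>b = b'\<close> j ab by simp
    qed
  qed
qed

text \<open>With \<open>c = k choose 2\<close> and \<open>u = M ^ (c + 2)\<close>, a set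
  \<open>S\<close> fails with probability at most \<open>(1 - M ^ (- c)) ^ (u * u)\<close>, hence at
  most \<open>2 ^ (- (M ^ (c + 4)))\<close>, and there are at most \<open>2 ^ (w * n)\<close> sets.
  As \<open>w * n\<close> is about \<open>M * M * u / 2\<close>, this \<open>u\<close> is the
  smallest power of \<open>M\<close> for which \<open>u * u / M ^ c\<close> is larger.\<close>

lemma exists_level_structure:
  assumes k: "2 \<le> k" and w: "1 \<le> w" and M: "M = 2 * k * w"
    and n: "n = k * M + M * (k * M ^ ((k choose 2) + 2))"
  shows "\<exists>(L :: nat set \<Rightarrow> nat) (rho :: nat \<Rightarrow> nat \<Rightarrow> nat). (\<forall>t v. rho t v < k) \<and>
    (\<forall>S. S \<subseteq> {..<2 ^ w} \<and> card S = n \<longrightarrow>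
      (\<exists>t e. e \<subseteq> S \<and> card e = k \<and> inj_on (rho t) e \<and> (\<forall>p\<in>pairs e. L p = t)))"
proof -
  obtain rho :: "nat \<Rightarrow> nat \<Rightarrow> nat" where rho': "(\<forall>t v. rho t v < k) \<and>
    (\<forall>S. S \<subseteq> {..<2 ^ w} \<and> card S = k * M \<longrightarrow> (\<exists>t<M. rho t ` S = {..<k}))"
    using exists_roles[OF k w M] by (rule exE)
  have rho: "rho t v < k" "S \<subseteq> {..<2 ^ w} \<Longrightarrow> card S = k * M \<Longrightarrow> \<exists>t<M. rho t ` S = {..<k}" for t v S
    using rho' by simp_all
  define c u N where "c = k choose 2" and "u = M ^ (c + 2)" and "N = (2::nat) ^ w"
  define JJ where "JJ = {..<u} \<times> {..<u}"
  define I where "I = {S. S \<subseteq> {..<N} \<and> card S = n}"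
  have M2: "2 \<le> M" using k w by (simp add: M)
  have "\<exists>t e. t < M \<and> (\<forall>j\<in>JJ. e j \<subseteq> S \<and> card (e j) = k \<and> inj_on (rho t) (e j)) \<and>
    disjoint_family_on (\<lambda>j. pairs (e j)) JJ" if "S \<in> I" for S
  proof -
    have S: "S \<subseteq> {..<2 ^ w}" "card S = n" "finite S"
      using that by (auto simp: I_def N_def intro: finite_subset)
    \<comment> \<open>The two summands of \<open>n\<close>: \<open>k * M\<close> vertices on which
      some level shows all roles, and \<open>k * u\<close> vertices to be deleted at each of the
      \<open>M\<close> levels.\<close>
    have "k * M + M * (k * u) \<le> card S" unfolding S(2) n u_def c_def by (rule order_refl)
    from exists_balanced_level[OF rho(2) S(3,1) this]
    obtain t where t: "t < M" "\<And>i. i < k \<Longrightarrow> k * u \<le> card {v \<in> S. rho t v = i}" by blast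
    then show ?thesis using exists_line_packing[OF S(3) t(2)] unfolding JJ_def by blast
  qed
  then have "\<exists>t. \<forall>S\<in>I. \<exists>e. t S < M \<and> (\<forall>j\<in>JJ. e j \<subseteq> S \<and> card (e j) = k \<and> inj_on (rho (t S)) (e j)) \<and>
    disjoint_family_on (\<lambda>j. pairs (e j)) JJ" by (intro bchoice) blast
  then obtain t where t: "\<forall>S\<in>I. \<exists>e. t S < M \<and> (\<forall>j\<in>JJ. e j \<subseteq> S \<and> card (e j) = k \<and> inj_on (rho (t S)) (e j)) \<and>
    disjoint_family_on (\<lambda>j. pairs (e j)) JJ" by (rule exE)
  then have "\<exists>e. \<forall>S\<in>I. t S < M \<and> (\<forall>j\<in>JJ. e S j \<subseteq> S \<and> card (e S j) = k \<and> inj_on (rho (t S)) (e S j)) \<and>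
    disjoint_family_on (\<lambda>j. pairs (e S j)) JJ" by (rule bchoice)
  then obtain e where e: "\<forall>S\<in>I. t S < M \<and> (\<forall>j\<in>JJ. e S j \<subseteq> S \<and> card (e S j) = k \<and> inj_on (rho (t S)) (e S j)) \<and>
    disjoint_family_on (\<lambda>j. pairs (e S j)) JJ" by (rule exE)
  have te: "\<And>S. S \<in> I \<Longrightarrow> t S < M"
    "\<And>S j. S \<in> I \<Longrightarrow> j \<in> JJ \<Longrightarrow> e S j \<subseteq> S \<and> card (e S j) = k \<and> inj_on (rho (t S)) (e S j)"
    "\<And>S. S \<in> I \<Longrightarrow> disjoint_family_on (\<lambda>j. pairs (e S j)) JJ"
    using e by simp_all
  define P where "P = pairs {..<N}"
  define X where "X S = {L \<in> P \<rightarrow>\<^sub>E {..<M}. \<forall>j\<in>JJ. \<exists>x\<in>pairs (e S j). L x \<noteq> t S}" for S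
  have finP: "finite P" by (simp add: P_def pairs_def)
  have cJJ: "card JJ = M ^ c * M ^ (c + 4)"
  proof -
    have "(c + 2) + (c + 2) = c + (c + 4)" by simp
    then have "u * u = M ^ c * M ^ (c + 4)" unfolding u_def by (metis power_add)
    then show ?thesis by (simp add: JJ_def card_cartesian_product)
  qed
  have "\<exists>L\<in>P \<rightarrow>\<^sub>E {..<M}. \<forall>S\<in>I. L \<notin> X S"
  proof (rule exists_outside_UN)
    show "finite I" by (simp add: I_def)
    show "finite (P \<rightarrow>\<^sub>E {..<M})" using finP by (simp add: finite_PiE)
    show "X S \<subseteq> P \<rightarrow>\<^sub>E {..<M}" for S by (auto simp: X_def)
    show "card (X S) * (M ^ c) ^ card JJ \<le> (M ^ c - 1) ^ card JJ * M ^ card P" if S: "S \<in> I" for S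
      unfolding X_def
    proof (rule card_avoiding_le)
      show "pairs (e S j) \<subseteq> P \<and> card (pairs (e S j)) = c" if "j \<in> JJ" for j
      proof -
        have "e S j \<subseteq> {..<N}" using te(2)[OF S that] S by (auto simp: I_def)
        then show ?thesis using te(2)[OF S that] finite_subset[of "e S j" "{..<N}"]
          by (auto simp: P_def pairs_def card_pairs[unfolded pairs_def] c_def)
      qed
    qed (use finP te S in \<open>auto simp: JJ_def\<close>)
    show "card I * ((M ^ c - 1) ^ card JJ * M ^ card P) < card (P \<rightarrow>\<^sub>E {..<M}) * (M ^ c) ^ card JJ"
    proof -
      have "1 \<le> k choose 2" using k by (simp add: Suc_le_eq zero_less_binomial)
      then have c1: "1 \<le> c" by (simp add: c_def)
      have x2: "2 \<le> M ^ c" using M2 c1 by (metis le_trans power_increasing power_one_right one_le_numeral)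
      have wn: "w * n < M ^ (c + 4)"
      proof -
        have "2 * (w * n) = M * (M + M * M ^ (c + 2))"
          by (simp add: n M c_def algebra_simps)
        also have "\<dots> = M ^ 2 + M ^ (c + 4)" by (simp add: power_add power2_eq_square algebra_simps eval_nat_numeral)
        also have "M ^ 2 < M ^ (c + 4)" using M2 by (intro power_strict_increasing) auto
        finally show ?thesis by simp
      qed
      have "card I = N choose n" by (simp add: I_def n_subsets)
      also have "\<dots> \<le> N ^ n" by (rule binomial_le_power)
      also have "\<dots> = 2 ^ (w * n)" by (simp add: N_def power_mult)
      also have "\<dots> < 2 ^ (M ^ (c + 4))" using wn by simp
      finally have I: "card I < 2 ^ (M ^ (c + 4))" .
      have *: "2 ^ (M ^ (c + 4)) * (M ^ c - 1) ^ card JJ \<le> (M ^ c) ^ card JJ"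
      proof -
        define x K where "x = M ^ c" and "K = M ^ (c + 4)"
        have "(2 * (x - 1) ^ x) ^ K \<le> (x ^ x) ^ K"
          using two_mult_pred_power_le[of x] x2 by (intro power_mono) (auto simp: x_def)
        then have "2 ^ K * (x - 1) ^ (x * K) \<le> x ^ (x * K)"
          by (simp only: power_mult_distrib power_mult)
        then show ?thesis by (simp only: cJJ x_def K_def)
      qed
      have pos: "0 < (M ^ c - 1) ^ card JJ * M ^ card P"
        using x2 M2 by (intro mult_pos_pos zero_less_power) auto
      have "card I * ((M ^ c - 1) ^ card JJ * M ^ card P) < 2 ^ (M ^ (c + 4)) * ((M ^ c - 1) ^ card JJ * M ^ card P)"
        using I pos by (rule mult_strict_right_mono)
      also have "\<dots> = (2 ^ (M ^ (c + 4)) * (M ^ c - 1) ^ card JJ) * M ^ card P" by (simp only: ac_simps)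
      also have "\<dots> \<le> (M ^ c) ^ card JJ * M ^ card P" using * by (rule mult_right_mono) simp
      also have "\<dots> = card (P \<rightarrow>\<^sub>E {..<M}) * (M ^ c) ^ card JJ" using finP by (simp add: card_PiE)
      finally show ?thesis .
    qed
  qed
  then obtain L where L: "L \<in> P \<rightarrow>\<^sub>E {..<M}" "\<forall>S\<in>I. L \<notin> X S" by (rule bexE)
  have "\<exists>t e. e \<subseteq> S \<and> card e = k \<and> inj_on (rho t) e \<and> (\<forall>p\<in>pairs e. L p = t)" if "S \<in> I" for S
  proof -
    have "\<not> (\<forall>j\<in>JJ. \<exists>x\<in>pairs (e S j). L x \<noteq> t S)" using L(1) bspec[OF L(2) that] by (simp add: X_def)
    then obtain j where "j \<in> JJ" "\<forall>x\<in>pairs (e S j). L x = t S" by blast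
    then show ?thesis using te(2)[OF that] by (intro exI[of _ "t S"] exI[of _ "e S j"]) simp
  qed
  then have "\<forall>S. S \<subseteq> {..<2 ^ w} \<and> card S = n \<longrightarrow>
      (\<exists>t e. e \<subseteq> S \<and> card e = k \<and> inj_on (rho t) e \<and> (\<forall>p\<in>pairs e. L p = t))"
    by (simp add: I_def N_def)
  moreover have "\<forall>t v. rho t v < k" using rho(1) by blast
  ultimately show ?thesis by (intro exI[of _ L] exI[of _ rho] conjI)
qed

theorem not_ramsey_prop:
  assumes k: "4 \<le> k" and w: "1 \<le> w" and M: "M = 2 * k * w"
    and n: "n = k * M + M * (k * M ^ ((k choose 2) + 2))"
  shows "\<not> ramsey_prop k s (gbal k s + 1) n (2 ^ w)"
proof -
  obtain L :: "nat set \<Rightarrow> nat" and rho :: "nat \<Rightarrow> nat \<Rightarrow> nat" where rho: "\<And>t v. rho t v < k"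
    and mono: "\<And>S. S \<subseteq> {..<2 ^ w} \<Longrightarrow> card S = n \<Longrightarrow>
      \<exists>t e. e \<subseteq> S \<and> card e = k \<and> inj_on (rho t) e \<and> (\<forall>p\<in>pairs e. L p = t)"
  proof -
    have "2 \<le> k" using k by simp
    from exists_level_structure[OF this w M n] show ?thesis using that by blast
  qed
  interpret level_structure k L rho using k rho by unfold_locales
  let ?red = "edges {..<2 ^ w}"
  have indep: "\<exists>e. e \<subseteq> V \<and> card e = k \<and> e \<in> ?red" if V: "V \<subseteq> {..<2 ^ w}" "card V = n" for V
  proof -
    obtain t e where e: "e \<subseteq> V" "card e = k" "inj_on (rho t) e" "\<forall>p\<in>pairs e. L p = t" using mono[OF V] by blast
    have "clique t e" unfolding clique_def adj_def
    proof (intro ballI impI conjI)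
      fix u v assume uv: "u \<in> e" "v \<in> e" "u \<noteq> v"
      then have "{u, v} \<in> pairs e" by (simp add: pairs_def)
      then show "L {u, v} = t" using e by blast
      show "rho t u \<noteq> rho t v" using e uv by (auto dest: inj_onD)
    qed auto
    then show ?thesis using e V by (auto simp: edges_def)
  qed
  have few: "card {e \<in> ?red. e \<subseteq> S} \<le> gbal k s" if "S \<subseteq> {..<2 ^ w}" "card S = s" for S
  proof -
    have "{e \<in> ?red. e \<subseteq> S} = edges S" using that by (auto simp: edges_def)
    then show ?thesis using card_edges_le[of S] that finite_subset[of S "{..<2 ^ w}"] by auto
  qed
  have red: "?red \<subseteq> {e. e \<subseteq> {..<2 ^ w} \<and> card e = k}" by (auto simp: edges_def)
  show ?thesis
  proof
    assume "ramsey_prop k s (gbal k s + 1) n (2 ^ w)"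
    note rp = this[unfolded ramsey_prop_def, rule_format, OF red]
    then show False
    proof (elim disjE exE conjE)
      fix V assume "V \<subseteq> {..<2 ^ w}" "card V = n" "\<forall>e. e \<subseteq> V \<and> card e = k \<longrightarrow> e \<notin> ?red"
      then show False using indep[of V] by blast
    next
      fix S assume "S \<subseteq> {..<2 ^ w}" "card S = s" "gbal k s + 1 \<le> card {e \<in> ?red. e \<subseteq> S}"
      then show False using few[of S] by simp
    qed
  qed
qed

section \<open>The function g and monotonicity of the Ramsey property\<close>

lemma g_table_length: "length (g_table k m) = Suc m"
  by (induction m) simp_all

lemma g_table_nth: "j \<le> m \<Longrightarrow> g_table k m ! j = g k j"
proof (induction m)
  case (Suc m)
  show ?case
  proof (cases "j = Suc m")
    case True
    then show ?thesis by (simp add: g_def)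
  next
    case False
    then show ?thesis using Suc by (simp add: nth_append g_table_length)
  qed
qed (simp add: g_def)

definition partitions :: "nat \<Rightarrow> nat \<Rightarrow> nat list set" where
  "partitions k s = {xs. length xs = k \<and> sum_list xs = s \<and> (\<forall>x\<in>set xs. x < s)}"

lemma finite_partitions: "finite (partitions k s)"
proof -
  have "partitions k s \<subseteq> {xs. set xs \<subseteq> {..<s} \<and> length xs = k}" by (auto simp: partitions_def)
  then show ?thesis using finite_lists_length_eq[of "{..<s}" k] finite_subset by blast
qed

lemma g_rec:
  assumes "k \<le> s" "0 < s"
  shows "g k s = Max ((\<lambda>xs. sum_list (map (g k) xs) + prod_list xs) ` partitions k s)"
proof -
  obtain m where m: "s = Suc m" using assms(2) gr0_implies_Suc by blast
  have "g k s = g_step k s (g_table k m)" by (simp add: g_def m nth_append g_table_length)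
  also have "\<dots> = Max {sum_list (map (\<lambda>x. g_table k m ! x) xs) + prod_list xs | xs.
      length xs = k \<and> sum_list xs = s \<and> (\<forall>x\<in>set xs. x < s)}"
    using assms by (simp add: g_step_def)
  also have "{sum_list (map (\<lambda>x. g_table k m ! x) xs) + prod_list xs | xs.
      length xs = k \<and> sum_list xs = s \<and> (\<forall>x\<in>set xs. x < s)}
    = (\<lambda>xs. sum_list (map (\<lambda>x. g_table k m ! x) xs) + prod_list xs) ` partitions k s"
    by (auto simp: partitions_def)
  also have "\<dots> = (\<lambda>xs. sum_list (map (g k) xs) + prod_list xs) ` partitions k s"
  proof (rule image_cong[OF refl])
    fix xs assume "xs \<in> partitions k s"
    then have "map (\<lambda>x. g_table k m ! x) xs = map (g k) xs"
      using m by (auto simp: partitions_def g_table_nth)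
    then show "sum_list (map (\<lambda>x. g_table k m ! x) xs) + prod_list xs = sum_list (map (g k) xs) + prod_list xs"
      by (simp only:)
  qed
  finally show ?thesis .
qed

lemma balanced_in_partitions:
  assumes "2 \<le> k" "k \<le> s"
  defines "xs \<equiv> replicate (s mod k) (s div k + 1) @ replicate (k - s mod k) (s div k)"
  shows "xs \<in> partitions k s"
proof -
  have "s mod k < k" using assms by simp
  then have "sum_list xs = k * (s div k) + s mod k"
    by (simp add: xs_def sum_list_replicate algebra_simps flip: add_mult_distrib)
  moreover have "s div k + 1 < s" if "0 < s mod k"
  proof -
    have b: "1 \<le> s div k" using assms by (simp add: Suc_le_eq div_greater_zero_iff)
    have "2 * (s div k) \<le> k * (s div k)" using assms by (intro mult_right_mono) auto
    then have "2 * (s div k) + 1 \<le> s" using that mult_div_mod_eq[of k s] by linarith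
    then show ?thesis using b by linarith
  qed
  moreover have "s div k < s" using assms by (intro div_less_dividend) auto
  ultimately show ?thesis using \<open>s mod k < k\<close> by (auto simp: partitions_def xs_def)
qed

text \<open>The balanced partition is one of the candidates in the maximum. This inequality carries
  the lower bound over from \<open>gbal\<close> to \<open>g\<close>.\<close>

lemma gbal_le_g:
  assumes "2 \<le> k"
  shows "gbal k s \<le> g k s"
proof (induction s rule: less_induct)
  case (less s)
  show ?case
  proof (cases "s < k")
    case True
    have "gbal_inc k m = 0" if "m < s" for m
    proof -
      have "m div k = 0" "m < k" using that True by auto
      then have "gbal_inc k m = gbal_inc k 0 + balprod_inc k m" using gbal_inc_eq[OF assms, of m] by simp
      moreover have "balprod_inc k m = 0" using \<open>m < k\<close> that True by (simp add: balprod_inc_def)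
      ultimately show ?thesis by (simp add: gbal_inc.simps)
    qed
    then show ?thesis by (simp add: gbal_def)
  next
    case False
    define b i where "b = s div k" and "i = s mod k"
    define xs where "xs = replicate i (b + 1) @ replicate (k - i) b"
    have xs: "xs \<in> partitions k s"
      using balanced_in_partitions[OF assms, of s] False by (simp add: xs_def b_def i_def)
    have i: "i < k" and s: "s = k * b + i" using assms by (simp_all add: b_def i_def)
    have "gbal k s = i * gbal k (b + 1) + (k - i) * gbal k b + balprod k s"
      using gbal_balanced[OF assms less_imp_le[OF i], of b] by (simp add: s)
    also have "balprod k s = prod_list xs" using balprod_eq[of k i b] i by (simp add: s xs_def)
    also have "i * gbal k (b + 1) + (k - i) * gbal k b = sum_list (map (gbal k) xs)"
      by (simp add: xs_def sum_list_replicate)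
    also have "sum_list (map (gbal k) xs) \<le> sum_list (map (g k) xs)"
      using less.IH xs by (intro sum_list_mono) (auto simp: partitions_def)
    also have "sum_list (map (g k) xs) + prod_list xs \<le> g k s"
      using xs finite_partitions False assms by (subst g_rec) (auto intro!: Max_ge)
    finally show ?thesis by simp
  qed
qed

lemma g_pos:
  assumes "2 \<le> k" "k \<le> s"
  shows "1 \<le> g k s"
proof -
  have "1 \<le> balprod_inc k (k - 1)" using assms by (simp add: balprod_inc_def)
  also have "\<dots> \<le> gbal_inc k (k - 1)" using assms by (intro balprod_inc_le_gbal_inc)
  also have "\<dots> \<le> gbal k s" unfolding gbal_def using assms by (intro member_le_sum) auto
  also have "\<dots> \<le> g k s" by (rule gbal_le_g[OF assms(1)])
  finally show ?thesis .
qed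

text \<open>\<open>r\<close> is only the least \<open>N\<close> with the property; upward closure is
  what turns a failure at \<open>2 ^ w\<close> into \<open>r > 2 ^ w\<close>.\<close>

lemma ramsey_prop_mono:
  assumes "ramsey_prop k s t n N" "N \<le> N'"
  shows "ramsey_prop k s t n N'"
  unfolding ramsey_prop_def
proof (intro allI impI)
  fix red assume red: "red \<subseteq> {e. e \<subseteq> {..<N'} \<and> card e = k}"
  define red' where "red' = {e \<in> red. e \<subseteq> {..<N}}"
  have "finite {e. e \<subseteq> {..<N'} \<and> card e = k}" by simp
  then have fin: "finite red" using red by (rule rev_finite_subset)
  have sub: "{..<N} \<subseteq> {..<N'}" using assms(2) by auto
  have "red' \<subseteq> {e. e \<subseteq> {..<N} \<and> card e = k}" using red by (auto simp: red'_def)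
  then have "(\<exists>V. V \<subseteq> {..<N} \<and> card V = n \<and> (\<forall>e. e \<subseteq> V \<and> card e = k \<longrightarrow> e \<notin> red'))
      \<or> (\<exists>S. S \<subseteq> {..<N} \<and> card S = s \<and> t \<le> card {e \<in> red'. e \<subseteq> S})"
    using assms(1) unfolding ramsey_prop_def by blast
  then show "(\<exists>V. V \<subseteq> {..<N'} \<and> card V = n \<and> (\<forall>e. e \<subseteq> V \<and> card e = k \<longrightarrow> e \<notin> red))
      \<or> (\<exists>S. S \<subseteq> {..<N'} \<and> card S = s \<and> t \<le> card {e \<in> red. e \<subseteq> S})"
  proof (elim disjE exE conjE)
    fix V assume V: "V \<subseteq> {..<N}" "card V = n" "\<forall>e. e \<subseteq> V \<and> card e = k \<longrightarrow> e \<notin> red'"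
    have "e \<notin> red" if e: "e \<subseteq> V \<and> card e = k" for e
    proof -
      have "e \<notin> red'" using V(3) e by blast
      moreover have "e \<subseteq> {..<N}" using V(1) e by blast
      ultimately show ?thesis by (simp add: red'_def)
    qed
    moreover have "V \<subseteq> {..<N'}" using V(1) sub by (rule subset_trans)
    ultimately show ?thesis using V(2) by (intro disjI1 exI[of _ V] conjI allI impI)
  next
    fix S assume S: "S \<subseteq> {..<N}" "card S = s" "t \<le> card {e \<in> red'. e \<subseteq> S}"
    have "card {e \<in> red'. e \<subseteq> S} \<le> card {e \<in> red. e \<subseteq> S}"
      using fin by (intro card_mono) (auto simp: red'_def)
    then have "t \<le> card {e \<in> red. e \<subseteq> S}" using S(3) by linarith
    moreover have "S \<subseteq> {..<N'}" using S(1) sub by (rule subset_trans)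
    ultimately show ?thesis using S(2) by (intro disjI2 exI[of _ S] conjI)
  qed
qed

lemma ramsey_prop_antimono:
  assumes "ramsey_prop k s t n N" "t' \<le> t"
  shows "ramsey_prop k s t' n N"
  using assms unfolding ramsey_prop_def by (meson le_trans)

section \<open>Sets with many edges in dense hypergraphs\<close>

lemma set_Cons_alt: "set_Cons A X = (\<lambda>(x, xs). x # xs) ` (A \<times> X)"
  by (auto simp: set_Cons_def)

lemma finite_listset: "(\<And>A. A \<in> set As \<Longrightarrow> finite A) \<Longrightarrow> finite (listset As)"
  by (induction As) (auto simp: set_Cons_alt)

lemma card_listset: "card (listset As) = prod_list (map card As)"
proof (induction As)
  case (Cons A As)
  have "card (set_Cons A (listset As)) = card (A \<times> listset As)"
    unfolding set_Cons_alt by (intro card_image) (auto intro!: inj_onI)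
  then show ?case using Cons by (simp add: card_cartesian_product)
qed simp

lemma pigeonhole_fibre:
  assumes Y: "finite Y" and Z: "finite Z" "f ` Y \<subseteq> Z" and ne: "Y \<noteq> {}"
  shows "\<exists>z\<in>Z. card Y \<le> card {y \<in> Y. f y = z} * card Z"
proof (rule ccontr)
  assume "\<not> ?thesis"
  then have lt: "card {y \<in> Y. f y = z} * card Z < card Y" if "z \<in> Z" for z using that by (meson not_le)
  have Zne: "Z \<noteq> {}" using ne Z by auto
  have "card Y * card Z = (\<Sum>z\<in>Z. card {y \<in> Y. f y = z} * card Z)"
    using sum_card_fibres[OF Y Z] by (simp flip: sum_distrib_right)
  also have "\<dots> < (\<Sum>z\<in>Z. card Y)" using Z Zne lt by (intro sum_strict_mono) auto
  finally show False by (simp add: mult.commute)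
qed

text \<open>Each coordinate of the dense relation \<open>R\<close> is replaced in turn by a whole good set;
  the density exponent grows from \<open>\<alpha>\<close> to \<open>\<alpha> + 1 + s * (\<alpha> + c + 1)\<close>.\<close>

fun part_exponents :: "nat \<Rightarrow> nat \<Rightarrow> nat list \<Rightarrow> nat list" where
  "part_exponents c \<alpha> [] = []"
| "part_exponents c \<alpha> (s # ss) = (\<alpha> + c + 1) # part_exponents c (\<alpha> + 1 + s * (\<alpha> + c + 1)) ss"

lemma length_part_exponents [simp]: "length (part_exponents c \<alpha> ss) = length ss"
  by (induction ss arbitrary: \<alpha>) simp_all

lemma dense_relation_contains_box:
  assumes n: "2 \<le> n"
    and good: "\<And>s A. s \<in> set ss \<Longrightarrow> finite A \<Longrightarrow> A \<subseteq> V \<Longrightarrow> n ^ c \<le> card A \<Longrightarrow> \<exists>S\<subseteq>A. card S = s \<and> P s S"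
    and As: "map card As = map (\<lambda>e. n ^ e) (part_exponents c \<alpha> ss)" "\<And>A. A \<in> set As \<Longrightarrow> finite A \<and> A \<subseteq> V"
    and R: "R \<subseteq> listset As" "prod_list (map card As) \<le> card R * n ^ \<alpha>"
  shows "\<exists>Ss. length Ss = length ss \<and> (\<forall>i<length ss. Ss ! i \<subseteq> As ! i \<and> card (Ss ! i) = ss ! i \<and> P (ss ! i) (Ss ! i))
    \<and> listset Ss \<subseteq> R"
  using good As R
proof (induction ss arbitrary: As \<alpha> R)
  case Nil
  then have "As = []" by simp
  then have "R \<noteq> {}" using Nil.prems(5) by auto
  then have "R = {[]}" using Nil.prems(4) \<open>As = []\<close> by auto
  then show ?case by (intro exI[of _ "[]"]) simp
next
  case (Cons s ss)
  define M where "M = n ^ (\<alpha> + c + 1)"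
  define \<alpha>' where "\<alpha>' = \<alpha> + 1 + s * (\<alpha> + c + 1)"
  obtain A As' where AAs: "As = A # As'" and cA: "card A = M"
    and As': "map card As' = map (\<lambda>e. n ^ e) (part_exponents c \<alpha>' ss)"
    using Cons.prems(2) by (cases As) (auto simp: M_def \<alpha>'_def)
  have A: "finite A" "A \<subseteq> V" using Cons.prems(3) AAs by auto
  define Y where "Y = listset As'"
  have finY: "finite Y" unfolding Y_def using Cons.prems(3) AAs by (intro finite_listset) auto
  have cY: "card Y = prod_list (map card As')" by (simp add: Y_def card_listset)
  have Ypos: "0 < card Y"
  proof -
    have "prod_list (map card As') = prod_list (map (\<lambda>e. n ^ e) (part_exponents c \<alpha>' ss))" by (simp only: As')
    also have "\<dots> > 0" using n by (intro gr0I) (auto simp: prod_list_zero_iff)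
    finally show ?thesis by (simp add: cY)
  qed
  define Rf where "Rf y = {x \<in> A. x # y \<in> R}" for y
  have finRf: "finite (Rf y)" for y using A by (simp add: Rf_def)
  define m where "m = n ^ c"
  \<comment> \<open>Tails \<open>y\<close> outside \<open>Y1\<close> have fibres of fewer than
    \<open>n ^ c\<close> elements, while \<open>R\<close> has on average at least
    \<open>n ^ (c + 1)\<close> elements per tail. As \<open>n \<ge> 2\<close>, a good share of
    \<open>R\<close> lies over \<open>Y1\<close>, and fibres have at most \<open>M\<close> elements,
    so \<open>Y1\<close> contains at least the share \<open>n ^ (- (\<alpha> + 1))\<close> of all
    tails.\<close>
  define Y1 where "Y1 = {y \<in> Y. m \<le> card (Rf y)}"
  have Req: "card R = (\<Sum>y\<in>Y. card (Rf y))"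
  proof -
    have "R = (\<lambda>(y, x). x # y) ` (SIGMA y:Y. Rf y)"
      using Cons.prems(4) by (force simp: AAs Y_def Rf_def set_Cons_def)
    moreover have "inj_on (\<lambda>(y, x). x # y) (SIGMA y:Y. Rf y)" by (auto intro!: inj_onI)
    ultimately have "card R = card (SIGMA y:Y. Rf y)" by (metis card_image)
    then show ?thesis using finY finRf by (simp add: card_SigmaI)
  qed
  have "card R \<le> card Y1 * M + card Y * m"
  proof -
    have "card R \<le> (\<Sum>y\<in>Y. (if y \<in> Y1 then M else 0) + m)" unfolding Req
    proof (rule sum_mono)
      fix y assume "y \<in> Y"
      have "card (Rf y) \<le> M" using A cA card_mono[of A "Rf y"] by (auto simp: Rf_def)
      then show "card (Rf y) \<le> (if y \<in> Y1 then M else 0) + m" using \<open>y \<in> Y\<close> by (auto simp: Y1_def)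
    qed
    also have "\<dots> = (\<Sum>y\<in>Y. if y \<in> Y1 then M else 0) + card Y * m" by (simp add: sum.distrib)
    also have "(\<Sum>y\<in>Y. if y \<in> Y1 then M else 0) = card Y1 * M"
    proof -
      have "Y \<inter> Y1 = Y1" by (auto simp: Y1_def)
      then show ?thesis using finY by (simp add: sum.If_cases)
    qed
    finally show ?thesis .
  qed
  then have up: "card R * n ^ \<alpha> \<le> (card Y1 * M + card Y * m) * n ^ \<alpha>" by (rule mult_right_mono) simp
  define K where "K = m * n ^ \<alpha>"
  have Mm: "M = n * K" by (simp add: M_def m_def K_def power_add)
  have Kpos: "0 < K" using n by (simp add: m_def K_def)
  have "M * card Y \<le> card R * n ^ \<alpha>" using Cons.prems(5) by (simp add: AAs cA cY)
  then have "M * card Y \<le> (card Y1 * M + card Y * m) * n ^ \<alpha>" using up by (rule le_trans)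
  also have "\<dots> = card Y1 * M * n ^ \<alpha> + K * card Y" unfolding K_def by (simp add: algebra_simps)
  finally have 1: "M * card Y \<le> card Y1 * M * n ^ \<alpha> + K * card Y" .
  have 2: "2 * (K * card Y) \<le> n * (K * card Y)" using n by (rule mult_right_mono) simp
  have 3: "M * card Y = n * (K * card Y)" by (simp only: Mm mult.assoc)
  have "K * card Y \<le> card Y1 * M * n ^ \<alpha>" using 1 2 unfolding 3 by linarith
  also have "\<dots> = K * (card Y1 * n ^ (\<alpha> + 1))" by (simp only: Mm power_add power_one_right ac_simps)
  finally have Y1: "card Y \<le> card Y1 * n ^ (\<alpha> + 1)" using Kpos by (simp only: mult_le_cancel1)
  have finY1: "finite Y1" using finY by (simp add: Y1_def)
  have "Y1 \<noteq> {}" using Y1 Ypos by auto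
  have "\<forall>y\<in>Y1. \<exists>S. S \<subseteq> Rf y \<and> card S = s \<and> P s S"
  proof
    fix y assume "y \<in> Y1"
    then have "n ^ c \<le> card (Rf y)" by (simp add: Y1_def m_def)
    moreover have "Rf y \<subseteq> V" using A by (auto simp: Rf_def)
    ultimately show "\<exists>S. S \<subseteq> Rf y \<and> card S = s \<and> P s S" using Cons.prems(1)[of s "Rf y"] finRf by auto
  qed
  then have "\<exists>F. \<forall>y\<in>Y1. F y \<subseteq> Rf y \<and> card (F y) = s \<and> P s (F y)" by (rule bchoice)
  then obtain F where F: "\<forall>y\<in>Y1. F y \<subseteq> Rf y \<and> card (F y) = s \<and> P s (F y)" by (rule exE)
  \<comment> \<open>There are at most \<open>M ^ s\<close> possible good sets, so a single set
    \<open>S\<close> serves at least the share \<open>M ^ (- s)\<close> of \<open>Y1\<close>. This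
    accounts for \<open>s * (\<alpha> + c + 1)\<close> in the new exponent.\<close>
  define Z where "Z = {S. S \<subseteq> A \<and> card S = s}"
  have Z: "finite Z" "F ` Y1 \<subseteq> Z" using A F by (auto simp: Z_def Rf_def)
  have cZ: "card Z \<le> M ^ s"
  proof -
    have "card Z = M choose s" using A cA by (simp add: Z_def n_subsets)
    then show ?thesis by (cases "s \<le> M") (simp_all add: binomial_le_pow binomial_eq_0)
  qed
  obtain S where S: "S \<in> Z" "card Y1 \<le> card {y \<in> Y1. F y = S} * card Z"
    using pigeonhole_fibre[OF finY1 Z \<open>Y1 \<noteq> {}\<close>] by (rule bexE)
  define R' where "R' = {y \<in> Y1. F y = S}"
  have "R' \<noteq> {}"
  proof
    assume "R' = {}"
    then have "card Y1 \<le> 0" using S(2) unfolding R'_def[symmetric] by simp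
    then show False using finY1 \<open>Y1 \<noteq> {}\<close> by simp
  qed
  then obtain y0 where y0: "y0 \<in> Y1" "F y0 = S" unfolding R'_def by blast
  have "\<exists>Ss. length Ss = length ss \<and> (\<forall>i<length ss. Ss ! i \<subseteq> As' ! i \<and> card (Ss ! i) = ss ! i \<and> P (ss ! i) (Ss ! i))
    \<and> listset Ss \<subseteq> R'"
  proof (rule Cons.IH[OF _ As'])
    show "\<exists>S\<subseteq>A. card S = s \<and> P s S" if "s \<in> set ss" "finite A" "A \<subseteq> V" "n ^ c \<le> card A" for s A
      using Cons.prems(1)[OF _ that(2-4)] that(1) by simp
    show "finite A \<and> A \<subseteq> V" if "A \<in> set As'" for A using Cons.prems(3) AAs that by simp
    show "R' \<subseteq> listset As'" by (auto simp: R'_def Y1_def Y_def)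
    have "card Y \<le> (card R' * M ^ s) * n ^ (\<alpha> + 1)"
    proof -
      have "card Y1 \<le> card R' * M ^ s" using S(2) cZ unfolding R'_def by (meson le_trans mult_le_mono2)
      then have "card Y1 * n ^ (\<alpha> + 1) \<le> (card R' * M ^ s) * n ^ (\<alpha> + 1)" by (rule mult_right_mono) simp
      then show ?thesis using Y1 by linarith
    qed
    also have "\<dots> = card R' * n ^ \<alpha>'"
    proof -
      have "M ^ s = n ^ (s * (\<alpha> + c + 1))" by (simp only: M_def power_mult[symmetric] mult.commute)
      then show ?thesis by (simp only: \<alpha>'_def power_add ac_simps)
    qed
    finally show "prod_list (map card As') \<le> card R' * n ^ \<alpha>'" by (simp add: cY)
  qed
  then obtain Ss where Ss: "length Ss = length ss"
    "\<forall>i<length ss. Ss ! i \<subseteq> As' ! i \<and> card (Ss ! i) = ss ! i \<and> P (ss ! i) (Ss ! i)" "listset Ss \<subseteq> R'"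
    by (elim exE conjE)
  have SP: "S \<subseteq> A" "card S = s" "P s S" using F y0 S(1) by (auto simp: Z_def)
  have "listset (S # Ss) \<subseteq> R"
  proof
    fix xs assume "xs \<in> listset (S # Ss)"
    then obtain x y where xs: "xs = x # y" "x \<in> S" "y \<in> listset Ss" by (auto simp: set_Cons_def)
    then have "y \<in> Y1" "F y = S" using Ss(3) by (auto simp: R'_def)
    then have "x \<in> Rf y" using F xs by auto
    then show "xs \<in> R" by (simp add: Rf_def xs)
  qed
  moreover have "\<forall>i<length (s # ss). (S # Ss) ! i \<subseteq> As ! i \<and> card ((S # Ss) ! i) = (s # ss) ! i \<and> P ((s # ss) ! i) ((S # Ss) ! i)"
  proof (intro allI impI)
    fix i assume i: "i < length (s # ss)"
    show "(S # Ss) ! i \<subseteq> As ! i \<and> card ((S # Ss) ! i) = (s # ss) ! i \<and> P ((s # ss) ! i) ((S # Ss) ! i)"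
    proof (cases i)
      case 0
      then show ?thesis using SP by (simp add: AAs)
    next
      case (Suc j)
      then have "j < length ss" using i by simp
      from Ss(2)[rule_format, OF this] show ?thesis by (simp add: AAs Suc)
    qed
  qed
  moreover have "length (S # Ss) = length (s # ss)" using Ss(1) by simp
  ultimately show ?case by (intro exI[of _ "S # Ss"] conjI)
qed

section \<open>Random placement of disjoint parts\<close>

lemma exists_permutation_image:
  assumes V: "finite V" and e: "e \<subseteq> V" "e' \<subseteq> V" "card e = card e'"
  shows "\<exists>\<psi>. \<psi> permutes V \<and> \<psi> ` e = e'"
proof -
  have fin: "finite e" "finite e'" using V e finite_subset by auto
  obtain f where f: "bij_betw f e e'" using finite_same_card_bij[OF fin e(3)] by blast
  have "card (V - e) = card (V - e')" using e fin by (simp add: card_Diff_subset)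
  then obtain h where h: "bij_betw h (V - e) (V - e')" using finite_same_card_bij[of "V - e" "V - e'"] V by auto
  define \<psi> where "\<psi> x = (if x \<in> e then f x else if x \<in> V then h x else x)" for x
  have 1: "bij_betw \<psi> e e'" using f by (rule bij_betw_cong[THEN iffD1, rotated]) (simp add: \<psi>_def)
  have 2: "bij_betw \<psi> (V - e) (V - e')" using h by (rule bij_betw_cong[THEN iffD1, rotated]) (simp add: \<psi>_def)
  have "bij_betw \<psi> (e \<union> (V - e)) (e' \<union> (V - e'))" by (rule bij_betw_combine[OF 1 2]) auto
  then have "bij_betw \<psi> V V" using e by (simp add: Un_absorb1)
  then have "\<psi> permutes V" by (rule bij_imp_permutes) (use e in \<open>auto simp: \<psi>_def\<close>)
  then show ?thesis using 1 by (auto simp: bij_betw_def)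
qed

lemma listset_nth:
  assumes "xs \<in> listset As"
  shows "length xs = length As \<and> (\<forall>i<length As. xs ! i \<in> As ! i)"
  using assms
proof (induction As arbitrary: xs)
  case (Cons A As)
  then obtain y ys where xs: "xs = y # ys" "y \<in> A" "ys \<in> listset As" by (auto simp: set_Cons_def)
  then show ?case using Cons.IH[OF xs(3)] by (auto simp: nth_Cons split: nat.splits)
qed simp

abbreviation disjoint_list :: "'a set list \<Rightarrow> bool" where
  "disjoint_list \<equiv> sorted_wrt (\<lambda>A B. A \<inter> B = {})"

lemma disjoint_list_nth:
  assumes "disjoint_list As" "i < length As" "j < length As" "x \<in> As ! i" "x \<in> As ! j"
  shows "i = j"
proof (rule ccontr)
  assume "i \<noteq> j"
  then consider "i < j" | "j < i" by linarith
  then show False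
  proof cases
    case 1
    then have "As ! i \<inter> As ! j = {}" using sorted_wrt_nth_less[OF assms(1)] assms(3) by blast
    then show False using assms by blast
  next
    case 2
    then have "As ! j \<inter> As ! i = {}" using sorted_wrt_nth_less[OF assms(1)] assms(2) by blast
    then show False using assms by blast
  qed
qed

lemma card_set_transversal:
  assumes "disjoint_list As" "xs \<in> listset As"
  shows "card (set xs) = length As"
proof -
  have "distinct xs" unfolding distinct_conv_nth
  proof (intro allI impI notI)
    fix i j assume ij: "i < length xs" "j < length xs" "i \<noteq> j" "xs ! i = xs ! j"
    then have "xs ! i \<in> As ! i" "xs ! i \<in> As ! j" using listset_nth[OF assms(2)] by auto
    then show False using disjoint_list_nth[OF assms(1)] ij listset_nth[OF assms(2)] by auto
  qed
  then show ?thesis using listset_nth[OF assms(2)] by (simp add: distinct_card)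
qed

lemma inj_on_set_listset:
  assumes "disjoint_list As"
  shows "inj_on set (listset As)"
proof (rule inj_onI)
  fix xs ys assume x: "xs \<in> listset As" and y: "ys \<in> listset As" and eq: "set xs = set ys"
  note lx = listset_nth[OF x] and ly = listset_nth[OF y]
  show "xs = ys"
  proof (rule nth_equalityI)
    fix i assume i: "i < length xs"
    then have "xs ! i \<in> set ys" using eq nth_mem by blast
    then obtain j where j: "j < length ys" "ys ! j = xs ! i" by (auto simp: in_set_conv_nth)
    have "ys ! j \<in> As ! i" "ys ! j \<in> As ! j" using lx ly i j by auto
    then have "i = j" using disjoint_list_nth[OF assms] lx ly i j by auto
    then show "xs ! i = ys ! i" using j by simp
  qed (use lx ly in simp)
qed

lemma exists_disjoint_list:
  assumes "finite V" "sum_list ns \<le> card V"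
  shows "\<exists>As. map card As = ns \<and> disjoint_list As \<and> (\<forall>A\<in>set As. A \<subseteq> V)"
  using assms
proof (induction ns arbitrary: V)
  case (Cons n ns)
  then obtain A where A: "A \<subseteq> V" "card A = n" by (metis add_leD1 obtain_subset_with_card_n sum_list.Cons)
  have "card (V - A) = card V - n" using card_Diff_subset[OF finite_subset[OF A(1) Cons.prems(1)] A(1)] A(2) by simp
  then have "sum_list ns \<le> card (V - A)" using Cons.prems by simp
  then obtain As where "map card As = ns \<and> disjoint_list As \<and> (\<forall>B\<in>set As. B \<subseteq> V - A)"
    using Cons.IH[of "V - A"] Cons.prems by auto
  then show ?case using A by (intro exI[of _ "A # As"]) auto
qed simp

text \<open>A uniformly random permutation of \<open>V\<close> turns every transversal into a
  uniformly random \<open>k\<close>-set, which is red with probability at least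
  \<open>n ^ (- k)\<close>. Some permutation reaches the average number of red transversals.\<close>

lemma exists_dense_parts:
  assumes V: "finite V" "n \<le> card V" and len: "length As = k"
    and dense: "\<And>W. W \<subseteq> V \<Longrightarrow> card W = n \<Longrightarrow> \<exists>e\<in>red. e \<subseteq> W \<and> card e = k"
    and As: "disjoint_list As" "\<And>A. A \<in> set As \<Longrightarrow> A \<subseteq> V"
  shows "\<exists>As'. map card As' = map card As \<and> disjoint_list As' \<and> (\<forall>A\<in>set As'. A \<subseteq> V) \<and>
    prod_list (map card As) \<le> card {xs \<in> listset As'. set xs \<in> red} * n ^ k"
proof -
  define Perms where "Perms = {\<pi>. \<pi> permutes V}"
  define c where "c e = card {\<pi> \<in> Perms. \<pi> ` e \<in> red}" for e
  have finPerms: "finite Perms" using V by (simp add: Perms_def finite_permutations)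
  have "id \<in> Perms" by (simp add: Perms_def permutes_id)
  then have posPerms: "0 < card Perms" using finPerms by (auto simp: card_gt_0_iff)
  have finA: "finite A" if "A \<in> set As" for A using As(2)[OF that] V(1) by (rule finite_subset)
  then have finL: "finite (listset As)" by (rule finite_listset)
  have c_le: "c e' \<le> c e" if e: "e \<subseteq> V" "e' \<subseteq> V" "card e = card e'" for e e'
  proof -
    obtain \<psi> where "\<psi> permutes V \<and> \<psi> ` e = e'" using exists_permutation_image[OF V(1) e] by (rule exE)
    then have \<psi>: "\<psi> permutes V" "\<psi> ` e = e'" by simp_all
    have "inj_on (\<lambda>\<pi>. \<pi> \<circ> \<psi>) {\<pi> \<in> Perms. \<pi> ` e' \<in> red}"
    proof (rule inj_onI)
      fix p p' assume eq: "p \<circ> \<psi> = p' \<circ> \<psi>"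
      show "p = p'"
      proof
        fix y
        obtain x where "y = \<psi> x" using surjD[OF permutes_surj[OF \<psi>(1)]] by (rule exE)
        then show "p y = p' y" using fun_cong[OF eq, of x] by simp
      qed
    qed
    moreover have "(\<lambda>\<pi>. \<pi> \<circ> \<psi>) ` {\<pi> \<in> Perms. \<pi> ` e' \<in> red} \<subseteq> {\<pi> \<in> Perms. \<pi> ` e \<in> red}"
    proof clarify
      fix \<pi> assume p: "\<pi> \<in> Perms" "\<pi> ` e' \<in> red"
      have "(\<pi> \<circ> \<psi>) ` e = \<pi> ` e'" using \<psi>(2) by (simp only: image_comp[symmetric])
      moreover have "\<pi> \<circ> \<psi> \<in> Perms" using p \<psi> by (simp add: Perms_def permutes_compose)
      ultimately show "\<pi> \<circ> \<psi> \<in> Perms \<and> (\<pi> \<circ> \<psi>) ` e \<in> red" using p by simp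
    qed
    ultimately show ?thesis unfolding c_def using finPerms by (intro card_inj_on_le) auto
  qed
  obtain W0 where W0: "W0 \<subseteq> V" "card W0 = n" using V(2) by (metis obtain_subset_with_card_n)
  have finW0: "finite W0" using W0(1) V(1) by (rule finite_subset)
  \<comment> \<open>Every permutation maps the fixed \<open>n\<close>-set \<open>W0\<close> onto a
    set with a red edge, so it makes one of the at most \<open>n ^ k\<close> candidates in
    \<open>W0\<close> red, and by symmetry all \<open>k\<close>-sets are made red equally
    often.\<close>
  have Perms_le: "card Perms \<le> c e * n ^ k" if e: "e \<subseteq> V" "card e = k" for e
  proof -
    define K where "K = {e. e \<subseteq> W0 \<and> card e = k}"
    have finK: "finite K" using finW0 by (simp add: K_def)
    have "Perms \<subseteq> (\<Union>d\<in>K. {\<pi> \<in> Perms. \<pi> ` d \<in> red})"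
    proof
      fix \<pi> assume p: "\<pi> \<in> Perms"
      then have perm: "\<pi> permutes V" by (simp add: Perms_def)
      then have inj: "inj \<pi>" by (rule permutes_inj)
      have "\<pi> ` W0 \<subseteq> V" using W0 permutes_image[OF perm] by blast
      moreover have "card (\<pi> ` W0) = n" using W0 inj by (simp add: card_image inj_on_subset)
      ultimately obtain d where d: "d \<in> red" "d \<subseteq> \<pi> ` W0" "card d = k" using dense by blast
      define d' where "d' = {x \<in> W0. \<pi> x \<in> d}"
      have im: "\<pi> ` d' = d" using d by (auto simp: d'_def)
      then have "card d' = k" using d inj by (metis card_image inj_on_subset subset_UNIV)
      then have "d' \<in> K" by (auto simp: K_def d'_def)
      then show "\<pi> \<in> (\<Union>d\<in>K. {\<pi> \<in> Perms. \<pi> ` d \<in> red})" using im d p by auto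
    qed
    then have "card Perms \<le> card (\<Union>d\<in>K. {\<pi> \<in> Perms. \<pi> ` d \<in> red})" using finK finPerms by (intro card_mono) auto
    also have "\<dots> \<le> (\<Sum>d\<in>K. c d)" unfolding c_def using finK by (rule card_UN_le)
    also have "\<dots> \<le> (\<Sum>d\<in>K. c e)" using e W0 by (intro sum_mono c_le) (auto simp: K_def)
    also have "\<dots> = (n choose k) * c e" using W0 finW0 by (simp add: K_def n_subsets)
    also have "\<dots> \<le> n ^ k * c e"
      by (intro mult_right_mono) (cases "k \<le> n"; simp add: binomial_le_pow binomial_eq_0)+
    finally show ?thesis by (simp add: mult.commute)
  qed
  define D where "D \<pi> = card {xs \<in> listset As. \<pi> ` set xs \<in> red}" for \<pi>
  have "\<exists>\<pi>\<in>Perms. card (listset As) \<le> D \<pi> * n ^ k"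
  proof (rule ccontr)
    assume "\<not> ?thesis"
    then have lt: "D \<pi> * n ^ k < card (listset As)" if "\<pi> \<in> Perms" for \<pi> using that by (meson not_le)
    have "card (listset As) * card Perms = (\<Sum>xs\<in>listset As. card Perms)" by simp
    also have "\<dots> \<le> (\<Sum>xs\<in>listset As. c (set xs) * n ^ k)"
    proof (rule sum_mono)
      fix xs assume xs: "xs \<in> listset As"
      have "set xs \<subseteq> V"
      proof
        fix x assume "x \<in> set xs"
        then obtain i where "i < length xs" "x = xs ! i" by (auto simp: in_set_conv_nth)
        then have "x \<in> As ! i" "i < length As" using listset_nth[OF xs] by auto
        then show "x \<in> V" using As(2) nth_mem by blast
      qed
      then show "card Perms \<le> c (set xs) * n ^ k" using card_set_transversal[OF As(1) xs] len by (intro Perms_le) auto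
    qed
    also have "\<dots> = (\<Sum>xs\<in>listset As. c (set xs)) * n ^ k" by (rule sum_distrib_right[symmetric])
    also have "(\<Sum>xs\<in>listset As. c (set xs)) = (\<Sum>xs\<in>listset As. \<Sum>\<pi>\<in>Perms. if \<pi> ` set xs \<in> red then 1 else 0)"
      using finPerms by (simp add: c_def sum.If_cases Int_def)
    also have "\<dots> = (\<Sum>\<pi>\<in>Perms. \<Sum>xs\<in>listset As. if \<pi> ` set xs \<in> red then 1 else 0)" by (rule sum.swap)
    also have "\<dots> = (\<Sum>\<pi>\<in>Perms. D \<pi>)" using finL by (simp add: D_def sum.If_cases Int_def)
    also have "(\<Sum>\<pi>\<in>Perms. D \<pi>) * n ^ k = (\<Sum>\<pi>\<in>Perms. D \<pi> * n ^ k)" by (rule sum_distrib_right)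
    also have "\<dots> < (\<Sum>\<pi>\<in>Perms. card (listset As))"
      using finPerms posPerms lt by (intro sum_strict_mono) auto
    finally show False by (simp add: mult.commute)
  qed
  then obtain \<pi> where \<pi>: "\<pi> \<in> Perms" "card (listset As) \<le> D \<pi> * n ^ k" by (rule bexE)
  then have perm: "\<pi> permutes V" by (simp add: Perms_def)
  then have inj: "inj \<pi>" by (rule permutes_inj)
  define As' where "As' = map ((`) \<pi>) As"
  have map_in: "map \<pi> xs \<in> listset (map ((`) \<pi>) Bs)" if "xs \<in> listset Bs" for xs Bs
    using that by (induction Bs arbitrary: xs) (auto simp: set_Cons_def)
  have "D \<pi> \<le> card {xs \<in> listset As'. set xs \<in> red}"
    unfolding D_def
  proof (rule card_inj_on_le)
    show "inj_on (map \<pi>) {xs \<in> listset As. \<pi> ` set xs \<in> red}"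
      using inj by (intro inj_on_subset[OF inj_mapI]) auto
    show "map \<pi> ` {xs \<in> listset As. \<pi> ` set xs \<in> red} \<subseteq> {xs \<in> listset As'. set xs \<in> red}"
      using map_in by (auto simp: As'_def)
    have "finite (listset As')" using finA unfolding As'_def by (intro finite_listset) auto
    then show "finite {xs \<in> listset As'. set xs \<in> red}" by simp
  qed
  then have "D \<pi> * n ^ k \<le> card {xs \<in> listset As'. set xs \<in> red} * n ^ k" by (rule mult_right_mono) simp
  then have "prod_list (map card As) \<le> card {xs \<in> listset As'. set xs \<in> red} * n ^ k"
    using \<pi>(2) unfolding card_listset by linarith
  moreover have "map card As' = map card As"
    using inj by (simp add: As'_def card_image inj_on_subset)
  moreover have "disjoint_list As'"
    unfolding As'_def sorted_wrt_map using As(1) by (rule sorted_wrt_mono_rel[rotated]) (use inj in \<open>auto dest: injD\<close>)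
  moreover have "\<forall>A\<in>set As'. A \<subseteq> V" using As(2) permutes_image[OF perm] by (auto simp: As'_def)
  ultimately show ?thesis by blast
qed

section \<open>The polynomial upper bound\<close>

lemma g_less: "s < k \<Longrightarrow> g k s = 0"
  by (cases s) (simp_all add: g_def g_step_def nth_append g_table_length)

text \<open>The density hypothesis passes to subsets of \<open>V\<close>, so the induction
  hypothesis applies inside every piece with enough vertices. The exponent is quantified before
  \<open>n\<close>, \<open>V\<close> and \<open>red\<close>, which makes the bound
  polynomial.\<close>

lemma exists_g_dense_set:
  assumes k: "2 \<le> k"
  shows "\<exists>c. \<forall>n (V :: nat set) red. k \<le> n \<longrightarrow> s \<le> n \<longrightarrow> finite V \<longrightarrow> n ^ c \<le> card V \<longrightarrow>
    (\<forall>W. W \<subseteq> V \<longrightarrow> card W = n \<longrightarrow> (\<exists>e\<in>red. e \<subseteq> W \<and> card e = k)) \<longrightarrow>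
    (\<exists>S\<subseteq>V. card S = s \<and> g k s \<le> card {e \<in> red. e \<subseteq> S \<and> card e = k})"
proof (induction s rule: less_induct)
  case (less s)
  show ?case
  proof (cases "s < k")
    case True
    show ?thesis
    proof (intro exI[of _ "1::nat"] allI impI)
      fix n and V :: "nat set" and red :: "nat set set"
      assume "s \<le> n" "n ^ 1 \<le> card V"
      then have "s \<le> card V" by simp
      then obtain S where "S \<subseteq> V" "card S = s" by (metis obtain_subset_with_card_n)
      then show "\<exists>S\<subseteq>V. card S = s \<and> g k s \<le> card {e \<in> red. e \<subseteq> S \<and> card e = k}"
        using g_less[OF True] by (intro exI[of _ S]) simp
    qed
  next
    case False
    then have ks: "k \<le> s" "0 < s" using k by auto
    have ne: "partitions k s \<noteq> {}" using balanced_in_partitions[OF k ks(1)] by blast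
    have "g k s \<in> (\<lambda>xs. sum_list (map (g k) xs) + prod_list xs) ` partitions k s"
      unfolding g_rec[OF ks] using finite_partitions ne by (intro Max_in) auto
    then obtain ss where ss: "ss \<in> partitions k s" "g k s = sum_list (map (g k) ss) + prod_list ss" by auto
    have len: "length ss = k" and sum: "sum_list ss = s" and lt: "\<And>x. x \<in> set ss \<Longrightarrow> x < s"
      using ss by (auto simp: partitions_def)
    define Good where "Good x c \<longleftrightarrow> (\<forall>n (V :: nat set) red. k \<le> n \<longrightarrow> x \<le> n \<longrightarrow> finite V \<longrightarrow> n ^ c \<le> card V \<longrightarrow>
      (\<forall>W. W \<subseteq> V \<longrightarrow> card W = n \<longrightarrow> (\<exists>e\<in>red. e \<subseteq> W \<and> card e = k)) \<longrightarrow>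
      (\<exists>S\<subseteq>V. card S = x \<and> g k x \<le> card {e \<in> red. e \<subseteq> S \<and> card e = k}))" for x c
    have "\<forall>x\<in>set ss. \<exists>c. Good x c"
    proof
      fix x assume "x \<in> set ss"
      then show "\<exists>c. Good x c" unfolding Good_def by (intro less.IH lt)
    qed
    then have "\<exists>cf. \<forall>x\<in>set ss. Good x (cf x)" by (rule bchoice)
    then obtain cf where cf: "\<forall>x\<in>set ss. Good x (cf x)" by (rule exE)
    define c where "c = Max (cf ` set ss)"
    have cf_le: "cf x \<le> c" if "x \<in> set ss" for x using that by (simp add: c_def)
    \<comment> \<open>The initial density exponent \<open>k\<close> is the loss \<open>n ^ k\<close>
      in \<open>exists_dense_parts\<close>; \<open>c\<close> is a common exponent for all part sizes
      \<open>x < s\<close>.\<close>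
    define es where "es = part_exponents c k ss"
    show ?thesis
    \<comment> \<open>Each of the \<open>k\<close> parts has at most \<open>n ^ sum_list es\<close>
      vertices; the additional factor \<open>n \<ge> k\<close> makes room for all of them.\<close>
    proof (intro exI[of _ "sum_list es + 1"] allI impI)
      fix n and V :: "nat set" and red :: "nat set set"
      assume n: "k \<le> n" "s \<le> n" and V: "finite V" "n ^ (sum_list es + 1) \<le> card V"
        and dense: "\<forall>W. W \<subseteq> V \<longrightarrow> card W = n \<longrightarrow> (\<exists>e\<in>red. e \<subseteq> W \<and> card e = k)"
      have n1: "1 \<le> n" "2 \<le> n" using n k by auto
      have "sum_list (map (\<lambda>e. n ^ e) es) \<le> sum_list (map (\<lambda>e. n ^ sum_list es) es)"
        using n1 by (intro sum_list_mono power_increasing member_le_sum_list) auto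
      also have "\<dots> = k * n ^ sum_list es" by (simp add: es_def len map_replicate_const sum_list_replicate)
      also have "\<dots> \<le> n ^ (sum_list es + 1)" using n by simp
      also have "\<dots> \<le> card V" by (rule V(2))
      finally obtain As0 where As0: "map card As0 = map (\<lambda>e. n ^ e) es" "disjoint_list As0" "\<forall>A\<in>set As0. A \<subseteq> V"
        using exists_disjoint_list[OF V(1)] by blast
      have lenA0: "length As0 = k" using arg_cong[OF As0(1), of length] by (simp add: es_def len)
      have "n ^ 1 \<le> n ^ (sum_list es + 1)" using n1 by (intro power_increasing) auto
      then have nV: "n \<le> card V" using V(2) unfolding power_one_right by linarith
      obtain As where A: "map card As = map card As0 \<and> disjoint_list As \<and> (\<forall>A\<in>set As. A \<subseteq> V) \<and>
          prod_list (map card As0) \<le> card {xs \<in> listset As. set xs \<in> red} * n ^ k"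
        using exists_dense_parts[OF V(1) nV lenA0 dense[rule_format] As0(2) As0(3)[rule_format]] by (rule exE)
      note As = conjunct1[OF A] conjunct1[OF conjunct2[OF A]] conjunct1[OF conjunct2[OF conjunct2[OF A]]]
        conjunct2[OF conjunct2[OF conjunct2[OF A]]]
      have lenA: "length As = k" using arg_cong[OF As(1), of length] lenA0 by simp
      define P where "P x S \<longleftrightarrow> g k x \<le> card {e \<in> red. e \<subseteq> S \<and> card e = k}" for x and S :: "nat set"
      have "\<exists>Ss. length Ss = length ss \<and> (\<forall>i<length ss. Ss ! i \<subseteq> As ! i \<and> card (Ss ! i) = ss ! i \<and> P (ss ! i) (Ss ! i))
        \<and> listset Ss \<subseteq> {xs \<in> listset As. set xs \<in> red}"
      proof (rule dense_relation_contains_box)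
        show "2 \<le> n" by (rule n1)
        show "\<exists>S\<subseteq>A. card S = x \<and> P x S" if x: "x \<in> set ss" and A: "finite A" "A \<subseteq> V" "n ^ c \<le> card A" for x A
        proof -
          have "n ^ cf x \<le> n ^ c" using n1 cf_le[OF x] by (intro power_increasing) auto
          then have "n ^ cf x \<le> card A" using A by linarith
          moreover have "x \<le> n" using lt[OF x] n by simp
          moreover have "\<forall>W. W \<subseteq> A \<longrightarrow> card W = n \<longrightarrow> (\<exists>e\<in>red. e \<subseteq> W \<and> card e = k)"
            using dense A(2) by blast
          ultimately show ?thesis unfolding P_def
            using bspec[OF cf x, unfolded Good_def, THEN spec, THEN spec, THEN spec, THEN mp, OF n(1),
                THEN mp, THEN mp, OF _ A(1), THEN mp, THEN mp] by (simp only:)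
        qed
        show "map card As = map (\<lambda>e. n ^ e) (part_exponents c k ss)" using As As0 by (simp add: es_def)
        show "finite A \<and> A \<subseteq> V" if "A \<in> set As" for A using As(3) that finite_subset[of A V] V(1) by simp
        show "prod_list (map card As) \<le> card {xs \<in> listset As. set xs \<in> red} * n ^ k" using As by simp
      qed auto
      then obtain Ss where Ss': "length Ss = length ss \<and>
          (\<forall>i<length ss. Ss ! i \<subseteq> As ! i \<and> card (Ss ! i) = ss ! i \<and> P (ss ! i) (Ss ! i)) \<and>
          listset Ss \<subseteq> {xs \<in> listset As. set xs \<in> red}" by (rule exE)
      note lenS = conjunct1[OF Ss'] and Ss = conjunct1[OF conjunct2[OF Ss']] and box = conjunct2[OF conjunct2[OF Ss']]
      have SsA: "Ss ! i \<subseteq> As ! i" if "i < k" for i using Ss that len by simp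
      have SsV: "Ss ! i \<subseteq> V" if "i < k" for i
      proof -
        have "As ! i \<in> set As" using that lenA by simp
        then show ?thesis using SsA[OF that] As(3) by blast
      qed
      have finS: "finite (Ss ! i)" if "i < k" for i using SsV[OF that] V(1) by (rule finite_subset)
      have disj: "i = j" if "i < k" "j < k" "x \<in> Ss ! i" "x \<in> Ss ! j" for i j x
      proof (rule disjoint_list_nth[OF As(2)])
        show "x \<in> As ! i" "x \<in> As ! j" using SsA[OF that(1)] SsA[OF that(2)] that(3,4) by auto
      qed (use that lenA in simp_all)
      have disjS: "disjoint_list Ss" unfolding sorted_wrt_iff_nth_less
      proof (intro allI impI)
        fix i j assume "i < j" "j < length Ss"
        then show "Ss ! i \<inter> Ss ! j = {}" using disj[of i j] lenS len by auto
      qed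
      define S where "S = (\<Union>i<k. Ss ! i)"
      have "card S = (\<Sum>i<k. card (Ss ! i))" unfolding S_def
        using finS disj by (intro card_UN_disjoint) auto
      also have "\<dots> = (\<Sum>i<k. ss ! i)" using Ss len by simp
      also have "\<dots> = s" using sum len by (simp add: sum_list_sum_nth atLeast0LessThan)
      finally have cS: "card S = s" .
      have SV: "S \<subseteq> V" using SsV by (auto simp: S_def)
      have finSS: "finite S" using SV V(1) by (rule finite_subset)
      define I where "I i = {e \<in> red. e \<subseteq> Ss ! i \<and> card e = k}" for i
      define T where "T = set ` listset Ss"
      have Tprop: "e \<subseteq> S \<and> card e = k \<and> e \<in> red" if "e \<in> T" for e
      proof -
        obtain xs where xs: "xs \<in> listset Ss" "e = set xs" using \<open>e \<in> T\<close> by (auto simp: T_def)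
        have "e \<subseteq> S"
        proof
          fix x assume "x \<in> e"
          then obtain i where i: "i < length xs" "x = xs ! i" by (auto simp: xs in_set_conv_nth)
          then have "i \<in> {..<k}" "x \<in> Ss ! i" using listset_nth[OF xs(1)] lenS len by simp_all
          then show "x \<in> S" unfolding S_def by (rule UN_I)
        qed
        moreover have "card e = k" using card_set_transversal[OF disjS xs(1)] lenS len xs by simp
        moreover have "e \<in> red" using box xs by auto
        ultimately show ?thesis by simp
      qed
      have finI: "finite (I i)" if "i < k" for i using finS[OF that] by (simp add: I_def)
      have "card (\<Union>i<k. I i) = (\<Sum>i<k. card (I i))"
      proof (rule card_UN_disjoint)
        show "\<forall>i\<in>{..<k}. \<forall>j\<in>{..<k}. i \<noteq> j \<longrightarrow> I i \<inter> I j = {}"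
        proof (intro ballI impI, rule ccontr)
          fix i j assume ij: "i \<in> {..<k}" "j \<in> {..<k}" "i \<noteq> j" "I i \<inter> I j \<noteq> {}"
          then obtain e where e: "e \<subseteq> Ss ! i" "e \<subseteq> Ss ! j" "card e = k" by (auto simp: I_def)
          then obtain x where "x \<in> e" using k by fastforce
          then show False using disj[of i j x] e ij by auto
        qed
      qed (use finI in auto)
      moreover have "g k (ss ! i) \<le> card (I i)" if "i < k" for i
        using Ss that len by (simp add: I_def P_def)
      then have "(\<Sum>i<k. g k (ss ! i)) \<le> (\<Sum>i<k. card (I i))" by (intro sum_mono) simp
      moreover have "sum_list (map (g k) ss) = (\<Sum>i<k. g k (ss ! i))"
        using len by (simp add: sum_list_sum_nth atLeast0LessThan)
      moreover have "card T = prod_list ss"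
      proof -
        have "card T = card (listset Ss)" unfolding T_def by (rule card_image[OF inj_on_set_listset[OF disjS]])
        also have "\<dots> = prod_list (map card Ss)" by (rule card_listset)
        also have "map card Ss = ss" using Ss lenS by (intro nth_equalityI) auto
        finally show ?thesis .
      qed
      \<comment> \<open>Transversals come on top of the edges inside the parts: as
        \<open>k \<ge> 2\<close>, a transversal has a vertex outside any given part.\<close>
      moreover have "card (T \<union> (\<Union>i<k. I i)) = card T + card (\<Union>i<k. I i)"
      proof (rule card_Un_disjoint)
        have "T \<subseteq> Pow S" using Tprop by auto
        then show "finite T" using finSS by (simp add: finite_subset)
        show "finite (\<Union>i<k. I i)" using finI by auto
        show "T \<inter> (\<Union>i<k. I i) = {}"
        proof (rule ccontr)
          assume "T \<inter> (\<Union>i<k. I i) \<noteq> {}"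
          then obtain xs i where xs: "xs \<in> listset Ss" "i < k" "set xs \<subseteq> Ss ! i" by (auto simp: T_def I_def)
          define j where "j = (if i = 0 then 1 else 0 :: nat)"
          have j: "j < k" "j \<noteq> i" using k by (auto simp: j_def)
          have lx: "length xs = k" "xs ! j \<in> Ss ! j" using listset_nth[OF xs(1)] lenS len j by auto
          then have "xs ! j \<in> Ss ! i" using xs(3) j nth_mem by blast
          then show False using disj[OF j(1) xs(2) lx(2)] j by blast
        qed
      qed
      moreover have "card (T \<union> (\<Union>i<k. I i)) \<le> card {e \<in> red. e \<subseteq> S \<and> card e = k}"
      proof (rule card_mono)
        show "finite {e \<in> red. e \<subseteq> S \<and> card e = k}" using finSS by simp
        show "T \<union> (\<Union>i<k. I i) \<subseteq> {e \<in> red. e \<subseteq> S \<and> card e = k}"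
          using Tprop by (auto simp: I_def S_def)
      qed
      ultimately have "g k s \<le> card {e \<in> red. e \<subseteq> S \<and> card e = k}" unfolding ss(2) by linarith
      then show "\<exists>S\<subseteq>V. card S = s \<and> g k s \<le> card {e \<in> red. e \<subseteq> S \<and> card e = k}"
        using SV cS by (intro exI[of _ S] conjI)
    qed
  qed
qed

lemma poly_bounded_le_g:
  assumes k: "2 \<le> k" "k \<le> s" and t: "t \<le> g k s"
  shows "poly_bounded_r k s t"
proof -
  obtain c where c: "\<forall>n (V :: nat set) red. k \<le> n \<longrightarrow> s \<le> n \<longrightarrow> finite V \<longrightarrow> n ^ c \<le> card V \<longrightarrow>
    (\<forall>W. W \<subseteq> V \<longrightarrow> card W = n \<longrightarrow> (\<exists>e\<in>red. e \<subseteq> W \<and> card e = k)) \<longrightarrow>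
    (\<exists>S\<subseteq>V. card S = s \<and> g k s \<le> card {e \<in> red. e \<subseteq> S \<and> card e = k})"
    using exists_g_dense_set[OF k(1), of s] by (rule exE)
  have "ramsey_prop k s t n (n ^ c)" if n: "s < n" for n
    unfolding ramsey_prop_def
  proof (intro allI impI)
    fix red assume red: "red \<subseteq> {e. e \<subseteq> {..<n ^ c} \<and> card e = k}"
    show "(\<exists>V. V \<subseteq> {..<n ^ c} \<and> card V = n \<and> (\<forall>e. e \<subseteq> V \<and> card e = k \<longrightarrow> e \<notin> red))
      \<or> (\<exists>S. S \<subseteq> {..<n ^ c} \<and> card S = s \<and> t \<le> card {e \<in> red. e \<subseteq> S})"
    proof (rule disjCI)
      assume neg: "\<not> (\<exists>S. S \<subseteq> {..<n ^ c} \<and> card S = s \<and> t \<le> card {e \<in> red. e \<subseteq> S})"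
      show "\<exists>V. V \<subseteq> {..<n ^ c} \<and> card V = n \<and> (\<forall>e. e \<subseteq> V \<and> card e = k \<longrightarrow> e \<notin> red)"
      proof (rule ccontr)
        assume "\<not> ?thesis"
        then have "\<forall>W. W \<subseteq> {..<n ^ c} \<longrightarrow> card W = n \<longrightarrow> (\<exists>e\<in>red. e \<subseteq> W \<and> card e = k)" by blast
        then obtain S where S: "S \<subseteq> {..<n ^ c}" "card S = s" "g k s \<le> card {e \<in> red. e \<subseteq> S \<and> card e = k}"
          using c[rule_format, of n "{..<n ^ c}" red] n k by auto
        have "{e \<in> red. e \<subseteq> S \<and> card e = k} = {e \<in> red. e \<subseteq> S}" using red by auto
        then have "t \<le> card {e \<in> red. e \<subseteq> S}" using S(3) t by simp
        then show False using neg S by blast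
      qed
    qed
  qed
  then have "(\<exists>N. ramsey_prop k s t n N) \<and> r k s t n \<le> 1 * n ^ c" if "s < n" for n
    using that unfolding r_def by (auto intro: Least_le)
  then show ?thesis unfolding poly_bounded_r_def by blast
qed

section \<open>Super-polynomial growth and the threshold\<close>

lemma exists_power_less_exp: "\<exists>w>s. A * w ^ D < (2::nat) ^ w"
proof -
  \<comment> \<open>The choice makes the coefficient at most \<open>v\<close>, so the left side is
    at most \<open>v ^ (D + 1)\<close> and hence at most \<open>2 ^ (v * (D + 1))\<close>, while
    \<open>w\<close> exceeds \<open>v * (D + 1)\<close>.\<close>
  define v where "v = A * (D + 2) ^ D + s + 1"
  define w where "w = (D + 2) * v"
  have "A * w ^ D = (A * (D + 2) ^ D) * v ^ D" unfolding w_def by (simp only: power_mult_distrib mult.assoc)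
  also have "\<dots> \<le> v * v ^ D" by (intro mult_right_mono) (simp_all add: v_def)
  also have "\<dots> = v ^ (D + 1)" by simp
  also have "\<dots> \<le> (2 ^ v) ^ (D + 1)" by (intro power_mono) (simp_all add: less_imp_le)
  also have "\<dots> = 2 ^ (v * (D + 1))" by (simp only: power_mult)
  also have "\<dots> < 2 ^ w" by (intro power_strict_increasing) (simp_all add: w_def v_def)
  finally have "A * w ^ D < 2 ^ w" .
  moreover have "s < w" by (simp add: w_def v_def)
  ultimately show ?thesis by blast
qed

text \<open>The size \<open>n\<close> in the construction is at most \<open>K * w ^ j\<close>, so a
  bound polynomial in \<open>n\<close> is polynomial in \<open>w\<close> and falls below
  \<open>2 ^ w\<close> for a suitable \<open>w\<close>. Then the Ramsey property would hold at
  \<open>2 ^ w\<close>, against \<open>not_ramsey_prop\<close>.\<close>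

lemma not_poly_bounded_g:
  assumes k: "4 \<le> k"
  shows "\<not> poly_bounded_r k s (g k s + 1)"
proof
  assume "poly_bounded_r k s (g k s + 1)"
  then obtain C d where Cd: "\<And>n. s < n \<Longrightarrow>
      (\<exists>N. ramsey_prop k s (g k s + 1) n N) \<and> r k s (g k s + 1) n \<le> C * n ^ d"
    unfolding poly_bounded_r_def by blast
  define j where "j = (k choose 2) + 3"
  define K where "K = 2 * k * (2 * k) ^ j"
  obtain w where w: "s < w" "(C * K ^ d) * w ^ (j * d) < 2 ^ w" using exists_power_less_exp by blast
  define M where "M = 2 * k * w"
  define n where "n = k * M + M * (k * M ^ ((k choose 2) + 2))"
  have w1: "1 \<le> w" using w by simp
  have M1: "1 \<le> M" using k w1 by (simp add: M_def)
  have "M * (k * M ^ ((k choose 2) + 2)) = k * M ^ j" by (simp add: j_def eval_nat_numeral)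
  then have "n = k * M + k * M ^ j" by (simp only: n_def)
  also have "k * M ^ 1 \<le> k * M ^ j" using M1 by (intro mult_left_mono power_increasing) (auto simp: j_def)
  then have "k * M + k * M ^ j \<le> 2 * k * M ^ j" by simp
  finally have "n \<le> 2 * k * M ^ j" .
  also have "2 * k * M ^ j = K * w ^ j" by (simp add: K_def M_def power_mult_distrib)
  finally have "n ^ d \<le> (K * w ^ j) ^ d" by (rule power_mono) simp
  then have "C * n ^ d \<le> (C * K ^ d) * w ^ (j * d)" by (simp add: power_mult_distrib power_mult mult.assoc)
  then have small: "C * n ^ d < 2 ^ w" using w by linarith
  have "w \<le> n"
  proof -
    have "1 * w \<le> (k * (2 * k)) * w" using k by (intro mult_right_mono) auto
    then show ?thesis by (simp add: n_def M_def mult.assoc trans_le_add1)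
  qed
  then have sn: "s < n" using w by simp
  have "ramsey_prop k s (g k s + 1) n (r k s (g k s + 1) n)"
    unfolding r_def using conjunct1[OF Cd[OF sn]] by (rule LeastI_ex)
  moreover have "r k s (g k s + 1) n \<le> 2 ^ w" using conjunct2[OF Cd[OF sn]] small by linarith
  ultimately have "ramsey_prop k s (g k s + 1) n (2 ^ w)" by (rule ramsey_prop_mono)
  moreover have "gbal k s + 1 \<le> g k s + 1" using gbal_le_g[of k s] k by simp
  ultimately have "ramsey_prop k s (gbal k s + 1) n (2 ^ w)" by (rule ramsey_prop_antimono)
  then show False using not_ramsey_prop[OF k w1 M_def n_def] by (rule notE[rotated])
qed

theorem theorem1p5:
  fixes k s :: nat
  assumes "4 \<le> k" and "k \<le> s"
  shows "h1 k s = g k s + 1"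
  unfolding h1_def
proof (rule Least_equality)
  show "2 \<le> g k s + 1 \<and> \<not> poly_bounded_r k s (g k s + 1)"
    using g_pos[of k s] not_poly_bounded_g assms by auto
  show "g k s + 1 \<le> t" if "2 \<le> t \<and> \<not> poly_bounded_r k s t" for t
    using poly_bounded_le_g[of k s t] assms that by (auto simp: not_less_eq_eq[symmetric])
qed

end
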